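(* Let $m\ge 2$ be an integer and let $B_r:=\{x\in\mathbb{R}^{2m}:|x|<r\}$. For any $\Lambda\in(0,\Lambda_1)$ there exists a sequence $(u_k)_{k\in\mathbb{N}}$ of solutions to $$(-\Delta)^m u_k=e^{2mu_k}\quad\text{in }B_2$$ such that $$\int_{B_2}e^{2mu_k}\,dx=\Lambda\quad\text{for all }k,$$ and, for some constant $C$ independent of $k$, $$\int_{B_1}|\Delta u_k|\,dx\le C\ \text{ for all }k,\qquad \int_{B_2}(\Delta u_k)^-\,dx\to\infty\ \text{ as }k\to\infty.$$
   Context: $\Lambda_1:=(2m-1)!\,\mathrm{vol}(S^{2m})$, where $S^{2m}$ is the unit sphere in $\mathbb{R}^{2m+1}$. For a real-valued function $h$, $h^-:=\max\{-h,0\}$ is its negative part. A solution is a function $u_k\in C^{2m-1}(B_2)$ satisfying the equation in the sense of distributions. *)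

theory Defs
  imports "HOL-Analysis.Analysis"
begin

text \<open>For open \<open>S\<close>: all derivatives up to order \<open>k\<close> exist and are continuous on \<open>S\<close>.
  Only \<open>f\<close> on \<open>S\<close> matters, since the Frechet derivatives are taken at interior points.\<close>

primrec C_on :: "nat \<Rightarrow> 'a::euclidean_space set \<Rightarrow> ('a \<Rightarrow> real) \<Rightarrow> bool" where
  "C_on 0 S f \<longleftrightarrow> continuous_on S f"
| "C_on (Suc k) S f \<longleftrightarrow> (\<forall>x\<in>S. f differentiable (at x)) \<and>
     (\<forall>v. C_on k S (\<lambda>x. frechet_derivative f (at x) v))"

definition laplacian :: "('a::euclidean_space \<Rightarrow> real) \<Rightarrow> 'a \<Rightarrow> real" where
  "laplacian f x =
     (\<Sum>b\<in>Basis. frechet_derivative (\<lambda>y. frechet_derivative f (at y) b) (at x) b)"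

definition neg_laplacian_power ::
    "nat \<Rightarrow> ('a::euclidean_space \<Rightarrow> real) \<Rightarrow> 'a \<Rightarrow> real" where
  "neg_laplacian_power m = (\<lambda>f x. - laplacian f x) ^^ m"

definition test_function_on :: "'a::euclidean_space set \<Rightarrow> ('a \<Rightarrow> real) \<Rightarrow> bool" where
  "test_function_on U \<phi> \<longleftrightarrow> (\<forall>k. C_on k UNIV \<phi>) \<and>
     compact (closure {x. \<phi> x \<noteq> 0}) \<and> closure {x. \<phi> x \<noteq> 0} \<subseteq> U"

text \<open>\<open>(-\<Delta>)\<^sup>m u = f\<close> on the open set \<open>U\<close> in the sense of distributions, intended for
  \<open>u\<close> and \<open>f\<close> locally integrable on \<open>U\<close> (here both are continuous there).\<close>

definition polyharmonic_eq_distr ::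
    "nat \<Rightarrow> 'a::euclidean_space set \<Rightarrow> ('a \<Rightarrow> real) \<Rightarrow> ('a \<Rightarrow> real) \<Rightarrow> bool" where
  "polyharmonic_eq_distr m U u f \<longleftrightarrow> (\<forall>\<phi>. test_function_on U \<phi> \<longrightarrow>
     (LINT x:U|lborel. u x * neg_laplacian_power m \<phi> x) = (LINT x:U|lborel. f x * \<phi> x))"

definition Q_solution :: "nat \<Rightarrow> 'a::euclidean_space set \<Rightarrow> ('a \<Rightarrow> real) \<Rightarrow> bool" where
  "Q_solution m U u \<longleftrightarrow> C_on (2 * m - 1) U u \<and>
     polyharmonic_eq_distr m U u (\<lambda>x. exp (2 * real m * u x))"

text \<open>Surface measure of a subset \<open>A\<close> of the unit sphere, in polar-coordinate normalization:
  it is the measure \<open>\<sigma>\<close> with \<open>dx = r\<^bsup>n-1\<^esup> dr d\<sigma>\<close>, so the cone over \<open>A\<close> with apex \<open>0\<close> has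
  Lebesgue measure \<open>\<sigma> A / n\<close>, where \<open>n\<close> is the dimension of the ambient space.\<close>

definition sphere_vol :: "'a::euclidean_space set \<Rightarrow> real" where
  "sphere_vol A =
     real DIM('a) * measure lebesgue {t *\<^sub>R x |t x. 0 < t \<and> t \<le> 1 \<and> x \<in> A}"

lemma sphere_vol_sphere:
  "sphere_vol (sphere (0::'a::euclidean_space) 1) = real DIM('a) * unit_ball_vol (real DIM('a))"
proof -
  have "{t *\<^sub>R x |t x. 0 < t \<and> t \<le> 1 \<and> x \<in> sphere (0::'a) 1} = cball 0 1 - {0}"
  proof (intro equalityI subsetI)
    fix y :: 'a assume "y \<in> cball 0 1 - {0}"
    then have "y = norm y *\<^sub>R (inverse (norm y) *\<^sub>R y)" "0 < norm y" "norm y \<le> 1"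
      "inverse (norm y) *\<^sub>R y \<in> sphere 0 1" by auto
    then show "y \<in> {t *\<^sub>R x |t x. 0 < t \<and> t \<le> 1 \<and> x \<in> sphere (0::'a) 1}" by blast
  qed auto
  moreover have "measure lebesgue (cball 0 1 - {0::'a}) = measure lebesgue (cball (0::'a) 1)"
    by (rule measure_Diff_null_set) auto
  moreover have "measure lebesgue (cball (0::'a) 1) = unit_ball_vol (real DIM('a))"
    by (simp add: content_cball)
  ultimately show ?thesis by (simp add: sphere_vol_def)
qed

end

theory Submission
  imports Defs
begin

text \<open>In dimension \<open>n = 2 m\<close> the equation is conformally invariant, so an inversion with pole \<open>c\<close>
  turns a solution depending on one coordinate only into another solution: if
  \<open>f\<^sup>(\<^sup>2\<^sup>m\<^sup>) = (-1)\<^sup>m e\<^bsup>2 m f\<^esup>\<close> on an interval and \<open>t = ((x - c) \<bullet> e) / |x - c|\<^sup>2\<close>, then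
  \<open>u = f(t) - 2 ln |x - c|\<close> solves \<open>(-\<Delta>)\<^sup>m u = e\<^bsup>2 m u\<^esup>\<close>. Take \<open>f\<close> close to
  \<open>- a - t\<^bsup>2 m - 2\<^esup>\<close> with \<open>a\<close> large and the pole at distance \<open>d\<close> outside \<open>B\<^sub>2\<close>. The mass on \<open>B\<^sub>2\<close> depends
  continuously on \<open>d\<close>; it is small for \<open>d = 1\<close> and large for small \<open>d\<close>, so some \<open>d\<close> gives exactly
  \<open>\<Lambda>\<close>, and \<open>d \<rightarrow> 0\<close> as \<open>a \<rightarrow> \<infinity>\<close>. On \<open>B\<^sub>1\<close>, away from the pole, \<open>\<Delta> u\<close> is bounded,
  while in a cone with apex \<open>c\<close> one has \<open>- \<Delta> u \<ge> const |x - c|\<^bsup>- 2 m\<^esup>\<close>, whose integral over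
  \<open>B\<^sub>2\<close> diverges logarithmically as \<open>d \<rightarrow> 0\<close>.\<close>

subsection \<open>Smooth functions\<close>

text \<open>One parameter \<open>K\<close> sets all scales:
  \<open>exp (2 * real m * a) = K ^ 5\<close>, |t| < \<open>K ^ 2\<close>, and pole distance at
  least \<open>1 / K ^ 2\<close>. The \<open>2 m\<close>-th derivative kills
  \<open>- a - t ^ (2 * m - 2)\<close>, so only a source of size \<open>1 / K ^ 5\<close> disturbs
  it; two extra powers of t cost at most \<open>K ^ 4\<close>, which leaves relative errors
  \<open>1 / K\<close>. The even degree gives f \<le> - a. The degree 2 m - 2 makes |x - c|^(-4)
  f''(t) of order |x - c|^(-2m) in a cone, the borderline rate in dimension 2 m. The term with t
  f'(t) has the same order and the opposite sign, so the cone must be steep against e; yet not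
  orthogonal to it, since \<open>t ^ (2 * m - 4)\<close> vanishes there for m > 2. The decay of exp
  (2 m f) is the obstacle to large mass, because |t| is mostly huge near the pole. Only a thin box
  with |t| \<le> 1 is used: for d = \<open>1 / K ^ 2\<close> its volume is about d^(2m+1) and the
  density there about d^(-4m) / K^5, so its mass is about K^(4m-7), which is unbounded because m
  \<ge> 2.\<close>

definition dird :: "'a::euclidean_space \<Rightarrow> ('a \<Rightarrow> real) \<Rightarrow> 'a \<Rightarrow> real" where
  "dird v f = (\<lambda>x. frechet_derivative f (at x) v)"

definition smooth_on :: "'a::euclidean_space set \<Rightarrow> ('a \<Rightarrow> real) \<Rightarrow> bool" where
  "smooth_on S f \<longleftrightarrow> (\<forall>k. C_on k S f)"

lemma dirdI: "(f has_derivative f') (at x) \<Longrightarrow> dird v f x = f' v"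
  unfolding dird_def by (metis frechet_derivative_at)

lemma differentiable_dird:
  "f differentiable (at x) \<Longrightarrow> (f has_derivative (\<lambda>v. dird v f x)) (at x)"
  unfolding dird_def by (simp add: frechet_derivative_works[symmetric])

lemma C_on_Suc: "C_on (Suc k) S f \<longleftrightarrow> (\<forall>x\<in>S. f differentiable (at x)) \<and> (\<forall>v. C_on k S (dird v f))"
  by (simp add: dird_def)

declare C_on.simps(2) [simp del]

lemma C_on_SucI: "(\<And>x. x \<in> S \<Longrightarrow> f differentiable (at x)) \<Longrightarrow> (\<And>v. C_on k S (dird v f)) \<Longrightarrow> C_on (Suc k) S f"
  and C_on_SucD1: "C_on (Suc k) S f \<Longrightarrow> x \<in> S \<Longrightarrow> f differentiable (at x)"
  and C_on_SucD2: "C_on (Suc k) S f \<Longrightarrow> C_on k S (dird v f)"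
  by (simp_all add: C_on_Suc)

lemma laplacian_dird: "laplacian f x = (\<Sum>b\<in>Basis. dird b (dird b f) x)"
  by (simp add: laplacian_def dird_def)

lemma has_derivative_cong_open:
  assumes "open S" "x \<in> S" "\<And>y. y \<in> S \<Longrightarrow> f y = g y"
  shows "(f has_derivative f') (at x) \<longleftrightarrow> (g has_derivative f') (at x)"
  using assms has_derivative_transform_within_open[of f f' x UNIV S g]
    has_derivative_transform_within_open[of g f' x UNIV S f] by auto

text \<open>\<open>frechet_derivative\<close> is a choice from the predicate
  \<open>has_derivative\<close>; two functions that agree near x have the same predicate, hence the
  same choice, also at points of non-differentiability.\<close>

lemma dird_cong:
  assumes "open S" "x \<in> S" "\<And>y. y \<in> S \<Longrightarrow> f y = g y"
  shows "dird v f x = dird v g x"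
  unfolding dird_def frechet_derivative_def
  using has_derivative_cong_open[OF assms] by simp

lemma differentiable_cong:
  assumes "open S" "x \<in> S" "\<And>y. y \<in> S \<Longrightarrow> f y = g y"
  shows "f differentiable (at x) \<longleftrightarrow> g differentiable (at x)"
  unfolding differentiable_def using has_derivative_cong_open[OF assms] by simp

lemma laplacian_cong:
  assumes "open S" "x \<in> S" "\<And>y. y \<in> S \<Longrightarrow> f y = g y"
  shows "laplacian f x = laplacian g x"
  unfolding laplacian_dird
  by (intro sum.cong refl dird_cong[OF assms(1,2)] dird_cong[OF assms(1)] assms(3))

lemma C_on_cong:
  assumes "open S" "\<And>y. y \<in> S \<Longrightarrow> f y = g y"
  shows "C_on k S f \<longleftrightarrow> C_on k S g"
  using assms(2)
proof (induction k arbitrary: f g)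
  case 0
  then show ?case by (metis C_on.simps(1) continuous_on_cong)
next
  case (Suc k)
  have "C_on k S (dird v f) \<longleftrightarrow> C_on k S (dird v g)" for v
  proof (rule Suc.IH)
    fix y assume "y \<in> S"
    from dird_cong[OF assms(1) this Suc.prems] show "dird v f y = dird v g y" .
  qed
  moreover have "f differentiable (at x) \<longleftrightarrow> g differentiable (at x)" if "x \<in> S" for x
    using differentiable_cong[OF assms(1) that Suc.prems] .
  ultimately show ?case
    unfolding C_on_Suc by blast
qed

lemma differentiable_at_imp_continuous_on:
  assumes "\<And>x. x \<in> S \<Longrightarrow> f differentiable (at x)" shows "continuous_on S f"
  using assms differentiable_imp_continuous_within continuous_at_imp_continuous_on by blast

lemma C_on_lower: "C_on (Suc k) S f \<Longrightarrow> C_on k S f"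
proof (induction k arbitrary: f)
  case 0
  then show ?case using differentiable_at_imp_continuous_on C_on_SucD1 by (metis C_on.simps(1))
next
  case (Suc k)
  show ?case
    by (rule C_on_SucI, erule C_on_SucD1[OF Suc.prems], rule Suc.IH, rule C_on_SucD2[OF Suc.prems])
qed

lemma C_on_subset: "C_on k S f \<Longrightarrow> T \<subseteq> S \<Longrightarrow> C_on k T f"
proof (induction k arbitrary: f)
  case 0
  then show ?case using continuous_on_subset by auto
next
  case (Suc k)
  show ?case
    by (rule C_on_SucI, rule C_on_SucD1[OF Suc.prems(1)], use Suc.prems(2) in blast,
        rule Suc.IH[OF C_on_SucD2[OF Suc.prems(1)] Suc.prems(2)])
qed

lemma smooth_on_subset: "smooth_on S f \<Longrightarrow> T \<subseteq> S \<Longrightarrow> smooth_on T f"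
  unfolding smooth_on_def using C_on_subset by blast

lemma smooth_on_cong:
  assumes "open S" "\<And>y. y \<in> S \<Longrightarrow> f y = g y"
  shows "smooth_on S f \<longleftrightarrow> smooth_on S g"
  unfolding smooth_on_def using C_on_cong[OF assms] by simp

lemma smooth_on_differentiable: "smooth_on S f \<Longrightarrow> x \<in> S \<Longrightarrow> f differentiable (at x)"
  unfolding smooth_on_def using C_on_SucD1[of 0] by blast

lemma smooth_on_dird: "smooth_on S f \<Longrightarrow> smooth_on S (dird v f)"
  unfolding smooth_on_def using C_on_SucD2 by metis

lemma smooth_on_continuous: "smooth_on S f \<Longrightarrow> continuous_on S f"
  unfolding smooth_on_def by (metis C_on.simps(1))

lemma dird_const [simp]: "dird v (\<lambda>x. c) = (\<lambda>x. 0)"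
  by (rule ext) (rule dirdI, rule has_derivative_const)

lemma dird_add:
  assumes "f differentiable (at x)" "g differentiable (at x)"
  shows "dird v (\<lambda>x. f x + g x) x = dird v f x + dird v g x"
  by (rule dirdI) (intro has_derivative_add differentiable_dird assms)

lemma dird_mult:
  assumes "f differentiable (at x)" "g differentiable (at x)"
  shows "dird v (\<lambda>x. f x * g x) x = f x * dird v g x + g x * dird v f x"
  by (subst dirdI[OF has_derivative_mult[OF assms[THEN differentiable_dird]]])
    (simp add: algebra_simps)

lemma dird_compose:
  fixes g :: "real \<Rightarrow> real"
  assumes "f differentiable (at x)" "g differentiable (at (f x))"
  shows "dird v (\<lambda>x. g (f x)) x = dird 1 g (f x) * dird v f x"
proof -
  note g = differentiable_dird[OF assms(2)]
  have "dird v (\<lambda>x. g (f x)) x = dird (dird v f x) g (f x)"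
    by (rule dirdI) (rule has_derivative_compose[OF differentiable_dird[OF assms(1)] g])
  also have "\<dots> = dird v f x * dird 1 g (f x)"
    using linear_scale[OF has_derivative_linear[OF g], of "dird v f x" 1] by simp
  finally show ?thesis by (simp add: mult.commute)
qed

lemma C_on_const: "C_on k S (\<lambda>x. c)"
  by (induction k arbitrary: c) (simp_all add: C_on_Suc)

lemma C_on_add:
  assumes "open S" "C_on k S f" "C_on k S g"
  shows "C_on k S (\<lambda>x. f x + g x)"
  using assms(2,3)
proof (induction k arbitrary: f g)
  case 0
  then show ?case by (auto intro: continuous_intros)
next
  case (Suc k)
  have "C_on k S (dird v (\<lambda>x. f x + g x))" for v
    by (subst C_on_cong[OF assms(1), OF dird_add])
      (auto intro: C_on_SucD1[OF Suc.prems(1)] C_on_SucD1[OF Suc.prems(2)]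
        intro!: Suc.IH C_on_SucD2[OF Suc.prems(1)] C_on_SucD2[OF Suc.prems(2)])
  moreover have "(\<lambda>x. f x + g x) differentiable (at x)" if "x \<in> S" for x
    using Suc.prems[THEN C_on_SucD1, OF that] by (rule differentiable_add)
  ultimately show ?case by (intro C_on_SucI)
qed

lemma C_on_mult:
  assumes "open S" "C_on k S f" "C_on k S g"
  shows "C_on k S (\<lambda>x. f x * g x)"
  using assms(2,3)
proof (induction k arbitrary: f g)
  case 0
  then show ?case by (auto intro: continuous_intros)
next
  case (Suc k)
  have "C_on k S (dird v (\<lambda>x. f x * g x))" for v
  proof (subst C_on_cong[OF assms(1), OF dird_mult])
    show "C_on k S (\<lambda>x. f x * dird v g x + g x * dird v f x)"
      by (intro C_on_add assms(1) Suc.IH Suc.prems[THEN C_on_SucD2] Suc.prems[THEN C_on_lower])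
  qed (use Suc.prems[THEN C_on_SucD1] in auto)
  moreover have "(\<lambda>x. f x * g x) differentiable (at x)" if "x \<in> S" for x
    using Suc.prems[THEN C_on_SucD1, OF that] by (rule differentiable_mult)
  ultimately show ?case by (intro C_on_SucI)
qed

text \<open>The inner function has only finite regularity: in this form the regularity of the ODE
  solution can be bootstrapped. The induction ranges over all \<open>g\<close>, because the chain
  rule replaces \<open>g\<close> by its derivative.\<close>

lemma smooth_on_compose_C_on:
  fixes g :: "real \<Rightarrow> real"
  assumes "open S" "C_on k S f" "smooth_on T g" "f ` S \<subseteq> T"
  shows "C_on k S (\<lambda>x. g (f x))"
  using assms(2,3)
proof (induction k arbitrary: g)
  case 0
  then show ?case using continuous_on_compose2[OF smooth_on_continuous _ assms(4)] by simp
next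
  case (Suc k)
  have d: "f differentiable at x" "g differentiable at (f x)" if "x \<in> S" for x
    using C_on_SucD1[OF Suc.prems(1) that] smooth_on_differentiable[OF Suc.prems(2), of "f x"] assms(4) that
    by auto
  have "C_on k S (dird v (\<lambda>x. g (f x)))" for v
  proof -
    have "C_on k S (\<lambda>x. dird 1 g (f x) * dird v f x)"
      by (rule C_on_mult[OF assms(1) Suc.IH[OF C_on_lower[OF Suc.prems(1)] smooth_on_dird[OF Suc.prems(2)]]
          C_on_SucD2[OF Suc.prems(1)]])
    then show ?thesis
      using C_on_cong[OF assms(1), of "dird v (\<lambda>x. g (f x))" "\<lambda>x. dird 1 g (f x) * dird v f x"]
        dird_compose[OF d] by metis
  qed
  moreover have "(\<lambda>x. g (f x)) differentiable (at x)" if "x \<in> S" for x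
    using has_derivative_compose[OF differentiable_dird[OF d(1)[OF that]] differentiable_dird[OF d(2)[OF that]]]
    unfolding differentiable_def by blast
  ultimately show ?case by (rule C_on_SucI[rotated])
qed

lemma smooth_on_const [simp]: "smooth_on S (\<lambda>x. c)"
  by (simp add: smooth_on_def C_on_const)

lemma smooth_on_add: "open S \<Longrightarrow> smooth_on S f \<Longrightarrow> smooth_on S g \<Longrightarrow> smooth_on S (\<lambda>x. f x + g x)"
  by (simp add: smooth_on_def C_on_add)

lemma smooth_on_mult: "open S \<Longrightarrow> smooth_on S f \<Longrightarrow> smooth_on S g \<Longrightarrow> smooth_on S (\<lambda>x. f x * g x)"
  by (simp add: smooth_on_def C_on_mult)

lemma smooth_on_uminus: "open S \<Longrightarrow> smooth_on S f \<Longrightarrow> smooth_on S (\<lambda>x. - f x)"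
  using smooth_on_mult[of S "\<lambda>x. -1" f] by simp

lemma smooth_on_diff: "open S \<Longrightarrow> smooth_on S f \<Longrightarrow> smooth_on S g \<Longrightarrow> smooth_on S (\<lambda>x. f x - g x)"
  using smooth_on_add[OF _ _ smooth_on_uminus, of S f g] by simp

lemma smooth_on_power: "open S \<Longrightarrow> smooth_on S f \<Longrightarrow> smooth_on S (\<lambda>x. f x ^ k)"
  by (induction k) (simp_all add: smooth_on_mult)

lemma smooth_on_sum:
  "open S \<Longrightarrow> (\<And>i. i \<in> I \<Longrightarrow> smooth_on S (f i)) \<Longrightarrow> smooth_on S (\<lambda>x. \<Sum>i\<in>I. f i x)"
  by (induction I rule: infinite_finite_induct) (simp_all add: smooth_on_add)

lemma smooth_on_compose:
  fixes g :: "real \<Rightarrow> real"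
  shows "open S \<Longrightarrow> smooth_on S f \<Longrightarrow> smooth_on T g \<Longrightarrow> f ` S \<subseteq> T \<Longrightarrow> smooth_on S (\<lambda>x. g (f x))"
  unfolding smooth_on_def[of S] using smooth_on_compose_C_on by blast

lemma smooth_on_laplacian: "open S \<Longrightarrow> smooth_on S f \<Longrightarrow> smooth_on S (laplacian f)"
  unfolding laplacian_dird[abs_def] by (intro smooth_on_sum smooth_on_dird)

lemma dird_linear:
  assumes "bounded_linear f" shows "dird v (\<lambda>x. f (x - c)) = (\<lambda>x. f v)"
proof
  fix x show "dird v (\<lambda>x. f (x - c)) x = f v"
    by (rule dirdI) (rule bounded_linear.has_derivative[OF assms], auto intro!: derivative_eq_intros)
qed

lemma smooth_on_linear:
  assumes "bounded_linear f" shows "smooth_on S (\<lambda>x. f (x - c))"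
proof -
  have "((\<lambda>x. f (x - c)) has_derivative (\<lambda>x. f x)) (at x)" for x
    by (rule bounded_linear.has_derivative[OF assms]) (auto intro!: derivative_eq_intros)
  then have d: "(\<lambda>x. f (x - c)) differentiable (at x)" for x
    unfolding differentiable_def by blast
  have "C_on k S (\<lambda>x. f (x - c))" for k
  proof (cases k)
    case 0
    then show ?thesis using d by (simp add: differentiable_at_imp_continuous_on)
  next
    case (Suc j)
    show ?thesis unfolding Suc using d by (intro C_on_SucI) (auto simp: dird_linear[OF assms] C_on_const)
  qed
  then show ?thesis by (simp add: smooth_on_def)
qed

text \<open>The tower of derivatives is carried as explicit data. Smoothness can be read off from
  any such tower, and operators in one variable become index arithmetic.\<close>

definition deriv_seq :: "real set \<Rightarrow> (nat \<Rightarrow> real \<Rightarrow> real) \<Rightarrow> bool" where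
  "deriv_seq T G \<longleftrightarrow> (\<forall>i. \<forall>x\<in>T. (G i has_real_derivative G (Suc i) x) (at x))"

lemma dird_real:
  assumes "(g has_real_derivative d) (at x)" shows "dird v g x = d * v"
  using dirdI[of g "\<lambda>y. d * y" x v] assms
  unfolding has_field_derivative_def[symmetric] by simp

lemma deriv_seq_smooth_on:
  assumes "open T" "deriv_seq T G" shows "smooth_on T (G i)"
proof -
  have d: "G i differentiable (at x)" if "x \<in> T" for i x
    using assms that unfolding deriv_seq_def real_differentiable_def by blast
  have "C_on k T (G i)" for k
  proof (induction k arbitrary: i)
    case 0
    show ?case using d by (simp add: differentiable_at_imp_continuous_on)
  next
    case (Suc k)
    have "C_on k T (dird v (G i))" for v
    proof (subst C_on_cong[OF assms(1)])
      show "dird v (G i) x = G (Suc i) x * v" if "x \<in> T" for x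
        using assms that unfolding deriv_seq_def by (auto intro: dird_real)
      show "C_on k T (\<lambda>x. G (Suc i) x * v)" by (intro C_on_mult assms Suc C_on_const)
    qed
    then show ?case using d by (intro C_on_SucI)
  qed
  then show ?thesis by (simp add: smooth_on_def)
qed

lemma smooth_on_deriv_seq:
  assumes "smooth_on T g" shows "deriv_seq T (\<lambda>i. (dird 1 ^^ i) g)"
proof -
  have s: "smooth_on T ((dird 1 ^^ i) g)" for i
    by (induction i) (auto intro: assms smooth_on_dird)
  show ?thesis unfolding deriv_seq_def
  proof (intro allI ballI)
    fix i x assume x: "x \<in> T"
    let ?h = "(dird 1 ^^ i) g"
    obtain d where d: "(?h has_real_derivative d) (at x)"
      using smooth_on_differentiable[OF s x, of i] unfolding real_differentiable_def by blast
    then show "(?h has_real_derivative (dird 1 ^^ Suc i) g x) (at x)"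
      using dird_real[OF d, of 1] by simp
  qed
qed

text \<open>One tower serves two functions: index 0 is the logarithm and index 1 the
  inverse.\<close>

lemma deriv_seq_ln:
  "deriv_seq {0<..} (\<lambda>i x. case i of 0 \<Rightarrow> ln x | Suc j \<Rightarrow> (-1) ^ j * fact j * inverse x ^ Suc j)"
  unfolding deriv_seq_def
proof (intro allI ballI)
  fix i :: nat and x :: real assume "x \<in> {0<..}"
  then have x: "x > 0" by simp
  show "((\<lambda>x. case i of 0 \<Rightarrow> ln x | Suc j \<Rightarrow> (-1) ^ j * fact j * inverse x ^ Suc j)
    has_real_derivative (case Suc i of 0 \<Rightarrow> ln x | Suc j \<Rightarrow> (-1) ^ j * fact j * inverse x ^ Suc j)) (at x)"
  proof (cases i)
    case 0
    then show ?thesis using DERIV_ln[OF x] by simp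
  next
    case (Suc j)
    have "((\<lambda>x. (-1) ^ j * fact j * inverse x ^ Suc j) has_real_derivative
      (-1) ^ j * fact j * ((1 + of_nat j) * (- (inverse x * 1 * inverse x) * inverse x ^ j))) (at x)"
      using x by (intro DERIV_cmult DERIV_power_Suc DERIV_inverse' DERIV_ident) auto
    then show ?thesis unfolding Suc by (simp add: algebra_simps)
  qed
qed

lemma smooth_on_ln: "smooth_on {0<..} (ln :: real \<Rightarrow> real)"
  and smooth_on_inverse: "smooth_on {0<..} (inverse :: real \<Rightarrow> real)"
  using deriv_seq_smooth_on[OF _ deriv_seq_ln, of 0] deriv_seq_smooth_on[OF _ deriv_seq_ln, of 1] by simp_all

lemma smooth_on_exp: "smooth_on UNIV (exp :: real \<Rightarrow> real)"
  using deriv_seq_smooth_on[of UNIV "\<lambda>_. exp" 0] by (simp add: deriv_seq_def DERIV_exp)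

subsection \<open>Laplacian calculus\<close>

definition grad_inner :: "('a::euclidean_space \<Rightarrow> real) \<Rightarrow> ('a \<Rightarrow> real) \<Rightarrow> 'a \<Rightarrow> real" where
  "grad_inner f g x = (\<Sum>b\<in>Basis. dird b f x * dird b g x)"

lemma grad_inner_commute: "grad_inner f g x = grad_inner g f x"
  by (simp add: grad_inner_def mult.commute)

lemma grad_inner_mult:
  assumes "smooth_on S f" "smooth_on S g" "x \<in> S"
  shows "grad_inner (\<lambda>x. f x * g x) h x = f x * grad_inner g h x + g x * grad_inner f h x"
  using assms by (simp add: grad_inner_def dird_mult smooth_on_differentiable algebra_simps
      sum.distrib sum_distrib_left)

lemma grad_inner_compose:
  assumes "smooth_on S f" "smooth_on T g" "f ` S \<subseteq> T" "x \<in> S"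
  shows "grad_inner (\<lambda>x. g (f x)) h x = dird 1 g (f x) * grad_inner f h x"
proof -
  have "g differentiable (at (f x))" using assms by (auto intro: smooth_on_differentiable)
  then show ?thesis
    using assms by (simp add: grad_inner_def dird_compose smooth_on_differentiable algebra_simps
      sum_distrib_left)
qed

lemma laplacian_const [simp]: "laplacian (\<lambda>x. c) = (\<lambda>x. 0)"
  by (simp add: laplacian_dird[abs_def])

lemma laplacian_add:
  assumes "open S" "smooth_on S f" "smooth_on S g" "x \<in> S"
  shows "laplacian (\<lambda>x. f x + g x) x = laplacian f x + laplacian g x"
proof -
  have "dird b (dird b (\<lambda>x. f x + g x)) x = dird b (dird b f) x + dird b (dird b g) x" for b
  proof (subst dird_cong[OF assms(1,4)])
    show "dird b (\<lambda>x. f x + g x) y = dird b f y + dird b g y" if "y \<in> S" for y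
      using assms that by (simp add: dird_add smooth_on_differentiable)
    show "dird b (\<lambda>x. dird b f x + dird b g x) x = dird b (dird b f) x + dird b (dird b g) x"
      using assms by (intro dird_add smooth_on_differentiable[of S] smooth_on_dird)
  qed
  then show ?thesis by (simp add: laplacian_dird sum.distrib)
qed

lemma laplacian_mult:
  assumes "open S" "smooth_on S f" "smooth_on S g" "x \<in> S"
  shows "laplacian (\<lambda>x. f x * g x) x = f x * laplacian g x + 2 * grad_inner f g x + g x * laplacian f x"
proof -
  have "dird b (dird b (\<lambda>x. f x * g x)) x
    = f x * dird b (dird b g) x + 2 * (dird b f x * dird b g x) + g x * dird b (dird b f) x" for b
  proof (subst dird_cong[OF assms(1,4)])
    show "dird b (\<lambda>x. f x * g x) y = f y * dird b g y + g y * dird b f y" if "y \<in> S" for y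
      using assms that by (simp add: dird_mult smooth_on_differentiable)
    have "dird b (\<lambda>x. f x * dird b g x + g x * dird b f x) x
        = dird b (\<lambda>x. f x * dird b g x) x + dird b (\<lambda>x. g x * dird b f x) x"
      using assms by (intro dird_add smooth_on_differentiable[of S] smooth_on_mult smooth_on_dird)
    also have "\<dots> = (f x * dird b (dird b g) x + dird b g x * dird b f x)
       + (g x * dird b (dird b f) x + dird b f x * dird b g x)"
      using assms by (intro arg_cong2[where f="(+)"] dird_mult smooth_on_differentiable[of S] smooth_on_dird)
    finally show "dird b (\<lambda>x. f x * dird b g x + g x * dird b f x) x
      = f x * dird b (dird b g) x + 2 * (dird b f x * dird b g x) + g x * dird b (dird b f) x"
      by simp
  qed
  then show ?thesis by (simp add: laplacian_dird grad_inner_def sum.distrib sum_distrib_left)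
qed

lemma laplacian_cmult:
  assumes "open S" "smooth_on S f" "x \<in> S"
  shows "laplacian (\<lambda>x. c * f x) x = c * laplacian f x"
  using laplacian_mult[OF assms(1) smooth_on_const assms(2,3), of c]
  by (simp add: grad_inner_def)

lemma laplacian_sum:
  assumes "open S" "\<And>i. i \<in> I \<Longrightarrow> smooth_on S (f i)" "x \<in> S"
  shows "laplacian (\<lambda>x. \<Sum>i\<in>I. f i x) x = (\<Sum>i\<in>I. laplacian (f i) x)"
  using assms(2)
proof (induction I rule: infinite_finite_induct)
  case (insert i I)
  have "laplacian (\<lambda>x. f i x + (\<Sum>i\<in>I. f i x)) x = laplacian (f i) x + laplacian (\<lambda>x. \<Sum>i\<in>I. f i x) x"
    using insert assms by (intro laplacian_add smooth_on_sum) auto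
  then show ?case using insert by simp
qed simp_all

lemma laplacian_compose:
  fixes g :: "real \<Rightarrow> real"
  assumes "open S" "smooth_on S f" "smooth_on T g" "f ` S \<subseteq> T" "x \<in> S"
  shows "laplacian (\<lambda>x. g (f x)) x
    = dird 1 (dird 1 g) (f x) * grad_inner f f x + dird 1 g (f x) * laplacian f x"
proof -
  note smooth_on_dird[OF assms(3), of 1, THEN smooth_on_compose[OF assms(1,2) _ assms(4)]]
  note sg' = this
  have "f x \<in> T" using assms by auto
  have "dird b (dird b (\<lambda>x. g (f x))) x = dird 1 (dird 1 g) (f x) * (dird b f x * dird b f x)
       + dird 1 g (f x) * dird b (dird b f) x" for b
  proof (subst dird_cong[OF assms(1,5)])
    show "dird b (\<lambda>x. g (f x)) y = dird 1 g (f y) * dird b f y" if "y \<in> S" for y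
      using assms that by (intro dird_compose smooth_on_differentiable[of S f] smooth_on_differentiable[of T g]) auto
    have "dird b (\<lambda>x. dird 1 g (f x) * dird b f x) x
        = dird 1 g (f x) * dird b (dird b f) x + dird b f x * dird b (\<lambda>x. dird 1 g (f x)) x"
      using assms sg' by (intro dird_mult smooth_on_differentiable[of S]) (auto intro: smooth_on_dird)
    also have "dird b (\<lambda>x. dird 1 g (f x)) x = dird 1 (dird 1 g) (f x) * dird b f x"
      using assms smooth_on_differentiable[OF smooth_on_dird[OF assms(3)] \<open>f x \<in> T\<close>, of 1]
        smooth_on_differentiable[OF assms(2,5)]
      by (intro dird_compose)
    finally show "dird b (\<lambda>x. dird 1 g (f x) * dird b f x) x = dird 1 (dird 1 g) (f x) * (dird b f x * dird b f x)
       + dird 1 g (f x) * dird b (dird b f) x" by simp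
  qed
  then show ?thesis by (simp add: laplacian_dird grad_inner_def sum.distrib sum_distrib_left)
qed

subsection \<open>Functions of the Kelvin coordinate\<close>

text \<open>The conformal factor of the inversion with pole \<open>c\<close>; by
  \<open>inverse 0 = 0\<close> its value at the pole is 0.\<close>

definition inv_sq :: "'a::euclidean_space \<Rightarrow> 'a \<Rightarrow> real" where
  "inv_sq c x = inverse ((x - c) \<bullet> (x - c))"

definition kelvin :: "'a::euclidean_space \<Rightarrow> 'a \<Rightarrow> 'a \<Rightarrow> real" where
  "kelvin c e x = ((x - c) \<bullet> e) * inv_sq c x"

definition shift_dot :: "'a::euclidean_space \<Rightarrow> 'a \<Rightarrow> 'a \<Rightarrow> real" where
  "shift_dot c e x = (x - c) \<bullet> e"

definition sq :: "'a::euclidean_space \<Rightarrow> 'a \<Rightarrow> real" where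
  "sq c x = (x - c) \<bullet> (x - c)"

lemma sq_pos: "x \<noteq> c \<Longrightarrow> sq c x > 0" by (simp add: sq_def)

lemma inv_sq_eq: "inv_sq c = (\<lambda>x. inverse (sq c x))"
  by (simp add: inv_sq_def sq_def fun_eq_iff)

lemma kelvin_eq: "kelvin c e = (\<lambda>x. shift_dot c e x * inv_sq c x)"
  by (simp add: kelvin_def shift_dot_def fun_eq_iff)

lemma dird_shift_dot: "dird v (shift_dot c e) = (\<lambda>x. v \<bullet> e)"
  unfolding shift_dot_def by (rule dird_linear[OF bounded_linear_inner_left])

lemma smooth_on_shift_dot: "smooth_on S (shift_dot c e)"
  unfolding shift_dot_def by (rule smooth_on_linear[OF bounded_linear_inner_left])

lemma sq_eq_sum: "sq c = (\<lambda>x. \<Sum>b\<in>Basis. shift_dot c b x * shift_dot c b x)"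
  unfolding sq_def shift_dot_def by (rule ext, rule euclidean_inner)

lemma smooth_on_sq: "open S \<Longrightarrow> smooth_on S (sq c)"
  unfolding sq_eq_sum by (intro smooth_on_sum smooth_on_mult smooth_on_shift_dot)

lemma dird_sq: "dird v (sq c) = (\<lambda>x. 2 * shift_dot c v x)"
proof
  fix x show "dird v (sq c) x = 2 * shift_dot c v x"
    unfolding sq_def[abs_def] shift_dot_def
    by (rule dirdI[of _ "\<lambda>v. 2 * ((x - c) \<bullet> v)"])
      (auto intro!: derivative_eq_intros simp: inner_commute)
qed

lemma dird_cmult: "f differentiable (at x) \<Longrightarrow> dird v (\<lambda>x. a * f x) x = a * dird v f x"
  by (simp add: dird_mult[of "\<lambda>x. a"])

lemma laplacian_shift_dot: "laplacian (shift_dot c e) x = 0"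
  by (simp add: laplacian_dird dird_shift_dot)

lemma laplacian_sq: "laplacian (sq c :: 'a::euclidean_space \<Rightarrow> real) x = 2 * real DIM('a)"
  by (simp add: laplacian_dird dird_sq dird_cmult smooth_on_differentiable[OF smooth_on_shift_dot, of _ UNIV]
      dird_shift_dot)

lemma grad_inner_sq: "grad_inner (sq c) (sq c) x = 4 * sq c x"
  by (simp add: grad_inner_def dird_sq fun_cong[OF sq_eq_sum, of c x] sum_distrib_left)

lemma grad_inner_shift_dot: "grad_inner (shift_dot c e) (shift_dot c e) x = e \<bullet> e"
  unfolding grad_inner_def dird_shift_dot by (subst euclidean_inner[of e e]) (simp only: inner_commute)

lemma grad_inner_sq_shift_dot: "grad_inner (sq c) (shift_dot c e) x = 2 * shift_dot c e x"
proof -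
  have "(\<Sum>b\<in>Basis. (x - c) \<bullet> b * (b \<bullet> e)) = (x - c) \<bullet> e"
    by (subst euclidean_inner[of "x - c" e]) (simp add: inner_commute)
  then show ?thesis
    unfolding grad_inner_def dird_sq dird_shift_dot
    by (simp add: shift_dot_def sum_distrib_left[symmetric] mult.assoc)
qed

lemma dird_inverse: "x > 0 \<Longrightarrow> dird 1 inverse x = - (inverse x)\<^sup>2"
  using dird_real[OF DERIV_inverse, of x 1] by (simp add: power2_eq_square)

lemma dird_dird_inverse:
  assumes "x > 0" shows "dird 1 (dird 1 inverse) x = 2 * inverse x ^ 3"
proof -
  have "dird 1 (dird 1 inverse) x = dird 1 (\<lambda>x. - (inverse x)\<^sup>2) x"
    by (rule dird_cong[of "{0<..}"]) (use assms in \<open>auto simp: dird_inverse\<close>)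
  also have "\<dots> = 2 * inverse x ^ 3 * 1"
    by (rule dird_real) (use assms in \<open>auto intro!: derivative_eq_intros simp: power2_eq_square power3_eq_cube\<close>)
  finally show ?thesis by simp
qed

text \<open>If \<open>G i\<close> is the \<open>i\<close>-th derivative of \<open>g\<close>, then \<open>eul a G i\<close> is that of \<open>s g'(s) + a g(s)\<close>.\<close>

definition eul :: "nat \<Rightarrow> (nat \<Rightarrow> real \<Rightarrow> real) \<Rightarrow> nat \<Rightarrow> real \<Rightarrow> real" where
  "eul a G = (\<lambda>i s. s * G (Suc i) s + real (a + i) * G i s)"

lemma deriv_seq_eul: "deriv_seq T G \<Longrightarrow> deriv_seq T (eul a G)"
  unfolding deriv_seq_def
proof (intro allI ballI)
  fix i s assume "\<forall>i. \<forall>x\<in>T. (G i has_real_derivative G (Suc i) x) (at x)" "s \<in> T"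
  then have "(G i has_real_derivative G (Suc i) s) (at s)" for i by blast
  then have "((\<lambda>s. s * G (Suc i) s + real (a + i) * G i s) has_real_derivative
      (1 * G (Suc i) s + G (Suc (Suc i)) s * s + real (a + i) * G (Suc i) s)) (at s)"
    by (intro DERIV_add DERIV_mult DERIV_ident DERIV_cmult)
  then show "(eul a G i has_real_derivative eul a G (Suc i) s) (at s)"
    by (simp add: eul_def algebra_simps)
qed

lemma deriv_seq_shift: "deriv_seq T G \<Longrightarrow> deriv_seq T (\<lambda>i. G (i + k))"
  unfolding deriv_seq_def by simp

lemma dird_deriv_seq:
  assumes "open T" "deriv_seq T G" "s \<in> T"
  shows "dird 1 (G i) s = G (Suc i) s" "dird 1 (dird 1 (G i)) s = G (Suc (Suc i)) s"
proof -
  have d: "dird 1 (G i) s = G (Suc i) s" if "s \<in> T" for i s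
    using assms that dird_real[of "G i" "G (Suc i) s" s 1] by (simp add: deriv_seq_def)
  then show "dird 1 (G i) s = G (Suc i) s" using assms by simp
  have "dird 1 (dird 1 (G i)) s = dird 1 (G (Suc i)) s"
    by (rule dird_cong[OF assms(1,3)]) (rule d)
  then show "dird 1 (dird 1 (G i)) s = G (Suc (Suc i)) s" using d assms by simp
qed

text \<open>A rising product of Euler operators: with D = s d/ds it is (D + a) (D + a + 1) ... (D +
  a + k - 1).\<close>

fun euls :: "nat \<Rightarrow> nat \<Rightarrow> (nat \<Rightarrow> real \<Rightarrow> real) \<Rightarrow> nat \<Rightarrow> real \<Rightarrow> real" where
  "euls a 0 G = G"
| "euls a (Suc k) G = eul (a + k) (euls a k G)"

lemma deriv_seq_euls: "deriv_seq T G \<Longrightarrow> deriv_seq T (euls a k G)"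
  by (induction k) (auto intro: deriv_seq_eul)

text \<open>Two derivatives pass an Euler operator at the price of raising its weight by 2.\<close>

lemma euls_shift: "euls a k G (i + 2) = euls (a + 2) k (\<lambda>i. G (i + 2)) i"
proof (induction k arbitrary: i)
  case (Suc k)
  show ?case
    using Suc[of i] Suc[of "Suc i"] by (simp add: eul_def fun_eq_iff algebra_simps)
qed simp

text \<open>The closed form of the coefficients in the k-th Laplacian of a function of
  \<open>kelvin\<close> in dimension \<open>n\<close>; it solves the recurrence that
  \<open>laplacian_kterm\<close> produces.\<close>

definition kcoef :: "real \<Rightarrow> nat \<Rightarrow> nat \<Rightarrow> real" where
  "kcoef n k j = (k choose j) * (\<Prod>i\<in>{j<..k}. 4 * real i - 2 * n)"

lemma kcoef_Suc_0:
  fixes n :: real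
  shows "kcoef n (Suc k) 0 = (4 * k + 4 - 2 * n) * kcoef n k 0"
proof -
  have "{0<..Suc k} = insert (Suc k) {0<..k}" by auto
  then show ?thesis by (simp add: kcoef_def)
qed

text \<open>After Pascal's rule and cancellation of the common product, the recurrence is the
  absorption identity (j + 1) (k choose j + 1) = (k - j) (k choose j); the dimension drops out. For
  j = k the second summand vanishes.\<close>

lemma kcoef_Suc_Suc:
  fixes n :: real
  assumes "j \<le> k"
  shows "kcoef n (Suc k) (Suc j) = kcoef n k j + (4 * (k + Suc j) + 4 - 2 * n) * kcoef n k (Suc j)"
proof (cases "j = k")
  case True then show ?thesis by (simp add: kcoef_def)
next
  case False
  then have j: "j < k" using assms by simp
  define P where "P = (\<Prod>i\<in>{Suc j<..k}. 4 * real i - 2 * n)"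
  have "{j<..k} = insert (Suc j) {Suc j<..k}" "{Suc j<..Suc k} = insert (Suc k) {Suc j<..k}"
    using j by auto
  then have P: "(\<Prod>i\<in>{j<..k}. 4 * real i - 2 * n) = (4 * real (Suc j) - 2 * n) * P"
    "(\<Prod>i\<in>{Suc j<..Suc k}. 4 * real i - 2 * n) = (4 * real (Suc k) - 2 * n) * P"
    by (simp_all add: P_def)
  have "Suc j * (k choose Suc j) = (k - j) * (k choose j)"
    by (metis binomial_absorb_comp binomial_absorption mult.commute)
  then have "real (Suc j) * real (k choose Suc j) = real (k - j) * (k choose j)"
    by (metis of_nat_mult)
  then have a: "(1 + real j) * (k choose Suc j) = (real k - real j) * (k choose j)"
    using j by (simp add: of_nat_diff)
  have "(real (k choose j) + (k choose Suc j)) * (4 * real (Suc k) - 2 * n)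
     = (k choose j) * (4 * real (Suc j) - 2 * n) + (4 * (k + Suc j) + 4 - 2 * n) * (k choose Suc j)"
    using a by (simp add: algebra_simps)
  then show ?thesis
    unfolding kcoef_def P P_def[symmetric] by (simp add: algebra_simps)
qed

section \<open>Derivatives of the conformal factor and of the Kelvin coordinate\<close>

context
  fixes c e :: "'a::euclidean_space"
  assumes e: "e \<bullet> e = 1"
begin

lemma sq_image: "sq c ` (- {c}) \<subseteq> {0<..}"
  using sq_pos by auto

lemma open_punctured: "open (- {c})" by (intro open_Compl closed_singleton)

lemma smooth_on_inv_sq: "smooth_on (- {c}) (inv_sq c)"
  unfolding inv_sq_eq
  by (rule smooth_on_compose[OF open_punctured smooth_on_sq[OF open_punctured] smooth_on_inverse sq_image])

lemma smooth_on_kelvin: "smooth_on (- {c}) (kelvin c e)"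
  unfolding kelvin_eq by (rule smooth_on_mult[OF open_punctured smooth_on_shift_dot smooth_on_inv_sq])

lemma grad_inner_inv_sq_left:
  assumes "x \<noteq> c" shows "grad_inner (inv_sq c) h x = - (inv_sq c x)\<^sup>2 * grad_inner (sq c) h x"
  unfolding inv_sq_eq
  using grad_inner_compose[OF smooth_on_sq[OF open_punctured] smooth_on_inverse sq_image, of x h] assms sq_pos[OF assms]
  by (simp add: dird_inverse)

lemma inv_sq_mult_sq: "x \<noteq> c \<Longrightarrow> inv_sq c x * sq c x = 1"
  using sq_pos[of x c] by (simp add: inv_sq_eq)

lemma grad_inner_inv_sq: assumes "x \<noteq> c" shows "grad_inner (inv_sq c) (inv_sq c) x = 4 * inv_sq c x ^ 3"
proof -
  have "grad_inner (inv_sq c) (inv_sq c) x = (inv_sq c x)\<^sup>2 * (inv_sq c x)\<^sup>2 * (4 * sq c x)"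
    using assms by (simp add: grad_inner_inv_sq_left grad_inner_commute[of "sq c" "inv_sq c"] grad_inner_sq)
  also have "\<dots> = 4 * inv_sq c x ^ 3 * (inv_sq c x * sq c x)"
    by (simp add: power2_eq_square power3_eq_cube)
  finally show ?thesis by (simp add: inv_sq_mult_sq assms)
qed

lemma grad_inner_inv_sq_shift_dot:
  assumes "x \<noteq> c" shows "grad_inner (inv_sq c) (shift_dot c e) x = - 2 * shift_dot c e x * (inv_sq c x)\<^sup>2"
  using assms by (simp add: grad_inner_inv_sq_left grad_inner_sq_shift_dot)

lemma laplacian_inv_sq:
  assumes "x \<noteq> c" shows "laplacian (inv_sq c) x = (8 - 2 * real DIM('a)) * (inv_sq c x)\<^sup>2"
proof -
  have "laplacian (inv_sq c) x = 2 * inv_sq c x ^ 3 * (4 * sq c x) - (inv_sq c x)\<^sup>2 * (2 * real DIM('a))"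
    unfolding inv_sq_eq
    using laplacian_compose[OF open_punctured smooth_on_sq[OF open_punctured] smooth_on_inverse sq_image, of x]
      assms sq_pos[OF assms]
    by (simp add: dird_inverse dird_dird_inverse grad_inner_sq laplacian_sq)
  also have "2 * inv_sq c x ^ 3 * (4 * sq c x) = 8 * (inv_sq c x)\<^sup>2 * (inv_sq c x * sq c x)"
    by (simp add: power2_eq_square power3_eq_cube)
  finally show ?thesis using assms by (simp add: inv_sq_mult_sq algebra_simps)
qed

lemma grad_inner_inv_sq_kelvin:
  assumes "x \<noteq> c" shows "grad_inner (inv_sq c) (kelvin c e) x = 2 * kelvin c e x * (inv_sq c x)\<^sup>2"
proof -
  have "grad_inner (kelvin c e) (inv_sq c) x = shift_dot c e x * grad_inner (inv_sq c) (inv_sq c) x + inv_sq c x * grad_inner (shift_dot c e) (inv_sq c) x"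
    unfolding kelvin_eq using assms
    by (intro grad_inner_mult[of "- {c}"] smooth_on_shift_dot smooth_on_inv_sq) auto
  then show ?thesis using assms
    by (simp add: grad_inner_commute[of "kelvin c e" "inv_sq c"] grad_inner_commute[of "shift_dot c e" "inv_sq c"] grad_inner_inv_sq_shift_dot
        grad_inner_inv_sq)
      (simp add: kelvin_eq power2_eq_square power3_eq_cube)
qed

text \<open>The inversion is conformal, so each of its coordinates in a unit direction has a
  gradient of length \<open>inv_sq\<close>.\<close>

lemma grad_inner_kelvin:
  assumes "x \<noteq> c" shows "grad_inner (kelvin c e) (kelvin c e) x = (inv_sq c x)\<^sup>2"
proof -
  have m: "grad_inner (kelvin c e) h x = shift_dot c e x * grad_inner (inv_sq c) h x + inv_sq c x * grad_inner (shift_dot c e) h x" for h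
    unfolding kelvin_eq using assms
    by (intro grad_inner_mult[of "- {c}"] smooth_on_shift_dot smooth_on_inv_sq) auto
  have "grad_inner (shift_dot c e) (kelvin c e) x = shift_dot c e x * (- 2 * shift_dot c e x * (inv_sq c x)\<^sup>2) + inv_sq c x"
    using m[of "shift_dot c e"] assms
    by (simp add: grad_inner_commute[of "shift_dot c e" "kelvin c e"] grad_inner_inv_sq_shift_dot grad_inner_shift_dot e)
  then show ?thesis using assms
    by (simp add: m[of "kelvin c e"] grad_inner_inv_sq_kelvin)
      (simp add: kelvin_eq power2_eq_square power3_eq_cube algebra_simps)
qed

lemma laplacian_kelvin:
  assumes "x \<noteq> c" shows "laplacian (kelvin c e) x = (4 - 2 * real DIM('a)) * kelvin c e x * inv_sq c x"
proof -
  have "laplacian (kelvin c e) x = shift_dot c e x * laplacian (inv_sq c) x + 2 * grad_inner (shift_dot c e) (inv_sq c) x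
      + inv_sq c x * laplacian (shift_dot c e) x"
    unfolding kelvin_eq using assms
    by (intro laplacian_mult[of "- {c}"] smooth_on_shift_dot smooth_on_inv_sq) auto
  then show ?thesis using assms
    by (simp add: grad_inner_commute[of "shift_dot c e" "inv_sq c"] grad_inner_inv_sq_shift_dot laplacian_inv_sq laplacian_shift_dot)
      (simp add: kelvin_eq power2_eq_square algebra_simps)
qed

lemma grad_inner_power:
  assumes "x \<noteq> c" "grad_inner (inv_sq c) h x = a * (inv_sq c x)\<^sup>2"
  shows "grad_inner (\<lambda>x. inv_sq c x ^ b) h x = b * a * inv_sq c x ^ (b + 1)"
proof (induction b)
  case 0 show ?case by (simp add: grad_inner_def)
next
  case (Suc b)
  have "grad_inner (\<lambda>x. inv_sq c x * inv_sq c x ^ b) h x = inv_sq c x * grad_inner (\<lambda>x. inv_sq c x ^ b) h x + inv_sq c x ^ b * grad_inner (inv_sq c) h x"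
    using assms by (intro grad_inner_mult[of "- {c}"] smooth_on_power smooth_on_inv_sq) auto
  then show ?case by (simp add: Suc assms) (simp add: power2_eq_square algebra_simps)
qed

text \<open>The coefficient vanishes for 2 b = n - 2, where the power is |x - c|^(2-n), the
  Newtonian kernel. This zero is what ends the chain of Laplacians of the logarithm.\<close>

lemma laplacian_inv_sq_power:
  assumes "x \<noteq> c" shows "laplacian (\<lambda>x. inv_sq c x ^ b) x = b * (4 * b + 4 - 2 * real DIM('a)) * inv_sq c x ^ (b + 1)"
proof (induction b)
  case 0 show ?case by simp
next
  case (Suc b)
  have "laplacian (\<lambda>x. inv_sq c x * inv_sq c x ^ b) x
     = inv_sq c x * laplacian (\<lambda>x. inv_sq c x ^ b) x + 2 * grad_inner (inv_sq c) (\<lambda>x. inv_sq c x ^ b) x + inv_sq c x ^ b * laplacian (inv_sq c) x"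
    using assms by (intro laplacian_mult[of "- {c}"] smooth_on_power smooth_on_inv_sq) auto
  also have "grad_inner (inv_sq c) (\<lambda>x. inv_sq c x ^ b) x = b * (4 * inv_sq c x) * inv_sq c x ^ (b + 1)"
    using grad_inner_power[OF assms, of "inv_sq c" "4 * inv_sq c x" b] assms
    by (simp add: grad_inner_commute[of "inv_sq c" "\<lambda>x. inv_sq c x ^ b"] grad_inner_inv_sq power2_eq_square power3_eq_cube)
  finally show ?case using assms
    by (simp add: Suc laplacian_inv_sq) (simp add: power2_eq_square algebra_simps)
qed

section \<open>Iterated Laplacians on an open set that avoids the pole\<close>

context
  fixes T :: "real set" and S :: "'a set"
  assumes T: "open T" and S: "open S" "c \<notin> S" "kelvin c e ` S \<subseteq> T"
begin

lemma smooth_on_inv_sq_S: "smooth_on S (inv_sq c)"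
  using S by (auto intro!: smooth_on_subset[OF smooth_on_inv_sq])

lemma smooth_on_kelvin_S: "smooth_on S (kelvin c e)"
  using S by (auto intro!: smooth_on_subset[OF smooth_on_kelvin])

lemma smooth_on_kelvin_term:
  assumes "deriv_seq T G" shows "smooth_on S (\<lambda>x. inv_sq c x ^ b * G i (kelvin c e x))"
  using S by (intro smooth_on_mult smooth_on_power smooth_on_inv_sq_S
      smooth_on_compose[OF _ smooth_on_kelvin_S deriv_seq_smooth_on[OF T assms]])

text \<open>Sums of products \<open>inv_sq ^ b\<close> times a function of \<open>kelvin\<close> are
  closed under the Laplacian. The Laplacian of \<open>kelvin\<close>, the cross term and the
  Laplacian of the power share the scalar 4 b + 4 - 2 n, and what this scalar multiplies is an Euler
  operator of weight \<open>b\<close>.\<close>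

lemma laplacian_kelvin_term:
  assumes G: "deriv_seq T G" and x: "x \<in> S"
  shows "laplacian (\<lambda>x. inv_sq c x ^ b * G 0 (kelvin c e x)) x
    = inv_sq c x ^ (b + 2) * G 2 (kelvin c e x) + (4 * b + 4 - 2 * real DIM('a)) * (inv_sq c x ^ (b + 1) * eul b G 0 (kelvin c e x))"
proof -
  note sG = deriv_seq_smooth_on[OF T G]
  have c: "x \<noteq> c" "kelvin c e x \<in> T" using x S by auto
  note d = dird_deriv_seq[OF T G c(2)]
  have "laplacian (\<lambda>x. inv_sq c x ^ b * G 0 (kelvin c e x)) x = inv_sq c x ^ b * laplacian (\<lambda>x. G 0 (kelvin c e x)) x
     + 2 * grad_inner (\<lambda>x. inv_sq c x ^ b) (\<lambda>x. G 0 (kelvin c e x)) x + G 0 (kelvin c e x) * laplacian (\<lambda>x. inv_sq c x ^ b) x"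
    by (rule laplacian_mult[OF S(1) smooth_on_power[OF S(1) smooth_on_inv_sq_S]
          smooth_on_compose[OF S(1) smooth_on_kelvin_S sG S(3)] x])
  also have "laplacian (\<lambda>x. G 0 (kelvin c e x)) x = G 2 (kelvin c e x) * (inv_sq c x)\<^sup>2 + G 1 (kelvin c e x) * ((4 - 2 * real DIM('a)) * kelvin c e x * inv_sq c x)"
    using laplacian_compose[OF S(1) smooth_on_kelvin_S sG S(3) x, of 0] c d
    by (simp add: grad_inner_kelvin laplacian_kelvin numeral_2_eq_2)
  also have "grad_inner (\<lambda>x. inv_sq c x ^ b) (\<lambda>x. G 0 (kelvin c e x)) x = G 1 (kelvin c e x) * (b * (2 * kelvin c e x) * inv_sq c x ^ (b + 1))"
    using grad_inner_compose[OF smooth_on_kelvin_S sG S(3) x, of 0 "\<lambda>x. inv_sq c x ^ b"] c d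
      grad_inner_power[OF c(1) grad_inner_inv_sq_kelvin[OF c(1)], of b]
    by (simp add: grad_inner_commute[of "\<lambda>x. inv_sq c x ^ b" "\<lambda>x. G 0 (kelvin c e x)"] grad_inner_commute[of "kelvin c e" "\<lambda>x. inv_sq c x ^ b"])
  finally show ?thesis using c
    by (simp add: laplacian_inv_sq_power eul_def) (simp add: power2_eq_square algebra_simps)
qed

text \<open>A summand after k Laplacians: j of them have differentiated twice, the other k - j have
  each applied one Euler operator.\<close>

definition kterm :: "(nat \<Rightarrow> real \<Rightarrow> real) \<Rightarrow> nat \<Rightarrow> nat \<Rightarrow> 'a \<Rightarrow> real" where
  "kterm G k j x = inv_sq c x ^ (k + j) * euls (2 * j) (k - j) (\<lambda>i. G (i + 2 * j)) 0 (kelvin c e x)"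

lemma smooth_on_kterm: "deriv_seq T G \<Longrightarrow> smooth_on S (kterm G k j)"
  unfolding kterm_def by (rule smooth_on_kelvin_term[OF deriv_seq_euls[OF deriv_seq_shift]])

text \<open>The second derivative moves inside by \<open>euls_shift\<close> and raises j; the new
  Euler operator has weight k + j = 2 j + (k - j), exactly the next factor of the rising
  product.\<close>

lemma laplacian_kterm:
  assumes "deriv_seq T G" "x \<in> S" "j \<le> k"
  shows "laplacian (kterm G k j) x
    = kterm G (Suc k) (Suc j) x + (4 * (k + j) + 4 - 2 * real DIM('a)) * kterm G (Suc k) j x"
proof -
  have "euls (2 * j) (k - j) (\<lambda>i. G (i + 2 * j)) 2 = euls (2 * Suc j) (k - j) (\<lambda>i. G (i + 2 * Suc j)) 0"
    using euls_shift[of "2 * j" "k - j" "\<lambda>i. G (i + 2 * j)" 0] by (simp add: algebra_simps numeral_2_eq_2)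
  moreover have "eul (k + j) (euls (2 * j) (k - j) (\<lambda>i. G (i + 2 * j)))
     = euls (2 * j) (Suc k - j) (\<lambda>i. G (i + 2 * j))"
    using assms(3) by (simp add: Suc_diff_le add.commute[of j k])
  ultimately show ?thesis
    using laplacian_kelvin_term[OF deriv_seq_euls[OF deriv_seq_shift[OF assms(1)]] assms(2), of "k + j" "2 * j" "k - j" "2 * j"]
    unfolding kterm_def by (simp add: algebra_simps)
qed

lemma laplacian_funpow_kelvin:
  assumes G: "deriv_seq T G" and x: "x \<in> S"
  shows "(laplacian ^^ k) (\<lambda>x. G 0 (kelvin c e x)) x = (\<Sum>j\<le>k. kcoef (real DIM('a)) k j * kterm G k j x)"
  using x
proof (induction k arbitrary: x)
  case 0
  show ?case by (simp add: kcoef_def kterm_def)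
next
  case (Suc k)
  note s = smooth_on_kterm[OF G]
  have "(laplacian ^^ Suc k) (\<lambda>x. G 0 (kelvin c e x)) x = laplacian (\<lambda>x. \<Sum>j\<le>k. kcoef (real DIM('a)) k j * kterm G k j x) x"
    using laplacian_cong[OF S(1) Suc.prems Suc.IH] by simp
  also have "\<dots> = (\<Sum>j\<le>k. kcoef (real DIM('a)) k j * laplacian (kterm G k j) x)"
    using S(1) s Suc.prems
    by (subst laplacian_sum[OF S(1) _ Suc.prems])
      (simp_all add: smooth_on_mult laplacian_cmult[OF S(1) _ Suc.prems])
  also have "\<dots> = (\<Sum>j\<le>k. kcoef (real DIM('a)) k j * kterm G (Suc k) (Suc j) x)
      + (\<Sum>j\<le>k. (4 * (k + j) + 4 - 2 * real DIM('a)) * kcoef (real DIM('a)) k j * kterm G (Suc k) j x)"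
    unfolding sum.distrib[symmetric]
    by (rule sum.cong[OF refl]) (simp add: laplacian_kterm[OF G Suc.prems] algebra_simps)
  \<comment> \<open>The summand for j = Suc k may be added: its coefficient contains
    \<open>k choose Suc k = 0\<close>. Both sums can then be aligned by an index shift.\<close>
  also have "(\<Sum>j\<le>k. (4 * (k + j) + 4 - 2 * real DIM('a)) * kcoef (real DIM('a)) k j * kterm G (Suc k) j x)
      = (\<Sum>j\<le>Suc k. (4 * (k + j) + 4 - 2 * real DIM('a)) * kcoef (real DIM('a)) k j * kterm G (Suc k) j x)"
    unfolding sum.atMost_Suc by (simp add: kcoef_def)
  also have "\<dots> = (4 * k + 4 - 2 * real DIM('a)) * kcoef (real DIM('a)) k 0 * kterm G (Suc k) 0 x
      + (\<Sum>j\<le>k. (4 * (k + Suc j) + 4 - 2 * real DIM('a)) * kcoef (real DIM('a)) k (Suc j) * kterm G (Suc k) (Suc j) x)"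
    by (subst sum.atMost_Suc_shift) simp
  also have "(\<Sum>j\<le>k. kcoef (real DIM('a)) k j * kterm G (Suc k) (Suc j) x) + \<dots>
     = kcoef (real DIM('a)) (Suc k) 0 * kterm G (Suc k) 0 x + (\<Sum>j\<le>k. kcoef (real DIM('a)) (Suc k) (Suc j) * kterm G (Suc k) (Suc j) x)"
  proof -
    have "(\<Sum>j\<le>k. kcoef (real DIM('a)) (Suc k) (Suc j) * kterm G (Suc k) (Suc j) x)
      = (\<Sum>j\<le>k. kcoef (real DIM('a)) k j * kterm G (Suc k) (Suc j) x)
      + (\<Sum>j\<le>k. (4 * (k + Suc j) + 4 - 2 * real DIM('a)) * kcoef (real DIM('a)) k (Suc j) * kterm G (Suc k) (Suc j) x)"
      unfolding sum.distrib[symmetric]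
      by (rule sum.cong[OF refl]) (simp add: kcoef_Suc_Suc distrib_right)
    then show ?thesis by (simp add: kcoef_Suc_0)
  qed
  also have "\<dots> = (\<Sum>j\<le>Suc k. kcoef (real DIM('a)) (Suc k) j * kterm G (Suc k) j x)"
    by (subst sum.atMost_Suc_shift) simp
  finally show ?case .
qed

text \<open>In the conformally critical dimension all but one of the coefficients contain the factor
  \<open>4 m - 2 n = 0\<close>.\<close>

lemma polylaplacian_kelvin:
  assumes "deriv_seq T G" "x \<in> S" "DIM('a) = 2 * m"
  shows "(laplacian ^^ m) (\<lambda>x. G 0 (kelvin c e x)) x = inv_sq c x ^ (2 * m) * G (2 * m) (kelvin c e x)"
proof -
  have z: "kcoef (real DIM('a)) m j = 0" if "j < m" for j
  proof -
    have "(\<Prod>i\<in>{j<..m}. 4 * real i - 2 * real DIM('a)) = 0"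
      by (rule prod_zero) (use that assms(3) in \<open>auto intro: bexI[of _ m]\<close>)
    then show ?thesis unfolding kcoef_def by simp
  qed
  have "(laplacian ^^ m) (\<lambda>x. G 0 (kelvin c e x)) x = (\<Sum>j\<le>m. kcoef (real DIM('a)) m j * kterm G m j x)"
    by (rule laplacian_funpow_kelvin[OF assms(1,2)])
  also have "\<dots> = (\<Sum>j\<in>{m}. kcoef (real DIM('a)) m j * kterm G m j x)"
    by (rule sum.mono_neutral_right) (use z in auto)
  also have "\<dots> = inv_sq c x ^ (2 * m) * G (2 * m) (kelvin c e x)"
    by (simp add: kcoef_def kterm_def flip: mult_2)
  finally show ?thesis .
qed

section \<open>The logarithmic term\<close>

lemma sq_image_S: "sq c ` S \<subseteq> {0<..}"
proof (rule image_subsetI)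
  fix x assume "x \<in> S"
  with S(2) have "x \<noteq> c" by metis
  then show "sq c x \<in> {0<..}" using sq_pos[of x c] by simp
qed

lemma smooth_on_ln_sq: "smooth_on S (\<lambda>x. ln (sq c x))"
  by (rule smooth_on_compose[OF S(1) smooth_on_sq[OF S(1)] smooth_on_ln sq_image_S])

lemma laplacian_ln_sq:
  assumes "x \<in> S" shows "laplacian (\<lambda>x. ln (sq c x)) x = (2 * real DIM('a) - 4) * inv_sq c x"
proof -
  have c: "x \<noteq> c" using assms S(2) by blast
  have d: "dird 1 ln y = inverse y" if "y > 0" for y
    using dird_real[OF DERIV_ln[OF that], of 1] by simp
  have "dird 1 (dird 1 ln) (sq c x) = dird 1 inverse (sq c x)"
    by (rule dird_cong[of "{0<..}"]) (use sq_pos[OF c] d in simp_all)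
  then have "laplacian (\<lambda>x. ln (sq c x)) x = inv_sq c x * (2 * real DIM('a)) - (inv_sq c x)\<^sup>2 * (4 * sq c x)"
    unfolding laplacian_compose[OF S(1) smooth_on_sq[OF S(1)] smooth_on_ln sq_image_S assms] d[OF sq_pos[OF c]]
      grad_inner_sq laplacian_sq inv_sq_eq
    by (simp add: dird_inverse[OF sq_pos[OF c]])
  moreover have "(inv_sq c x)\<^sup>2 * (4 * sq c x) = 4 * inv_sq c x * (inv_sq c x * sq c x)" by (simp add: power2_eq_square)
  ultimately show ?thesis by (simp only: inv_sq_mult_sq[OF c]) (simp add: algebra_simps)
qed

text \<open>The first Laplacian yields a multiple of \<open>inv_sq\<close>; the next ones multiply
  by b (4 b + 4 - 2 n) for b = 1, 2, and so on. The factor for b = m - 1 is zero when n = 2 m, and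
  it occurs among the m Laplacians because m \<ge> 2.\<close>

lemma polylaplacian_ln_sq:
  assumes "x \<in> S" "DIM('a) = 2 * m" "m \<ge> 2"
  shows "(laplacian ^^ m) (\<lambda>x. ln (sq c x)) x = 0"
proof -
  have *: "(laplacian ^^ Suc k) (\<lambda>x. ln (sq c x)) x
      = (2 * real DIM('a) - 4) * (\<Prod>b=1..k. b * (4 * real b + 4 - 2 * real DIM('a))) * inv_sq c x ^ Suc k" if "x \<in> S" for k x
    using that
  proof (induction k arbitrary: x)
    case 0 then show ?case by (simp add: laplacian_ln_sq)
  next
    case (Suc k)
    have "x \<noteq> c" using Suc.prems S(2) by blast
    define C where "C = (2 * real DIM('a) - 4) * (\<Prod>b=1..k. b * (4 * real b + 4 - 2 * real DIM('a)))"
    have "(laplacian ^^ Suc (Suc k)) (\<lambda>x. ln (sq c x)) x = laplacian (\<lambda>x. C * inv_sq c x ^ Suc k) x"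
      using laplacian_cong[OF S(1) Suc.prems Suc.IH] by (simp add: C_def)
    also have "\<dots> = C * laplacian (\<lambda>x. inv_sq c x ^ Suc k) x"
      by (rule laplacian_cmult[OF S(1) smooth_on_power[OF S(1) smooth_on_inv_sq_S] Suc.prems])
    also have "\<dots> = C * (Suc k * (4 * Suc k + 4 - 2 * real DIM('a)) * inv_sq c x ^ Suc (Suc k))"
      using laplacian_inv_sq_power[OF \<open>x \<noteq> c\<close>, of "Suc k"] by simp
    finally show ?case by (simp add: C_def algebra_simps)
  qed
  obtain k where k: "m = Suc (Suc k)" using le_Suc_ex[OF assms(3)] by auto
  have "4 * real (Suc k) + 4 - 2 * real DIM('a) = 0" using assms(2) k by simp
  then have "(\<Prod>b=1..Suc k. b * (4 * real b + 4 - 2 * real DIM('a))) = 0"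
    by (simp add: prod.nat_ivl_Suc')
  then show ?thesis unfolding k using *[OF assms(1), of "Suc k"] by simp
qed

end
end

subsection \<open>Integration by parts\<close>

lemma lborel_integral_translate:
  fixes f :: "'a::euclidean_space \<Rightarrow> real"
  assumes [measurable]: "f \<in> borel_measurable borel"
  shows "(LINT x|lborel. f (x + a)) = (LINT x|lborel. f x)"
    and "integrable lborel f \<Longrightarrow> integrable lborel (\<lambda>x. f (x + a))"
proof -
  have "(LINT x|lborel. f (a + x)) = (LINT x|distr lborel borel ((+) a). f x)"
    by (rule integral_distr[symmetric]) simp_all
  then show "(LINT x|lborel. f (x + a)) = (LINT x|lborel. f x)"
    by (simp add: lborel_distr_plus add.commute)
  assume "integrable lborel f"
  then have "integrable (distr lborel borel ((+) a)) f" by (simp add: lborel_distr_plus)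
  then have "integrable lborel (\<lambda>x. f (a + x))" by (rule integrable_distr[rotated]) simp
  then show "integrable lborel (\<lambda>x. f (x + a))" by (simp add: add.commute)
qed

lemma dird_zero_outside:
  assumes "closed K" "\<And>x. x \<notin> K \<Longrightarrow> F x = 0" "x \<notin> K"
  shows "dird v F x = 0"
  using dird_cong[of "- K" x F "\<lambda>x. 0"] assms by (simp add: open_Compl)

text \<open>Each difference quotient of \<open>F\<close> has integral 0 by translation invariance of
  the Lebesgue measure. The quotients tend to the derivative under a common bounded, compactly
  supported majorant, so the integral of the limit is 0 as well.\<close>

lemma integral_dird_eq_0:
  fixes F :: "'a::euclidean_space \<Rightarrow> real"
  assumes d: "\<And>x. F differentiable (at x)" and c: "continuous_on UNIV (dird b F)"
    and K: "compact K" "\<And>x. x \<notin> K \<Longrightarrow> F x = 0"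
  shows "(LINT x|lborel. dird b F x) = 0"
proof -
  have cF: "continuous_on UNIV F" using d differentiable_at_imp_continuous_on by blast
  have mF [measurable]: "F \<in> borel_measurable borel" by (rule borel_measurable_continuous_onI[OF cF])
  obtain R where R: "R > 0" "K \<subseteq> cball 0 R"
    using compact_imp_bounded[OF K(1)] unfolding bounded_pos by (auto simp: subset_iff)
  have "bounded (dird b F ` K)"
    by (intro compact_imp_bounded compact_continuous_image K continuous_on_subset[OF c]) simp
  then obtain M where M: "M > 0" "\<And>x. x \<in> K \<Longrightarrow> \<bar>dird b F x\<bar> \<le> M"
    unfolding bounded_pos by auto
  have M': "\<bar>dird b F x\<bar> \<le> M" for x
    using M dird_zero_outside[OF compact_imp_closed[OF K(1)] K(2)] by (cases "x \<in> K") auto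
  define h where "h k = 1 / real (Suc k)" for k
  have h: "h k > 0" "h k \<le> 1" for k by (simp_all add: h_def)
  define g where "g k x = (F (x + h k *\<^sub>R b) - F x) / h k" for k x
  have iF: "integrable lborel F"
  proof -
    have "set_integrable lborel K F"
      unfolding set_integrable_def by (rule borel_integrable_compact[OF K(1) continuous_on_subset[OF cF]]) simp
    moreover have "(\<lambda>x. indicator K x *\<^sub>R F x) = F" using K(2) by (auto simp: indicator_def fun_eq_iff)
    ultimately show ?thesis by (simp add: set_integrable_def)
  qed
  have g0: "(LINT x|lborel. g k x) = 0" for k
    unfolding g_def using lborel_integral_translate[OF mF, of "h k *\<^sub>R b"] iF by simp
  \<comment> \<open>Inside the enlarged ball the mean value theorem applies; outside it, neither x
    nor the shifted point can lie in \<open>K\<close>, since the step \<open>h k\<close> is at most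
    1.\<close>
  have bound: "norm (g k x) \<le> M * indicator (cball 0 (R + norm b)) x" for k x
  proof (cases "x \<in> cball 0 (R + norm b)")
    case True
    have "\<exists>z>0. z < h k \<and> F (x + h k *\<^sub>R b) - F (x + 0 *\<^sub>R b) = (h k - 0) * dird b F (x + z *\<^sub>R b)"
    proof (rule MVT2)
      fix z
      have "((\<lambda>z. F (x + z *\<^sub>R b)) has_derivative (\<lambda>y. dird (y *\<^sub>R b) F (x + z *\<^sub>R b))) (at z)"
        by (rule has_derivative_compose[OF _ differentiable_dird[OF d]]) (auto intro!: derivative_eq_intros)
      moreover have "dird (y *\<^sub>R b) F w = dird b F w * y" for y w
        using linear_scale[OF has_derivative_linear[OF differentiable_dird[OF d]], of y b w] by simp
      ultimately show "((\<lambda>z. F (x + z *\<^sub>R b)) has_real_derivative dird b F (x + z *\<^sub>R b)) (at z)"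
        unfolding has_field_derivative_def by simp
    qed (rule h)
    then obtain z where "F (x + h k *\<^sub>R b) - F x = h k * dird b F (x + z *\<^sub>R b)" by auto
    then have "g k x = dird b F (x + z *\<^sub>R b)" using h[of k] by (simp add: g_def)
    then show ?thesis using M' True by simp
  next
    case False
    then have x: "norm x > R + norm b" by simp
    have "norm (h k *\<^sub>R b) \<le> norm b" using h[of k] by (simp add: mult_left_le_one_le)
    then have "norm (x + h k *\<^sub>R b) > R" "norm x > R"
      using x norm_triangle_ineq2[of x "- (h k *\<^sub>R b)"] norm_ge_zero[of b] by (simp_all, linarith+)
    then have "x \<notin> K" "x + h k *\<^sub>R b \<notin> K" using R by auto
    then show ?thesis using False K(2) by (simp add: g_def)
  qed
  have lim: "(\<lambda>k. g k x) \<longlonglongrightarrow> dird b F x" for x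
  proof -
    have "((\<lambda>z. F (x + z *\<^sub>R b)) has_derivative (\<lambda>y. dird (y *\<^sub>R b) F (x + 0 *\<^sub>R b))) (at 0)"
      by (rule has_derivative_compose[OF _ differentiable_dird[OF d]]) (auto intro!: derivative_eq_intros)
    moreover have "dird (y *\<^sub>R b) F w = dird b F w * y" for y w
      using linear_scale[OF has_derivative_linear[OF differentiable_dird[OF d]], of y b w] by simp
    ultimately have "((\<lambda>z. F (x + z *\<^sub>R b)) has_real_derivative dird b F x) (at 0)"
      unfolding has_field_derivative_def by simp
    then have D: "((\<lambda>h. (F (x + h *\<^sub>R b) - F x) / h) \<longlongrightarrow> dird b F x) (at 0)"
      by (simp add: DERIV_def)
    have "h \<longlonglongrightarrow> 0"
      unfolding h_def using LIMSEQ_inverse_real_of_nat by (simp add: inverse_eq_divide)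
    then have h0: "filterlim h (at 0) sequentially"
      unfolding filterlim_at using h(1) by (auto intro!: always_eventually simp: less_imp_neq[symmetric])
    show ?thesis unfolding g_def by (rule filterlim_compose[OF D h0])
  qed
  have "(\<lambda>k. LINT x|lborel. g k x) \<longlonglongrightarrow> (LINT x|lborel. dird b F x)"
  proof (rule integral_dominated_convergence)
    show "dird b F \<in> borel_measurable lborel" using borel_measurable_continuous_onI[OF c] by simp
    show "g k \<in> borel_measurable lborel" for k unfolding g_def by measurable
    show "integrable lborel (\<lambda>x. M * indicator (cball 0 (R + norm b)) x)"
      by (intro integrable_mult_right integrable_real_indicator) (simp_all add: emeasure_bounded_finite[OF bounded_cball, unfolded infinity_ennreal_def])
  qed (use lim bound in auto)
  then show ?thesis by (simp add: g0 LIMSEQ_const_iff)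
qed

lemma integrable_support:
  fixes g :: "'a::euclidean_space \<Rightarrow> real"
  assumes "compact K" "K \<subseteq> U" "continuous_on U g" "\<And>x. x \<notin> K \<Longrightarrow> g x = 0"
  shows "set_integrable lborel U g"
proof -
  have "set_integrable lborel K g"
    unfolding set_integrable_def
    by (rule borel_integrable_compact[OF assms(1) continuous_on_subset[OF assms(3,2)]])
  moreover have "(\<lambda>x. indicator K x *\<^sub>R g x) = (\<lambda>x. indicator U x *\<^sub>R g x)"
    using assms by (auto simp: indicator_def fun_eq_iff)
  ultimately show ?thesis by (simp add: set_integrable_def)
qed

lemma laplacian_zero_outside:
  assumes "closed K" "\<And>x. x \<notin> K \<Longrightarrow> F x = 0" "x \<notin> K"
  shows "laplacian F x = 0"
  using laplacian_cong[of "- K" x F "\<lambda>x. 0"] assms by (simp add: open_Compl)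

lemma Green_identity:
  fixes u :: "'a::euclidean_space \<Rightarrow> real"
  assumes U: "open U" "smooth_on U u" and K: "compact K" "K \<subseteq> U"
    and p: "smooth_on UNIV p" "\<And>x. x \<notin> K \<Longrightarrow> p x = 0"
  shows "(LINT x:U|lborel. u x * laplacian p x) = (LINT x:U|lborel. laplacian u x * p x)"
proof -
  have pU: "smooth_on U p" using smooth_on_subset[OF p(1)] by simp
  have cK: "closed K" by (rule compact_imp_closed[OF K(1)])
  have oK: "open (- K)" using cK by (simp add: open_Compl)
  have UK: "x \<in> U \<or> x \<in> - K" for x using K(2) by auto
  \<comment> \<open>The components of the field u grad p - p grad u, whose divergence is the
    integrand. As \<open>u\<close> is controlled only on \<open>U\<close>, the field is extended by
    0; it is smooth on \<open>U\<close> and on the complement of \<open>K\<close>, and these two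
    open sets cover the space.\<close>
  define H where "H b x = (if x \<in> U then u x * dird b p x - p x * dird b u x else 0)" for b x
  have HK: "H b x = 0" if "x \<notin> K" for b x
    using that p(2) dird_zero_outside[OF cK p(2) that] by (simp add: H_def)
  have sU: "smooth_on U (H b)" for b
  proof (subst smooth_on_cong[OF U(1)])
    show "H b x = u x * dird b p x - p x * dird b u x" if "x \<in> U" for x using that by (simp add: H_def)
    show "smooth_on U (\<lambda>x. u x * dird b p x - p x * dird b u x)"
      by (rule smooth_on_diff[OF U(1) smooth_on_mult[OF U(1) U(2) smooth_on_dird[OF pU]]
            smooth_on_mult[OF U(1) pU smooth_on_dird[OF U(2)]]])
  qed
  have sK: "smooth_on (- K) (H b)" for b
    by (subst smooth_on_cong[OF oK, of _ "\<lambda>x. 0"]) (auto simp: HK)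
  have dH: "H b differentiable (at x)" for b x
    using UK[of x] smooth_on_differentiable[OF sU] smooth_on_differentiable[OF sK] by metis
  have cH: "continuous_on UNIV (dird v (H b))" for v b
  proof -
    have "continuous_on (U \<union> - K) (dird v (H b))"
      by (rule continuous_on_open_Un[OF U(1) oK smooth_on_continuous[OF smooth_on_dird[OF sU]]
            smooth_on_continuous[OF smooth_on_dird[OF sK]]])
    moreover have "U \<union> - K = UNIV" using UK by auto
    ultimately show ?thesis by simp
  qed
  have dHK: "dird v (H b) x = 0" if "x \<notin> K" for v b x
    by (rule dird_zero_outside[OF cK HK that])
  have int: "integrable lborel (dird v (H b))" for v b
    using integrable_support[OF K(1) _ cH dHK] by (simp add: set_integrable_def)
  have dHU: "dird b (H b) x = u x * dird b (dird b p) x - p x * dird b (dird b u) x" if "x \<in> U" for b x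
  proof -
    have "dird b (H b) x = dird b (\<lambda>x. u x * dird b p x + (- 1) * (p x * dird b u x)) x"
      by (rule dird_cong[OF U(1) that]) (simp add: H_def)
    also have "\<dots> = dird b (\<lambda>x. u x * dird b p x) x + dird b (\<lambda>x. (- 1) * (p x * dird b u x)) x"
      using U pU that by (intro dird_add smooth_on_differentiable[of U] smooth_on_mult smooth_on_dird) auto
    also have "dird b (\<lambda>x. (- 1) * (p x * dird b u x)) x = (- 1) * dird b (\<lambda>x. p x * dird b u x) x
       + p x * dird b u x * dird b (\<lambda>x. - 1) x"
      by (rule dird_mult) (auto intro!: smooth_on_differentiable[OF _ that] smooth_on_mult U pU smooth_on_dird)
    also have "dird b (\<lambda>x. p x * dird b u x) x = p x * dird b (dird b u) x + dird b u x * dird b p x"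
      by (intro dird_mult smooth_on_differentiable[OF _ that] U pU smooth_on_dird)
    also have "dird b (\<lambda>x. u x * dird b p x) x = u x * dird b (dird b p) x + dird b p x * dird b u x"
      by (intro dird_mult smooth_on_differentiable[OF _ that] U pU smooth_on_dird)
    finally show ?thesis by simp
  qed
  have "(\<Sum>b\<in>Basis. dird b (H b) x) = indicator U x *\<^sub>R (u x * laplacian p x - laplacian u x * p x)" for x
  proof (cases "x \<in> U")
    case True
    then show ?thesis
      by (simp add: dHU laplacian_dird sum_subtractf sum_distrib_left sum_distrib_right mult.commute)
  next
    case False
    then have "x \<notin> K" using K(2) by auto
    then show ?thesis using False by (simp add: dHK)
  qed
  then have "(LINT x:U|lborel. u x * laplacian p x - laplacian u x * p x)
      = (LINT x|lborel. (\<Sum>b\<in>Basis. dird b (H b) x))"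
    by (simp add: set_lebesgue_integral_def)
  also have "\<dots> = (\<Sum>b\<in>Basis. (LINT x|lborel. dird b (H b) x))"
    by (rule Bochner_Integration.integral_sum) (rule int)
  also have "\<dots> = 0"
    by (intro sum.neutral ballI integral_dird_eq_0[OF dH cH K(1) HK])
  finally have "(LINT x:U|lborel. u x * laplacian p x - laplacian u x * p x) = 0" .
  moreover have "set_integrable lborel U (\<lambda>x. u x * laplacian p x)"
    by (rule integrable_support[OF K smooth_on_continuous[OF smooth_on_mult[OF U smooth_on_laplacian[OF U(1) pU]]]])
      (simp add: laplacian_zero_outside[OF cK p(2)])
  moreover have "set_integrable lborel U (\<lambda>x. laplacian u x * p x)"
    by (rule integrable_support[OF K smooth_on_continuous[OF smooth_on_mult[OF U(1) smooth_on_laplacian[OF U] pU]]])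
      (simp add: p(2))
  ultimately show ?thesis by (simp add: set_integral_diff)
qed

section \<open>From the pointwise to the distributional equation\<close>

lemma smooth_on_funpow_laplacian: "open S \<Longrightarrow> smooth_on S f \<Longrightarrow> smooth_on S ((laplacian ^^ k) f)"
  by (induction k) (simp_all add: smooth_on_laplacian)

lemma funpow_laplacian_add:
  assumes "open S" "smooth_on S f" "smooth_on S g" "x \<in> S"
  shows "(laplacian ^^ k) (\<lambda>x. f x + g x) x = (laplacian ^^ k) f x + (laplacian ^^ k) g x"
  using assms(4)
proof (induction k arbitrary: x)
  case (Suc k)
  have "(laplacian ^^ Suc k) (\<lambda>x. f x + g x) x = laplacian (\<lambda>x. (laplacian ^^ k) f x + (laplacian ^^ k) g x) x"
    using laplacian_cong[OF assms(1) Suc.prems Suc.IH] by simp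
  also have "\<dots> = laplacian ((laplacian ^^ k) f) x + laplacian ((laplacian ^^ k) g) x"
    by (rule laplacian_add[OF assms(1) _ _ Suc.prems])
      (rule smooth_on_funpow_laplacian[OF assms(1,2)], rule smooth_on_funpow_laplacian[OF assms(1,3)])
  finally show ?case by simp
qed simp

lemma funpow_laplacian_cmult:
  assumes "open S" "smooth_on S f" "x \<in> S"
  shows "(laplacian ^^ k) (\<lambda>x. a * f x) x = a * (laplacian ^^ k) f x"
  using assms(3)
proof (induction k arbitrary: x)
  case (Suc k)
  have "(laplacian ^^ Suc k) (\<lambda>x. a * f x) x = laplacian (\<lambda>x. a * (laplacian ^^ k) f x) x"
    using laplacian_cong[OF assms(1) Suc.prems Suc.IH] by simp
  also have "\<dots> = a * laplacian ((laplacian ^^ k) f) x"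
    by (rule laplacian_cmult[OF assms(1) smooth_on_funpow_laplacian[OF assms(1,2)] Suc.prems])
  finally show ?case by simp
qed simp

lemma Green_identity_funpow:
  fixes u :: "'a::euclidean_space \<Rightarrow> real"
  assumes U: "open U" "smooth_on U u" and K: "compact K" "K \<subseteq> U"
    and p: "smooth_on UNIV p" "\<And>x. x \<notin> K \<Longrightarrow> p x = 0"
  shows "(LINT x:U|lborel. u x * (laplacian ^^ m) p x) = (LINT x:U|lborel. (laplacian ^^ m) u x * p x)"
  using p
proof (induction m arbitrary: p)
  case (Suc m)
  have "(laplacian ^^ Suc m) p = (laplacian ^^ m) (laplacian p)" by (simp add: funpow_swap1)
  moreover have "(LINT x:U|lborel. u x * (laplacian ^^ m) (laplacian p) x)
      = (LINT x:U|lborel. (laplacian ^^ m) u x * laplacian p x)"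
    by (rule Suc.IH[OF smooth_on_laplacian[OF open_UNIV Suc.prems(1)]
          laplacian_zero_outside[OF compact_imp_closed[OF K(1)] Suc.prems(2)]])
  moreover have "\<dots> = (LINT x:U|lborel. laplacian ((laplacian ^^ m) u) x * p x)"
    by (rule Green_identity[OF U(1) smooth_on_funpow_laplacian[OF U] K Suc.prems])
  ultimately show ?case by simp
qed simp

lemma neg_laplacian_power_eq:
  assumes "open S" "smooth_on S f" "x \<in> S"
  shows "neg_laplacian_power m f x = (- 1) ^ m * (laplacian ^^ m) f x"
  using assms(3)
proof (induction m arbitrary: x)
  case (Suc m)
  have "neg_laplacian_power (Suc m) f x = - laplacian (neg_laplacian_power m f) x"
    by (simp add: neg_laplacian_power_def)
  also have "laplacian (neg_laplacian_power m f) x = laplacian (\<lambda>x. (- 1) ^ m * (laplacian ^^ m) f x) x"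
    by (rule laplacian_cong[OF assms(1) Suc.prems Suc.IH])
  also have "\<dots> = (- 1) ^ m * laplacian ((laplacian ^^ m) f) x"
    by (rule laplacian_cmult[OF assms(1) smooth_on_funpow_laplacian[OF assms(1,2)] Suc.prems])
  finally show ?case by simp
qed (simp add: neg_laplacian_power_def)

lemma polyharmonic_eq_distrI:
  fixes u :: "'a::euclidean_space \<Rightarrow> real"
  assumes U: "open U" "smooth_on U u"
    and eq: "\<And>x. x \<in> U \<Longrightarrow> (- 1) ^ m * (laplacian ^^ m) u x = f x"
  shows "polyharmonic_eq_distr m U u f"
  unfolding polyharmonic_eq_distr_def
proof (intro allI impI)
  fix p :: "'a \<Rightarrow> real" assume "test_function_on U p"
  then have p: "smooth_on UNIV p" and K: "compact (closure {x. p x \<noteq> 0})" "closure {x. p x \<noteq> 0} \<subseteq> U"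
    by (auto simp: test_function_on_def smooth_on_def)
  have p0: "p x = 0" if "x \<notin> closure {x. p x \<noteq> 0}" for x
    using that closure_subset[of "{x. p x \<noteq> 0}"] by auto
  have U': "U \<in> sets lborel" using U(1) by simp
  have "(LINT x:U|lborel. u x * neg_laplacian_power m p x)
      = (LINT x:U|lborel. (- 1) ^ m * (u x * (laplacian ^^ m) p x))"
    using neg_laplacian_power_eq[OF open_UNIV p] by (intro set_lebesgue_integral_cong U') auto
  also have "\<dots> = (- 1) ^ m * (LINT x:U|lborel. (laplacian ^^ m) u x * p x)"
    using Green_identity_funpow[OF U K p p0] by simp
  also have "\<dots> = (LINT x:U|lborel. (- 1) ^ m * ((laplacian ^^ m) u x * p x))" by simp
  also have "\<dots> = (LINT x:U|lborel. f x * p x)"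
    using eq by (intro set_lebesgue_integral_cong U') (auto simp flip: mult.assoc)
  finally show "(LINT x:U|lborel. u x * neg_laplacian_power m p x) = (LINT x:U|lborel. f x * p x)" .
qed

subsection \<open>The ordinary differential equation\<close>

text \<open>The oriented interval integral also covers negative \<open>t\<close>. Its iterates solve
  the initial value problem with zero data at 0.\<close>

definition antideriv :: "(real \<Rightarrow> real) \<Rightarrow> real \<Rightarrow> real" where
  "antideriv g t = (LBINT y=ereal 0..ereal t. g y)"

lemma antideriv_0 [simp]: "antideriv g 0 = 0"
  by (simp add: antideriv_def)

lemma antideriv_zero [simp]: "antideriv (\<lambda>x. 0) = (\<lambda>x. 0)"
  by (simp add: antideriv_def fun_eq_iff)

lemma DERIV_antideriv:
  assumes "continuous_on UNIV g" shows "(antideriv g has_real_derivative g t) (at t)"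
proof -
  let ?a = "- \<bar>t\<bar> - 1" and ?b = "\<bar>t\<bar> + 1"
  have "((\<lambda>u. LBINT y=ereal 0..ereal u. g y) has_vector_derivative g t) (at t within {?a..?b})"
    by (rule interval_integral_FTC2[OF _ _ continuous_on_subset[OF assms subset_UNIV]]) simp_all
  moreover have "t \<in> interior {?a..?b}" by (simp, linarith)
  ultimately have "((\<lambda>u. LBINT y=ereal 0..ereal u. g y) has_vector_derivative g t) (at t)"
    by (simp only: at_within_interior)
  then show ?thesis
    unfolding antideriv_def[abs_def] has_real_derivative_iff_has_vector_derivative .
qed

lemma continuous_antideriv: "continuous_on UNIV g \<Longrightarrow> continuous_on UNIV (antideriv g)"
  by (rule continuous_at_imp_continuous_on, rule ballI, rule DERIV_isCont[OF DERIV_antideriv])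

lemma continuous_antideriv_funpow:
  "continuous_on UNIV g \<Longrightarrow> continuous_on UNIV ((antideriv ^^ k) g)"
  by (induction k) (simp_all add: continuous_antideriv)

lemma comparison_nonneg:
  fixes \<phi> :: "real \<Rightarrow> real"
  assumes d: "\<And>s. (\<phi> has_real_derivative g s) (at s)" and "\<phi> 0 = 0"
    and B: "\<And>s. 0 \<le> s \<Longrightarrow> (B has_real_derivative b s) (at s)" "B 0 \<ge> 0"
    and le: "\<And>s. 0 \<le> s \<Longrightarrow> \<bar>g s\<bar> \<le> b s" and "0 \<le> t"
  shows "\<bar>\<phi> t\<bar> \<le> B t"
proof -
  have "B 0 - \<phi> 0 \<le> B t - \<phi> t"
  proof (rule DERIV_nonneg_imp_nondecreasing[OF \<open>0 \<le> t\<close>])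
    fix s :: real assume "0 \<le> s" "s \<le> t"
    then show "\<exists>y. ((\<lambda>s. B s - \<phi> s) has_real_derivative y) (at s) \<and> 0 \<le> y"
      using le[of s] by (intro exI[of _ "b s - g s"] conjI DERIV_diff B d) auto
  qed
  moreover have "B 0 + \<phi> 0 \<le> B t + \<phi> t"
  proof (rule DERIV_nonneg_imp_nondecreasing[OF \<open>0 \<le> t\<close>])
    fix s :: real assume "0 \<le> s" "s \<le> t"
    then show "\<exists>y. ((\<lambda>s. B s + \<phi> s) has_real_derivative y) (at s) \<and> 0 \<le> y"
      using le[of s] by (intro exI[of _ "b s + g s"] conjI DERIV_add B d) auto
  qed
  ultimately show ?thesis using assms(2) B(2) by (simp add: abs_le_iff)
qed

lemma comparison:
  fixes \<phi> :: "real \<Rightarrow> real"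
  assumes d: "\<And>s. (\<phi> has_real_derivative g s) (at s)" and "\<phi> 0 = 0"
    and B: "\<And>s. 0 \<le> s \<Longrightarrow> (B has_real_derivative b s) (at s)" "B 0 \<ge> 0"
    and le: "\<And>s. \<bar>g s\<bar> \<le> b \<bar>s\<bar>"
  shows "\<bar>\<phi> t\<bar> \<le> B \<bar>t\<bar>"
proof (cases "0 \<le> t")
  case True
  have "\<bar>\<phi> t\<bar> \<le> B t"
  proof (rule comparison_nonneg[OF d assms(2) B _ True])
    show "\<bar>g s\<bar> \<le> b s" if "0 \<le> s" for s using le[of s] that by simp
  qed
  then show ?thesis using True by simp
next
  case False
  have "\<bar>\<phi> (- (- t))\<bar> \<le> B (- t)"
  proof (rule comparison_nonneg[where \<phi> = "\<lambda>s. \<phi> (- s)" and g = "\<lambda>s. - g (- s)", OF _ _ B])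
    show "((\<lambda>s. \<phi> (- s)) has_real_derivative - g (- s)) (at s)" for s
      using DERIV_chain2[OF d DERIV_minus[OF DERIV_ident], of s UNIV] by simp
    show "\<bar>- g (- s)\<bar> \<le> b s" if "0 \<le> s" for s using le[of "- s"] that by simp
  qed (use False assms(2) in auto)
  then show ?thesis using False by simp
qed

text \<open>In the weight exp (l |t|) every integration gains a factor 1 / l. With \<open>g'\<close>
  = 0 the same estimate bounds a single function.\<close>

lemma antideriv_funpow_diff_le:
  assumes c: "continuous_on UNIV g" "continuous_on UNIV g'" and "0 < l" "0 \<le> d"
    and le: "\<And>s. \<bar>g s - g' s\<bar> \<le> d * exp (l * \<bar>s\<bar>)"
  shows "\<bar>(antideriv ^^ k) g t - (antideriv ^^ k) g' t\<bar> \<le> d / l ^ k * exp (l * \<bar>t\<bar>)"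
proof (induction k arbitrary: t)
  case 0 show ?case using le by simp
next
  case (Suc k)
  let ?g = "(antideriv ^^ k) g" and ?g' = "(antideriv ^^ k) g'"
  have "\<bar>antideriv ?g t - antideriv ?g' t\<bar> \<le> d / l ^ Suc k * exp (l * \<bar>t\<bar>)"
  proof (rule comparison[where B = "\<lambda>t. d / l ^ Suc k * exp (l * t)" and b = "\<lambda>t. d / l ^ k * exp (l * t)"])
    show "((\<lambda>t. antideriv ?g t - antideriv ?g' t) has_real_derivative ?g s - ?g' s) (at s)" for s
      by (intro DERIV_diff DERIV_antideriv continuous_antideriv_funpow c)
    have "((\<lambda>t. d / l ^ Suc k * exp (l * t)) has_real_derivative d / l ^ Suc k * (exp (l * s) * l)) (at s)" for s
      by (auto intro!: derivative_eq_intros)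
    moreover have "d / l ^ Suc k * (exp (l * s) * l) = d / l ^ k * exp (l * s)" for s
      using \<open>0 < l\<close> by (simp add: field_simps)
    ultimately show "((\<lambda>t. d / l ^ Suc k * exp (l * t)) has_real_derivative d / l ^ k * exp (l * s)) (at s)" for s
      by metis
  qed (use Suc.IH assms in auto)
  then show ?case by simp
qed

text \<open>Vanishing at 0 to order \<open>k\<close> is retained, so that the errors can later be
  compared with powers of \<open>t\<close> near 0 as well.\<close>

lemma antideriv_funpow_le:
  assumes c: "continuous_on UNIV g" and "0 \<le> d" and le: "\<And>s. \<bar>g s\<bar> \<le> d"
  shows "\<bar>(antideriv ^^ k) g t\<bar> \<le> d * \<bar>t\<bar> ^ k"
proof -
  have "\<bar>(antideriv ^^ k) g t\<bar> \<le> d * \<bar>t\<bar> ^ k / fact k"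
  proof (induction k arbitrary: t)
    case 0 show ?case using le by simp
  next
    case (Suc k)
    let ?g = "(antideriv ^^ k) g"
    have "\<bar>antideriv ?g t\<bar> \<le> d * \<bar>t\<bar> ^ Suc k / fact (Suc k)"
    proof (rule comparison[where B = "\<lambda>t. d * t ^ Suc k / fact (Suc k)" and b = "\<lambda>t. d * t ^ k / fact k"])
      show "(antideriv ?g has_real_derivative ?g s) (at s)" for s
        by (intro DERIV_antideriv continuous_antideriv_funpow c)
      have "((\<lambda>t. d * t ^ Suc k / fact (Suc k)) has_real_derivative
          d * ((1 + of_nat k) * (1 * s ^ k)) / fact (Suc k)) (at s)" for s
        by (intro DERIV_cdivide DERIV_cmult DERIV_power_Suc DERIV_ident)
      moreover have "d * ((1 + of_nat k) * (1 * s ^ k)) / fact (Suc k) = d * s ^ k / fact k" for s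
      proof -
        have "fact (Suc k) = (1 + real k) * fact k" by simp
        moreover have "1 + real k \<noteq> 0" by linarith
        ultimately show ?thesis by (simp only: mult_1 mult.assoc[symmetric] mult.commute[of d] mult_divide_mult_cancel_left)
            simp
      qed
      ultimately show "((\<lambda>t. d * t ^ Suc k / fact (Suc k)) has_real_derivative d * s ^ k / fact k) (at s)" for s
        by simp
    qed (use Suc.IH in auto)
    then show ?case by simp
  qed
  also have "\<dots> \<le> d * \<bar>t\<bar> ^ k / 1"
    using assms(2) by (intro divide_left_mono) auto
  finally show ?thesis by simp
qed

text \<open>The integral operator is a contraction in the sup norm with weight \<open>e\<^bsup>- l |t|\<^esup>\<close> for large \<open>l\<close>;
  the unknown is \<open>h(t) = e\<^bsup>- l |t|\<^esup> (f(t) - p(t))\<close>.\<close>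

lemma antideriv_fixpoint:
  fixes p M :: "real \<Rightarrow> real"
  assumes p: "continuous_on UNIV p" and M: "\<And>y. \<bar>M y\<bar> \<le> d" "\<And>y z. \<bar>M y - M z\<bar> \<le> c * \<bar>y - z\<bar>"
    and "N > 0" "c \<ge> 0"
  obtains f where "continuous_on UNIV f" "\<And>t. f t = p t + \<sigma> * (antideriv ^^ N) (\<lambda>s. M (f s)) t"
proof -
  \<comment> \<open>The summand 1 gives l \<le> l ^ N, and 2 |\<sigma>| c \<le> l then bounds the
    Lipschitz constant |\<sigma>| c / l ^ N of the operator by 1/2.\<close>
  define l where "l = 1 + 2 * \<bar>\<sigma>\<bar> * c"
  have l: "l \<ge> 1" "2 * \<bar>\<sigma>\<bar> * c \<le> l" using assms(5) by (simp_all add: l_def)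
  have lN: "l \<le> l ^ N" using l assms(4) self_le_power[of l N] by simp
  have cM: "continuous_on UNIV M"
  proof (rule lipschitz_on_continuous_on)
    show "c-lipschitz_on UNIV M" using M(2) assms(5) by (auto simp: lipschitz_on_def dist_real_def)
  qed
  have d0: "d \<ge> 0" using M(1)[of 0] by simp
  define I where "I h = (\<lambda>s. M (p s + exp (l * \<bar>s\<bar>) * h s))" for h :: "real \<Rightarrow> real"
  have cI: "continuous_on UNIV (I h)" if "continuous_on UNIV h" for h :: "real \<Rightarrow> real"
    unfolding I_def
    by (rule continuous_on_compose2[OF cM]) (auto intro!: continuous_intros p that)
  define F where "F h = (\<lambda>t. exp (- (l * \<bar>t\<bar>)) * (\<sigma> * (antideriv ^^ N) (I h) t))" for h
  have z: "(antideriv ^^ N) (\<lambda>x. 0) = (\<lambda>x. 0)" by (induction N) simp_all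
  have F: "F h \<in> bcontfun" if "continuous_on UNIV h" for h :: "real \<Rightarrow> real"
  proof (rule bcontfun_normI)
    show "continuous_on UNIV (F h)"
      unfolding F_def by (intro continuous_intros continuous_antideriv_funpow cI that)
    fix t
    have "\<bar>(antideriv ^^ N) (I h) t - (antideriv ^^ N) (\<lambda>x. 0) t\<bar> \<le> d / l ^ N * exp (l * \<bar>t\<bar>)"
    proof (rule antideriv_funpow_diff_le[OF cI[OF that]])
      fix s
      have "\<bar>I h s - 0\<bar> \<le> d * 1" using M(1) by (simp add: I_def)
      also have "\<dots> \<le> d * exp (l * \<bar>s\<bar>)" using d0 l by (intro mult_left_mono) auto
      finally show "\<bar>I h s - 0\<bar> \<le> d * exp (l * \<bar>s\<bar>)" .
    qed (use l d0 in auto)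
    then have "exp (- (l * \<bar>t\<bar>)) * \<bar>(antideriv ^^ N) (I h) t\<bar> \<le> exp (- (l * \<bar>t\<bar>)) * (d / l ^ N * exp (l * \<bar>t\<bar>))"
      by (intro mult_left_mono) (simp_all add: z)
    also have "\<dots> = d / l ^ N" by (simp add: exp_minus)
    finally have "\<bar>\<sigma>\<bar> * (exp (- (l * \<bar>t\<bar>)) * \<bar>(antideriv ^^ N) (I h) t\<bar>) \<le> \<bar>\<sigma>\<bar> * (d / l ^ N)"
      by (rule mult_left_mono) simp
    then show "norm (F h t) \<le> \<bar>\<sigma>\<bar> * (d / l ^ N)"
      by (simp add: F_def abs_mult mult.left_commute)
  qed
  define \<Psi> where "\<Psi> h = Bcontfun (F (apply_bcontfun h))" for h :: "real \<Rightarrow>\<^sub>C real"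
  have \<Psi>: "apply_bcontfun (\<Psi> h) = F (apply_bcontfun h)" for h
    unfolding \<Psi>_def by (rule Bcontfun_inverse) (rule F, simp)
  have "\<exists>!h. \<Psi> h = h"
  proof (rule banach_fix_type)
    show "(0::real) \<le> 1/2" "1/2 < (1::real)" by simp_all
    show "\<forall>h h'. dist (\<Psi> h) (\<Psi> h') \<le> 1/2 * dist h h'"
    proof (intro allI dist_bound)
      fix h h' :: "real \<Rightarrow>\<^sub>C real" and t
      let ?h = "apply_bcontfun h" and ?h' = "apply_bcontfun h'"
      have "\<bar>(antideriv ^^ N) (I ?h) t - (antideriv ^^ N) (I ?h') t\<bar> \<le> (c * dist h h') / l ^ N * exp (l * \<bar>t\<bar>)"
      proof (rule antideriv_funpow_diff_le[OF cI cI])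
        fix s
        have "\<bar>I ?h s - I ?h' s\<bar> \<le> c * \<bar>exp (l * \<bar>s\<bar>) * (?h s - ?h' s)\<bar>"
          using M(2)[of "p s + exp (l * \<bar>s\<bar>) * ?h s" "p s + exp (l * \<bar>s\<bar>) * ?h' s"]
          by (simp add: I_def right_diff_distrib)
        also have "\<dots> = c * exp (l * \<bar>s\<bar>) * dist (?h s) (?h' s)" by (simp add: abs_mult dist_real_def)
        also have "\<dots> \<le> c * exp (l * \<bar>s\<bar>) * dist h h'"
          using assms(5) by (intro mult_left_mono dist_bounded) auto
        finally show "\<bar>I ?h s - I ?h' s\<bar> \<le> c * dist h h' * exp (l * \<bar>s\<bar>)" by (simp add: mult_ac)
      qed (use l assms(5) in auto)
      then have "\<bar>\<sigma>\<bar> * exp (- (l * \<bar>t\<bar>)) * \<bar>(antideriv ^^ N) (I ?h) t - (antideriv ^^ N) (I ?h') t\<bar>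
          \<le> \<bar>\<sigma>\<bar> * exp (- (l * \<bar>t\<bar>)) * ((c * dist h h') / l ^ N * exp (l * \<bar>t\<bar>))"
        by (intro mult_left_mono) simp_all
      also have "\<dots> = (2 * \<bar>\<sigma>\<bar> * c) / l ^ N * (1/2 * dist h h')" by (simp add: exp_minus)
      also have "\<dots> \<le> 1 * (1/2 * dist h h')"
        using l lN by (intro mult_right_mono) (simp_all add: divide_le_eq)
      finally have "\<bar>exp (- (l * \<bar>t\<bar>)) * (\<sigma> * ((antideriv ^^ N) (I ?h) t - (antideriv ^^ N) (I ?h') t))\<bar>
          \<le> 1/2 * dist h h'"
        by (simp add: abs_mult mult_ac)
      then show "dist (apply_bcontfun (\<Psi> h) t) (apply_bcontfun (\<Psi> h') t) \<le> 1/2 * dist h h'"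
        by (simp add: \<Psi> F_def dist_real_def right_diff_distrib)
    qed
  qed
  then obtain h where h: "\<Psi> h = h" by blast
  define f where "f t = p t + exp (l * \<bar>t\<bar>) * apply_bcontfun h t" for t
  have I: "I (apply_bcontfun h) = (\<lambda>s. M (f s))" by (simp add: I_def f_def)
  show ?thesis
  proof (rule that)
    show "continuous_on UNIV f" unfolding f_def by (auto intro!: continuous_intros p)
    fix t
    have "apply_bcontfun h t = F (apply_bcontfun h) t" using \<Psi>[of h] h by simp
    then show "f t = p t + \<sigma> * (antideriv ^^ N) (\<lambda>s. M (f s)) t"
      unfolding f_def[of t] F_def I by (simp add: exp_minus)
  qed
qed

text \<open>The Lipschitz constant is exp b on the half line below \<open>b\<close>; for the
  truncated nonlinearity this gives a global Lipschitz bound.\<close>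

lemma exp_diff_le:
  fixes x y b :: real assumes "x \<le> b" "y \<le> b"
  shows "\<bar>exp x - exp y\<bar> \<le> exp b * \<bar>x - y\<bar>"
proof -
  have *: "exp x - exp y \<le> exp b * (x - y)" if "y \<le> x" "x \<le> b" for x y :: real
  proof -
    have "exp x - exp y = exp x * (1 - exp (y - x))" by (simp add: right_diff_distrib exp_diff)
    also have "\<dots> \<le> exp x * (x - y)"
    proof (rule mult_left_mono)
      show "1 - exp (y - x) \<le> x - y" using exp_ge_add_one_self[of "y - x"] by linarith
    qed simp
    also have "\<dots> \<le> exp b * (x - y)" using that by (intro mult_right_mono) auto
    finally show ?thesis .
  qed
  show ?thesis
    using *[of y x] *[of x y] assms by (cases "y \<le> x") (auto simp: abs_if)
qed

text \<open>The nonlinearity is truncated at the level \<open>- a\<close>, which the solution does not exceed on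
  \<open>T\<close>.\<close>

lemma ode_solution:
  fixes m :: nat and K :: real
  assumes m: "m \<ge> 2" and K: "K \<ge> 1"
  defines "T \<equiv> {- (K ^ 2) <..< K ^ 2}"
  obtains G a where "deriv_seq T G" "exp (2 * real m * a) = K ^ 5"
    "\<And>t. t \<in> T \<Longrightarrow> G 0 t \<le> - a"
    "\<And>t. t \<in> T \<Longrightarrow> - a - 2 * t ^ (2 * m - 2) \<le> G 0 t"
    "\<And>t. t \<in> T \<Longrightarrow> \<bar>G 1 t + (2 * real m - 2) * t ^ (2 * m - 3)\<bar> \<le> \<bar>t\<bar> ^ (2 * m - 3) / K"
    "\<And>t. t \<in> T \<Longrightarrow> \<bar>G 2 t + (2 * real m - 2) * (2 * real m - 3) * t ^ (2 * m - 4)\<bar> \<le> \<bar>t\<bar> ^ (2 * m - 4) / K"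
    "\<And>t. t \<in> T \<Longrightarrow> G (2 * m) t = (- 1) ^ m * exp (2 * real m * G 0 t)"
proof -
  define a where "a = ln (K ^ 5) / (2 * real m)"
  have K5: "0 < K ^ 5" using K by (intro zero_less_power) linarith
  have "2 * real m * a = ln (K ^ 5)" unfolding a_def using m by simp
  then have a: "exp (2 * real m * a) = K ^ 5" using exp_ln[OF K5] by metis
  define \<epsilon> where "\<epsilon> = exp (- (2 * real m * a))"
  have \<epsilon>: "\<epsilon> > 0" "\<epsilon> = 1 / K ^ 5"
    unfolding \<epsilon>_def exp_minus a using K5 by (simp_all add: inverse_eq_divide)
  define M where "M y = exp (2 * real m * min y (- a))" for y
  have Mle: "\<bar>M y\<bar> \<le> \<epsilon>" for y
  proof -
    have "2 * real m * min y (- a) \<le> 2 * real m * (- a)" by (rule mult_left_mono) auto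
    then show ?thesis by (simp add: M_def \<epsilon>_def)
  qed
  have Mlip: "\<bar>M y - M z\<bar> \<le> (\<epsilon> * (2 * real m)) * \<bar>y - z\<bar>" for y z
  proof -
    have "\<bar>M y - M z\<bar> \<le> exp (2 * real m * (- a)) * \<bar>2 * real m * min y (- a) - 2 * real m * min z (- a)\<bar>"
      unfolding M_def by (intro exp_diff_le mult_left_mono) auto
    also have "\<dots> = \<epsilon> * (2 * real m) * \<bar>min y (- a) - min z (- a)\<bar>"
      unfolding \<epsilon>_def right_diff_distrib[symmetric] abs_mult by simp
    also have "\<dots> \<le> \<epsilon> * (2 * real m) * \<bar>y - z\<bar>"
      using \<epsilon>(1) by (intro mult_left_mono) auto
    finally show ?thesis .
  qed
  define c where "c i = (\<Prod>j<i. real (2 * m - 2 - j))" for i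
  \<comment> \<open>The derivatives of the polynomial \<open>- a - t ^ (2 * m - 2)\<close>.
    Truncated subtraction in the exponent does no harm: from i = 2 m - 1 on, \<open>c i\<close>
    contains the factor 0.\<close>
  define P where "P i t = - (if i = 0 then a else 0) - c i * t ^ (2 * m - 2 - i)" for i :: nat and t :: real
  have P: "(P i has_real_derivative P (Suc i) t) (at t)" for i t
  proof -
    have "((\<lambda>t. - (if i = 0 then a else 0) - c i * t ^ (2 * m - 2 - i)) has_real_derivative
        0 - c i * (real (2 * m - 2 - i) * t ^ (2 * m - 2 - i - Suc 0))) (at t)"
      by (intro DERIV_diff DERIV_const DERIV_cmult DERIV_pow)
    moreover have "P i = (\<lambda>t. - (if i = 0 then a else 0) - c i * t ^ (2 * m - 2 - i))" by (simp add: P_def fun_eq_iff)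
    moreover have "P (Suc i) t = 0 - c i * (real (2 * m - 2 - i) * t ^ (2 * m - 2 - i - Suc 0))"
      by (simp add: P_def c_def)
    ultimately show ?thesis by simp
  qed
  have sP: "smooth_on UNIV (P 0)"
    by (rule deriv_seq_smooth_on) (simp_all add: deriv_seq_def P)
  have N0: "0 < 2 * m" and c0: "0 \<le> \<epsilon> * (2 * real m)" using m \<epsilon>(1) by simp_all
  obtain f where f: "continuous_on UNIV f"
      "\<And>t. f t = P 0 t + (- 1) ^ m * (antideriv ^^ (2 * m)) (\<lambda>s. M (f s)) t"
    using antideriv_fixpoint[OF smooth_on_continuous[OF sP] Mle Mlip N0 c0, where \<sigma> = "(- 1) ^ m"]
    by blast
  define g where "g = (\<lambda>s. M (f s))"
  have cM: "continuous_on UNIV M" unfolding M_def by (auto intro!: continuous_intros)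
  have cg: "continuous_on UNIV g"
    unfolding g_def by (rule continuous_on_compose2[OF cM f(1)]) simp
  have J: "\<bar>(antideriv ^^ k) g t\<bar> \<le> \<epsilon> * \<bar>t\<bar> ^ k" for k t
  proof (rule antideriv_funpow_le[OF cg])
    show "0 \<le> \<epsilon>" using \<epsilon>(1) by simp
    show "\<bar>g s\<bar> \<le> \<epsilon>" for s unfolding g_def by (rule Mle)
  qed
  \<comment> \<open>The reason for the exponent 5: on \<open>T\<close> the two surplus powers of |t|
    are at most \<open>K ^ 4\<close>, and the source is at most \<open>1 / K ^ 5\<close>, so a full
    factor 1 / K remains.\<close>
  have J2: "\<bar>(antideriv ^^ (k + 2)) g t\<bar> \<le> \<bar>t\<bar> ^ k / K" if "t \<in> T" for k t
  proof -
    have "\<bar>t\<bar> \<le> K\<^sup>2" using that by (simp add: T_def abs_le_iff)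
    then have t2: "\<bar>t\<bar> ^ 2 \<le> (K\<^sup>2) ^ 2" by (rule power_mono) simp
    have "\<epsilon> * \<bar>t\<bar> ^ (k + 2) \<le> \<epsilon> * (\<bar>t\<bar> ^ k * (K\<^sup>2) ^ 2)"
      unfolding power_add using \<epsilon>(1) by (intro mult_left_mono t2) simp_all
    also have "\<epsilon> * (\<bar>t\<bar> ^ k * (K\<^sup>2) ^ 2) = \<bar>t\<bar> ^ k / K"
    proof -
      have "K ^ 5 = (K\<^sup>2) ^ 2 * K" by (simp add: power2_eq_square power_numeral_reduce)
      moreover have "(K\<^sup>2) ^ 2 \<noteq> 0" "K \<noteq> 0" using K by auto
      ultimately show ?thesis unfolding \<epsilon>(2) by simp
    qed
    finally show ?thesis using J[of "k + 2" t] by linarith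
  qed
  have m2: "(2 * m - 2) + 2 = 2 * m" "even (2 * m - 2)" using m by auto
  have absp: "\<bar>t\<bar> ^ (2 * m - 2) = t ^ (2 * m - 2)" for t :: real by (rule power_even_abs[OF m2(2)])
  \<comment> \<open>The correction is at most \<open>t ^ (2 * m - 2) / K\<close> and cannot outweigh
    the leading term, which is nonpositive because the degree is even. Hence f \<le> - a on
    \<open>T\<close>, and the truncated equation is the original one there.\<close>
  have ft: "\<bar>f t + a + t ^ (2 * m - 2)\<bar> \<le> t ^ (2 * m - 2)" if "t \<in> T" for t
  proof -
    have "f t + a + t ^ (2 * m - 2) = (- 1) ^ m * (antideriv ^^ (2 * m)) g t"
      using f(2)[of t] by (simp add: P_def c_def g_def)
    then have "\<bar>f t + a + t ^ (2 * m - 2)\<bar> \<le> \<bar>t\<bar> ^ (2 * m - 2) / K"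
      using J2[OF that, of "2 * m - 2", unfolded m2(1)] by (simp add: abs_mult power_abs)
    also have "\<dots> \<le> \<bar>t\<bar> ^ (2 * m - 2) / 1" using K by (intro divide_left_mono) auto
    finally show ?thesis by (simp add: absp)
  qed
  have fa: "f t \<le> - a" if "t \<in> T" for t using ft[OF that] by linarith
  have gT: "g t = exp (2 * real m * f t)" if "t \<in> T" for t using fa[OF that] by (simp add: g_def M_def)
  have T: "open T" by (simp add: T_def)
  have step: "C_on (Suc k) T (antideriv h)" if "continuous_on UNIV h" "C_on k T h" for k h
  proof (rule C_on_SucI)
    show "antideriv h differentiable at x" for x
      using DERIV_antideriv[OF that(1)] real_differentiable_def by blast
    show "C_on k T (dird v (antideriv h))" for v
      by (subst C_on_cong[OF T dird_real[OF DERIV_antideriv[OF that(1)]]]) (rule C_on_mult[OF T that(2) C_on_const])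
  qed
  \<comment> \<open>Bootstrap, confined to \<open>T\<close> where the kink of \<open>min\<close> is
    not seen: if \<open>f\<close> is of class C^k then so is \<open>g\<close>; one antiderivative
    gains an order and the others merely keep it.\<close>
  have fC: "C_on k T f" for k
  proof (induction k)
    case 0
    show ?case unfolding C_on.simps(1) by (rule continuous_on_subset[OF f(1) subset_UNIV])
  next
    case (Suc k)
    have "C_on k T (\<lambda>t. exp (2 * real m * f t))"
      by (rule smooth_on_compose_C_on[OF T C_on_mult[OF T C_on_const Suc.IH] smooth_on_exp subset_UNIV])
    then have "C_on k T g" by (subst C_on_cong[OF T gT])
    have "C_on (Suc k) T ((antideriv ^^ Suc i) g)" for i
    proof (induction i)
      case 0 show ?case using step[OF cg \<open>C_on k T g\<close>] by simp
    next
      case (Suc i)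
      show ?case
        using step[OF continuous_antideriv_funpow[OF cg] C_on_lower[OF Suc.IH]] by simp
    qed
    moreover have "Suc (2 * m - 1) = 2 * m" using m by simp
    ultimately have "C_on (Suc k) T ((antideriv ^^ (2 * m)) g)" by metis
    moreover have "C_on (Suc k) T (P 0)"
      using smooth_on_subset[OF sP subset_UNIV, of T] unfolding smooth_on_def by blast
    ultimately have "C_on (Suc k) T (\<lambda>t. P 0 t + (- 1) ^ m * (antideriv ^^ (2 * m)) g t)"
      by (rule C_on_add[OF T _ C_on_mult[OF T C_on_const], rotated])
    moreover have "f = (\<lambda>t. P 0 t + (- 1) ^ m * (antideriv ^^ (2 * m)) g t)" unfolding g_def using f(2) by (rule ext)
    ultimately show ?case by simp
  qed
  define G where "G i = (dird 1 ^^ i) f" for i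
  have G: "deriv_seq T G"
    unfolding G_def by (rule smooth_on_deriv_seq) (simp add: smooth_on_def fC)
  \<comment> \<open>Each derivative strips one antiderivative; at i = 2 m the polynomial is gone and
    the source itself remains.\<close>
  have Gi: "G i t = P i t + (- 1) ^ m * (antideriv ^^ (2 * m - i)) g t" if "t \<in> T" "i \<le> 2 * m" for i t
    using that
  proof (induction i arbitrary: t)
    case 0
    then show ?case using f(2)[of t] by (simp add: G_def g_def)
  next
    case (Suc i)
    then have i: "2 * m - i = Suc (2 * m - Suc i)" "i \<le> 2 * m" by auto
    have "G (Suc i) t = dird 1 (\<lambda>t. P i t + (- 1) ^ m * (antideriv ^^ (2 * m - i)) g t) t"
      unfolding G_def funpow.simps o_def
      by (rule dird_cong[OF T Suc.prems(1)]) (use Suc.IH i in \<open>simp add: G_def\<close>)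
    also have "\<dots> = (P (Suc i) t + (- 1) ^ m * (antideriv ^^ (2 * m - Suc i)) g t) * 1"
      unfolding i(1) funpow.simps o_def
      by (intro dird_real DERIV_add P DERIV_cmult DERIV_antideriv continuous_antideriv_funpow cg)
    finally show ?case by simp
  qed
  have c2: "c 1 = 2 * real m - 2" "c 2 = (2 * real m - 2) * (2 * real m - 3)"
    using m by (simp_all add: c_def numeral_2_eq_2 of_nat_diff)
  have c2m: "c (2 * m) = 0"
    unfolding c_def using m by (intro prod_zero bexI[of _ "2 * m - 2"]) auto
  show ?thesis
  proof (rule that[OF G a])
    fix t assume t: "t \<in> T"
    show "G 0 t \<le> - a" using fa[OF t] by (simp add: G_def)
    show "- a - 2 * t ^ (2 * m - 2) \<le> G 0 t" using ft[OF t] by (simp add: G_def)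
    have e: "(2 * m - 3) + 2 = 2 * m - 1" "(2 * m - 4) + 2 = 2 * m - 2" using m by auto
    show "\<bar>G 1 t + (2 * real m - 2) * t ^ (2 * m - 3)\<bar> \<le> \<bar>t\<bar> ^ (2 * m - 3) / K"
      using Gi[OF t, of 1] J2[OF t, of "2 * m - 3", unfolded e] m c2(1) by (simp add: P_def abs_mult power_abs numeral_3_eq_3)
    show "\<bar>G 2 t + (2 * real m - 2) * (2 * real m - 3) * t ^ (2 * m - 4)\<bar> \<le> \<bar>t\<bar> ^ (2 * m - 4) / K"
      using Gi[OF t, of 2] J2[OF t, of "2 * m - 4", unfolded e] m c2(2) by (simp add: P_def abs_mult power_abs)
    show "G (2 * m) t = (- 1) ^ m * exp (2 * real m * G 0 t)"
      using Gi[OF t, of "2 * m"] c2m m gT[OF t] by (simp add: P_def) (simp add: G_def)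
  qed
qed

subsection \<open>The solutions\<close>

definition kelvin_sol :: "(real \<Rightarrow> real) \<Rightarrow> 'a::euclidean_space \<Rightarrow> 'a \<Rightarrow> 'a \<Rightarrow> real" where
  "kelvin_sol f c e x = f (kelvin c e x) - ln (sq c x)"

text \<open>The factor \<open>inv_sq ^ (2 m)\<close> is the Jacobian of the inversion in dimension 2
  m. \<open>polylaplacian_kelvin\<close> yields the same factor, which is why the logarithm enters
  \<open>kelvin_sol\<close> with coefficient - 2 ln |x - c|.\<close>

lemma exp_kelvin_sol:
  assumes "x \<noteq> c"
  shows "exp (2 * real m * kelvin_sol f c e x)
    = exp (2 * real m * f (kelvin c e x)) * inv_sq c x ^ (2 * m)"
proof -
  have "exp (2 * real m * ln (sq c x)) = exp (real (2 * m) * ln (sq c x))" by simp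
  also have "\<dots> = sq c x ^ (2 * m)" using sq_pos[OF assms] by (simp only: exp_of_nat_mult exp_ln)
  finally have "exp (2 * real m * ln (sq c x)) = sq c x ^ (2 * m)" .
  moreover have "exp (2 * real m * kelvin_sol f c e x)
      = exp (2 * real m * f (kelvin c e x)) / exp (2 * real m * ln (sq c x))"
    by (simp only: kelvin_sol_def right_diff_distrib exp_diff)
  ultimately show ?thesis by (simp only: inv_sq_eq power_inverse divide_inverse)
qed

context
  fixes c e :: "'a::euclidean_space" and T :: "real set" and S :: "'a set" and G m
  assumes e: "e \<bullet> e = 1" and T: "open T" and S: "open S" "c \<notin> S" "kelvin c e ` S \<subseteq> T"
    and G: "deriv_seq T G" and dim: "DIM('a) = 2 * m" and m: "m \<ge> 2"
begin

lemma smooth_on_G_kelvin: "smooth_on S (\<lambda>x. G 0 (kelvin c e x))"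
  using smooth_on_kelvin_term[OF e T S G, of 0 0] by simp

lemma smooth_on_kelvin_sol: "smooth_on S (kelvin_sol (G 0) c e)"
  unfolding kelvin_sol_def[abs_def]
  by (rule smooth_on_diff[OF S(1) smooth_on_G_kelvin smooth_on_ln_sq[OF e T S]])

lemma smooth_on_minus_ln: "smooth_on S (\<lambda>x. (- 1) * ln (sq c x))"
  by (rule smooth_on_mult[OF S(1) smooth_on_const smooth_on_ln_sq[OF e T S]])

lemma kelvin_sol_eq: "kelvin_sol (G 0) c e = (\<lambda>x. G 0 (kelvin c e x) + (- 1) * ln (sq c x))"
  by (simp add: kelvin_sol_def fun_eq_iff)

lemma laplacian_kelvin_sol:
  assumes "x \<in> S"
  shows "laplacian (kelvin_sol (G 0) c e) x = inv_sq c x ^ 2 * G 2 (kelvin c e x)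
    - (4 * real m - 4) * (inv_sq c x * (kelvin c e x * G 1 (kelvin c e x))) - (4 * real m - 4) * inv_sq c x"
proof -
  have "laplacian (kelvin_sol (G 0) c e) x
      = laplacian (\<lambda>x. G 0 (kelvin c e x)) x + laplacian (\<lambda>x. (- 1) * ln (sq c x)) x"
    unfolding kelvin_sol_eq
    by (rule laplacian_add[OF S(1) smooth_on_G_kelvin smooth_on_minus_ln assms])
  also have "laplacian (\<lambda>x. (- 1) * ln (sq c x)) x = (- 1) * laplacian (\<lambda>x. ln (sq c x)) x"
    by (rule laplacian_cmult[OF S(1) smooth_on_ln_sq[OF e T S] assms])
  also have "laplacian (\<lambda>x. G 0 (kelvin c e x)) x = inv_sq c x ^ 2 * G 2 (kelvin c e x)
      + (4 - 2 * real (2 * m)) * (inv_sq c x * (kelvin c e x * G 1 (kelvin c e x)))"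
    using laplacian_kelvin_term[OF e T S G assms, of 0] by (simp add: dim eul_def power2_eq_square)
  finally show ?thesis
    unfolding laplacian_ln_sq[OF e T S assms] dim by (simp add: algebra_simps)
qed

lemma Q_solution_kelvin_sol:
  assumes ode: "\<And>t. t \<in> T \<Longrightarrow> G (2 * m) t = (- 1) ^ m * exp (2 * real m * G 0 t)"
  shows "Q_solution m S (kelvin_sol (G 0) c e)"
  unfolding Q_solution_def
proof
  show "C_on (2 * m - 1) S (kelvin_sol (G 0) c e)" using smooth_on_kelvin_sol unfolding smooth_on_def by blast
  show "polyharmonic_eq_distr m S (kelvin_sol (G 0) c e) (\<lambda>x. exp (2 * real m * kelvin_sol (G 0) c e x))"
  proof (rule polyharmonic_eq_distrI[OF S(1) smooth_on_kelvin_sol])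
    fix x assume x: "x \<in> S"
    then have "x \<noteq> c" "kelvin c e x \<in> T" using S by auto
    have "(laplacian ^^ m) (kelvin_sol (G 0) c e) x
        = (laplacian ^^ m) (\<lambda>x. G 0 (kelvin c e x)) x + (- 1) * (laplacian ^^ m) (\<lambda>x. ln (sq c x)) x"
      unfolding kelvin_sol_eq
      using funpow_laplacian_add[OF S(1) smooth_on_G_kelvin smooth_on_minus_ln x]
        funpow_laplacian_cmult[OF S(1) smooth_on_ln_sq[OF e T S] x] by metis
    also have "\<dots> = inv_sq c x ^ (2 * m) * G (2 * m) (kelvin c e x)"
      unfolding polylaplacian_kelvin[OF e T S G x dim] polylaplacian_ln_sq[OF e T S x dim m] by simp
    finally show "(- 1) ^ m * (laplacian ^^ m) (kelvin_sol (G 0) c e) x = exp (2 * real m * kelvin_sol (G 0) c e x)"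
      unfolding exp_kelvin_sol[OF \<open>x \<noteq> c\<close>] ode[OF \<open>kelvin c e x \<in> T\<close>]
      by (simp add: mult_ac flip: power_mult_distrib power_add mult_2)
  qed
qed

end

section \<open>The pole and the ball\<close>

lemma inv_sq_norm: "inv_sq c x = 1 / (norm (x - c))\<^sup>2"
  by (simp add: inv_sq_def power2_norm_eq_inner inverse_eq_divide)

lemma kelvin_le:
  assumes "e \<bullet> e = 1" shows "\<bar>kelvin c e x\<bar> \<le> 1 / norm (x - c)"
proof (cases "x = c")
  case False
  have "norm e = 1" using assms by (simp add: norm_eq_sqrt_inner)
  then have "\<bar>(x - c) \<bullet> e\<bar> \<le> norm (x - c)" using Cauchy_Schwarz_ineq2[of "x - c" e] by simp
  then have "\<bar>(x - c) \<bullet> e\<bar> / (norm (x - c))\<^sup>2 \<le> norm (x - c) / (norm (x - c))\<^sup>2"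
    by (rule divide_right_mono) simp
  then show ?thesis using False
    by (simp add: kelvin_def inv_sq_norm abs_mult power2_eq_square)
qed (simp add: kelvin_def)

text \<open>\<open>e\<close> is the direction of the Kelvin coordinate and \<open>\<nu>\<close> the
  direction in which the pole lies. Their orthogonality lets \<open>kelvin\<close> stay small at
  points of the ball close to the pole, without which no large mass could arise there.\<close>

locale two_directions =
  fixes e \<nu> :: "'a::euclidean_space" and m :: nat
  assumes e: "e \<in> Basis" and \<nu>: "\<nu> \<in> Basis" and e\<nu>: "e \<noteq> \<nu>" and dim: "DIM('a) = 2 * m" and m: "m \<ge> 2"
begin

lemma ee: "e \<bullet> e = 1" "\<nu> \<bullet> \<nu> = 1" "e \<bullet> \<nu> = 0" "\<nu> \<bullet> e = 0" "norm \<nu> = 1" "norm e = 1"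
  using e \<nu> e\<nu> by (simp_all add: inner_Basis)

definition pole :: "real \<Rightarrow> 'a" where "pole d = (2 + d) *\<^sub>R \<nu>"

lemma norm_pole:
  assumes "0 \<le> d" "x \<in> ball 0 r" shows "2 - r + d < norm (x - pole d)"
proof -
  have "norm (pole d) = 2 + d" using assms by (simp add: pole_def ee)
  then show ?thesis using norm_triangle_ineq2[of "pole d" x] assms(2) by (simp add: norm_minus_commute)
qed

lemma in_ball_iff:
  assumes "x = pole d + q"
  shows "x \<in> ball 0 2 \<longleftrightarrow> (norm q)\<^sup>2 + 2 * (2 + d) * (q \<bullet> \<nu>) + 4 * d + d\<^sup>2 < 0"
proof -
  have "x \<in> ball 0 2 \<longleftrightarrow> (norm x)\<^sup>2 < 2\<^sup>2" using abs_square_less_1[of "norm x / 2"] by (simp add: power_divide)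
  also have "(norm x)\<^sup>2 = (norm q)\<^sup>2 + 2 * (2 + d) * (q \<bullet> \<nu>) + (2 + d)\<^sup>2"
    unfolding assms power2_norm_eq_inner
    by (simp add: pole_def inner_add_left inner_add_right ee inner_commute[of \<nu> q] power2_eq_square algebra_simps)
  finally show ?thesis by (simp add: power2_eq_square algebra_simps)
qed

end

text \<open>The ODE solution is fixed by \<open>K\<close>, while the pole distance remains a free
  parameter for the intermediate value argument.\<close>

locale kelvin_ode = two_directions +
  fixes G :: "nat \<Rightarrow> real \<Rightarrow> real" and K a :: real and T
  assumes K: "K \<ge> 1" and T_def: "T = {- (K ^ 2) <..< K ^ 2}" and G: "deriv_seq T G"
    and a: "exp (2 * real m * a) = K ^ 5"
    and G0_le: "\<And>t. t \<in> T \<Longrightarrow> G 0 t \<le> - a"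
    and G0_ge: "\<And>t. t \<in> T \<Longrightarrow> - a - 2 * t ^ (2 * m - 2) \<le> G 0 t"
    and G1: "\<And>t. t \<in> T \<Longrightarrow> \<bar>G 1 t + (2 * real m - 2) * t ^ (2 * m - 3)\<bar> \<le> \<bar>t\<bar> ^ (2 * m - 3) / K"
    and G2: "\<And>t. t \<in> T \<Longrightarrow> \<bar>G 2 t + (2 * real m - 2) * (2 * real m - 3) * t ^ (2 * m - 4)\<bar> \<le> \<bar>t\<bar> ^ (2 * m - 4) / K"
    and ode: "\<And>t. t \<in> T \<Longrightarrow> G (2 * m) t = (- 1) ^ m * exp (2 * real m * G 0 t)"
begin

definition sol :: "real \<Rightarrow> 'a \<Rightarrow> real" where "sol d = kelvin_sol (G 0) (pole d) e"

lemma open_T: "open T" by (simp add: T_def)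

text \<open>|\<open>kelvin\<close>| is at most 1 / |x - c| < 1 / d, so d \<ge>
  \<open>1 / K ^ 2\<close> is what keeps the argument of \<open>G\<close> inside
  \<open>T\<close>.\<close>

lemma pole_facts:
  assumes d: "1 / K\<^sup>2 \<le> d" and x: "x \<in> ball 0 2"
  shows "0 < d" "d < norm (x - pole d)" "x \<noteq> pole d" "kelvin (pole d) e x \<in> T"
proof -
  have "0 < 1 / K\<^sup>2" using K by simp
  then show d0: "0 < d" using d by linarith
  show n: "d < norm (x - pole d)" using norm_pole[of d x 2] x d0 by simp
  then show "x \<noteq> pole d" using d0 by auto
  have "1 / norm (x - pole d) < 1 / d" using n d0 by (simp add: frac_less2)
  also have "\<dots> \<le> K\<^sup>2" using d d0 K by (simp add: field_simps)
  finally have "\<bar>kelvin (pole d) e x\<bar> < K\<^sup>2" using kelvin_le[OF ee(1), of "pole d" x] by linarith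
  then show "kelvin (pole d) e x \<in> T" by (simp add: T_def abs_less_iff)
qed

lemma kelvin_image:
  assumes "1 / K\<^sup>2 \<le> d" shows "kelvin (pole d) e ` ball 0 2 \<subseteq> T" "pole d \<notin> ball 0 2"
  using pole_facts[OF assms] by blast+

lemma Q_solution_sol: "1 / K\<^sup>2 \<le> d \<Longrightarrow> Q_solution m (ball 0 2) (sol d)"
  unfolding sol_def
  by (rule Q_solution_kelvin_sol[OF ee(1) open_T open_ball _ _ G dim m ode]) (rule kelvin_image(2), assumption, rule kelvin_image(1))

lemma smooth_on_sol: "1 / K\<^sup>2 \<le> d \<Longrightarrow> smooth_on (ball 0 2) (sol d)"
  unfolding sol_def
  by (rule smooth_on_kelvin_sol[OF ee(1) open_T open_ball _ _ G dim m]) (rule kelvin_image(2), assumption, rule kelvin_image(1))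

lemma laplacian_sol:
  assumes "1 / K\<^sup>2 \<le> d" "x \<in> ball 0 2"
  shows "laplacian (sol d) x = inv_sq (pole d) x ^ 2 * G 2 (kelvin (pole d) e x)
    - (4 * real m - 4) * (inv_sq (pole d) x * (kelvin (pole d) e x * G 1 (kelvin (pole d) e x)))
    - (4 * real m - 4) * inv_sq (pole d) x"
  unfolding sol_def
  by (rule laplacian_kelvin_sol[OF ee(1) open_T open_ball kelvin_image(2,1)[OF assms(1)] G dim m assms(2)])

lemma exp_sol:
  assumes "1 / K\<^sup>2 \<le> d" "x \<in> ball 0 2"
  shows "exp (2 * real m * sol d x) = exp (2 * real m * G 0 (kelvin (pole d) e x)) * inv_sq (pole d) x ^ (2 * m)"
  unfolding sol_def by (rule exp_kelvin_sol[OF pole_facts(3)[OF assms]])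

lemma exp_minus_a: "exp (2 * real m * (- a)) = 1 / K ^ 5"
  using a by (simp add: exp_minus inverse_eq_divide)

lemma exp_sol_le:
  assumes "1 / K\<^sup>2 \<le> d" "x \<in> ball 0 2"
  shows "exp (2 * real m * sol d x) \<le> 1 / K ^ 5 * (1 / d\<^sup>2) ^ (2 * m)"
  unfolding exp_sol[OF assms]
proof (rule mult_mono)
  have "2 * real m * G 0 (kelvin (pole d) e x) \<le> 2 * real m * (- a)"
    using G0_le[OF pole_facts(4)[OF assms]] by (intro mult_left_mono) auto
  then show "exp (2 * real m * G 0 (kelvin (pole d) e x)) \<le> 1 / K ^ 5"
    unfolding exp_minus_a[symmetric] by simp
  note p = pole_facts[OF assms]
  have "d\<^sup>2 \<le> (norm (x - pole d))\<^sup>2" using p by (intro power_mono) auto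
  then have "inv_sq (pole d) x \<le> 1 / d\<^sup>2" unfolding inv_sq_norm using p(1,3) by (intro divide_left_mono mult_pos_pos) auto
  then show "inv_sq (pole d) x ^ (2 * m) \<le> (1 / d\<^sup>2) ^ (2 * m)"
    by (rule power_mono) (simp add: inv_sq_norm)
qed (use K in \<open>auto simp: inv_sq_norm\<close>)

section \<open>The mass as a function of the pole distance\<close>

definition mass :: "real \<Rightarrow> real" where
  "mass d = (LINT x:ball 0 2|lborel. exp (2 * real m * sol d x))"

lemma ball_finite: "emeasure lborel (ball x r :: 'a set) < \<infinity>"
  by (rule emeasure_bounded_finite[OF bounded_ball])

lemma exp_sol_measurable:
  assumes "1 / K\<^sup>2 \<le> d"
  shows "(\<lambda>x. indicator (ball 0 2) x *\<^sub>R exp (2 * real m * sol d x)) \<in> borel_measurable lborel"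
proof -
  have "continuous_on (ball 0 2) (\<lambda>x. exp (2 * real m * sol d x))"
    by (intro continuous_intros smooth_on_continuous[OF smooth_on_sol[OF assms]])
  from borel_measurable_continuous_on_indicator[OF _ this] show ?thesis by simp
qed

lemma exp_sol_integrable:
  assumes "1 / K\<^sup>2 \<le> d"
  shows "set_integrable lborel (ball 0 2) (\<lambda>x. exp (2 * real m * sol d x))"
  unfolding set_integrable_def
proof (rule Bochner_Integration.integrable_bound[OF _ exp_sol_measurable[OF assms]])
  show "integrable lborel (\<lambda>x. (1 / K ^ 5 * (1 / d\<^sup>2) ^ (2 * m)) * indicator (ball 0 2 :: 'a set) x)"
    by (intro integrable_mult_right integrable_real_indicator) (simp_all add: ball_finite[unfolded infinity_ennreal_def])
  show "AE x in lborel. norm (indicator (ball 0 2) x *\<^sub>R exp (2 * real m * sol d x))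
     \<le> norm ((1 / K ^ 5 * (1 / d\<^sup>2) ^ (2 * m)) * indicator (ball 0 2 :: 'a set) x)"
    using exp_sol_le[OF assms] K by (intro AE_I2) (auto simp: indicator_def abs_mult)
qed

lemma nn_integral_sol:
  assumes "1 / K\<^sup>2 \<le> d"
  shows "(\<integral>\<^sup>+x\<in>ball 0 2. ennreal (exp (2 * real m * sol d x)) \<partial>lborel) = ennreal (mass d)"
proof -
  have "(\<integral>\<^sup>+x\<in>ball 0 2. ennreal (exp (2 * real m * sol d x)) \<partial>lborel)
      = (\<integral>\<^sup>+x. ennreal (indicator (ball 0 2) x *\<^sub>R exp (2 * real m * sol d x)) \<partial>lborel)"
    by (intro nn_integral_cong) (simp add: indicator_def)
  also have "\<dots> = ennreal (mass d)"
    unfolding mass_def set_lebesgue_integral_def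
    using exp_sol_integrable[OF assms] by (intro nn_integral_eq_integral) (auto simp: set_integrable_def)
  finally show ?thesis .
qed

text \<open>Used at both ends: for d = 1 it makes the mass small, and for the d finally selected it
  turns the prescribed mass into an upper bound for d.\<close>

lemma mass_le:
  assumes "1 / K\<^sup>2 \<le> d"
  shows "mass d \<le> 1 / K ^ 5 * (1 / d\<^sup>2) ^ (2 * m) * measure lborel (ball 0 2 :: 'a set)"
proof -
  have "mass d \<le> (LINT x:(ball 0 2 :: 'a set)|lborel. 1 / K ^ 5 * (1 / d\<^sup>2) ^ (2 * m))"
    unfolding mass_def
  proof (rule set_integral_mono[OF exp_sol_integrable[OF assms]])
    show "set_integrable lborel (ball 0 2 :: 'a set) (\<lambda>x. 1 / K ^ 5 * (1 / d\<^sup>2) ^ (2 * m))"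
      by (simp add: set_integrable_def ball_finite[unfolded infinity_ennreal_def])
  qed (rule exp_sol_le[OF assms])
  also have "\<dots> = 1 / K ^ 5 * (1 / d\<^sup>2) ^ (2 * m) * measure lborel (ball 0 2 :: 'a set)"
    by (simp add: set_lebesgue_integral_def)
  finally show ?thesis .
qed

lemma tendsto_exp_sol:
  assumes D: "\<And>k. 1 / K\<^sup>2 \<le> D k" "1 / K\<^sup>2 \<le> d" "D \<longlonglongrightarrow> d" and x: "x \<in> ball 0 2"
  shows "(\<lambda>k. exp (2 * real m * sol (D k) x)) \<longlonglongrightarrow> exp (2 * real m * sol d x)"
proof -
  note p = pole_facts[OF D(2) x]
  have r: "(\<lambda>k. inv_sq (pole (D k)) x) \<longlonglongrightarrow> inv_sq (pole d) x"
    unfolding inv_sq_def pole_def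
    by (intro tendsto_intros D(3)) (use p(3) in \<open>simp add: pole_def\<close>)
  then have t: "(\<lambda>k. kelvin (pole (D k)) e x) \<longlonglongrightarrow> kelvin (pole d) e x"
    unfolding kelvin_def pole_def by (intro tendsto_intros D(3))
  have "isCont (G 0) (kelvin (pole d) e x)"
    using G p(4) unfolding deriv_seq_def by (blast intro: DERIV_isCont)
  then have "(\<lambda>k. G 0 (kelvin (pole (D k)) e x)) \<longlonglongrightarrow> G 0 (kelvin (pole d) e x)"
    by (rule isCont_tendsto_compose[OF _ t])
  then have "(\<lambda>k. exp (2 * real m * G 0 (kelvin (pole (D k)) e x)) * inv_sq (pole (D k)) x ^ (2 * m))
     \<longlonglongrightarrow> exp (2 * real m * G 0 (kelvin (pole d) e x)) * inv_sq (pole d) x ^ (2 * m)"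
    by (intro tendsto_intros r)
  then show ?thesis unfolding exp_sol[OF D(1) x] exp_sol[OF D(2) x] .
qed

lemma continuous_mass: "continuous_on {1 / K\<^sup>2..1} mass"
proof (rule continuous_on_sequentiallyI)
  fix D d assume "\<forall>k. D k \<in> {1 / K\<^sup>2..1}" "d \<in> {1 / K\<^sup>2..1}" and lim: "D \<longlonglongrightarrow> d"
  then have D: "1 / K\<^sup>2 \<le> D k" and d: "1 / K\<^sup>2 \<le> d" for k by auto
  have K0: "0 < 1 / K\<^sup>2" using K by simp
  \<comment> \<open>The pointwise bound for the smallest admissible distance
    \<open>1 / K ^ 2\<close> dominates for all distances at once.\<close>
  define B where "B = 1 / K ^ 5 * (1 / (1 / K\<^sup>2)\<^sup>2) ^ (2 * m)"
  show "(\<lambda>k. mass (D k)) \<longlonglongrightarrow> mass d"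
    unfolding mass_def set_lebesgue_integral_def
  proof (rule integral_dominated_convergence[where w = "\<lambda>x. B * indicator (ball 0 2) x"])
    show "integrable lborel (\<lambda>x. B * indicator (ball 0 2 :: 'a set) x)"
      by (intro integrable_mult_right integrable_real_indicator) (simp_all add: ball_finite[unfolded infinity_ennreal_def])
    show "AE x in lborel. (\<lambda>k. indicator (ball 0 2) x *\<^sub>R exp (2 * real m * sol (D k) x))
      \<longlonglongrightarrow> indicator (ball 0 2) x *\<^sub>R exp (2 * real m * sol d x)"
    proof (rule AE_I2)
      fix x :: 'a
      show "(\<lambda>k. indicator (ball 0 2) x *\<^sub>R exp (2 * real m * sol (D k) x))
        \<longlonglongrightarrow> indicator (ball 0 2) x *\<^sub>R exp (2 * real m * sol d x)"
        using tendsto_exp_sol[OF D d lim, of x] by (cases "x \<in> ball 0 2") simp_all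
    qed
    show "AE x in lborel. norm (indicator (ball 0 2) x *\<^sub>R exp (2 * real m * sol (D k) x))
      \<le> B * indicator (ball 0 2) x" for k
    proof (rule AE_I2)
      fix x :: 'a
      have "0 < D k" using D[of k] K0 by linarith
      then have "(1 / (D k)\<^sup>2) ^ (2 * m) \<le> (1 / (1 / K\<^sup>2)\<^sup>2) ^ (2 * m)"
        using D[of k] K0 by (intro power_mono divide_left_mono mult_pos_pos zero_less_power) (auto simp del: zero_less_divide_iff zero_less_divide_1_iff)
      then have "1 / K ^ 5 * (1 / (D k)\<^sup>2) ^ (2 * m) \<le> B"
        unfolding B_def using K by (intro mult_left_mono) auto
      then show "norm (indicator (ball 0 2) x *\<^sub>R exp (2 * real m * sol (D k) x)) \<le> B * indicator (ball 0 2) x"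
        using exp_sol_le[OF D[of k], of x] by (cases "x \<in> ball 0 2") simp_all
    qed
  qed (use exp_sol_measurable D d in simp_all)
qed

end

subsection \<open>Mass and Laplacian of the solutions\<close>

text \<open>With y = M - 1 the leading terms are - (4 y^2 - 2 y) + 8 \<tau> y^2. Since y \<ge> 1 and
  8 \<tau> \<le> 36/25, they are at most - 14/25; the choice of \<open>K\<close> keeps the errors
  below 1/200. The tightest case is y = 1, that is m = 2, where \<tau> < 1/4 is the true
  threshold.\<close>

lemma bracket_le:
  fixes M K \<tau> :: real
  assumes M: "2 \<le> M" and K: "200 * M \<le> K" and \<tau>: "0 \<le> \<tau>" "\<tau> \<le> 9/50"
  shows "- ((2 * M - 2) * (2 * M - 3)) + 1 / K + (4 * M - 4) * \<tau> * (2 * M - 2 + 1 / K) \<le> - (1/2)"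
proof -
  define y where "y = M - 1"
  have y: "1 \<le> y" "M = y + 1" using M by (simp_all add: y_def)
  have "1 / K \<le> 1 / (200 * M)" using K M by (intro divide_left_mono) auto
  then have k: "M * (1 / K) \<le> 1 / 200" using M by (simp add: field_simps)
  have K0: "0 \<le> 1 / K" using K M by simp
  have "(4 * M - 4) * \<tau> * (2 * M - 2 + 1 / K) \<le> (4 * M - 4) * (9/50) * (2 * M - 2 + 1 / K)"
    using M \<tau> K0 by (intro mult_right_mono mult_left_mono) auto
  also have "\<dots> = 36/25 * y\<^sup>2 + 18/25 * (y * (1 / K))" by (simp add: y(2) power2_eq_square algebra_simps)
  finally have "(4 * M - 4) * \<tau> * (2 * M - 2 + 1 / K) \<le> 36/25 * y\<^sup>2 + 18/25 * (y * (1 / K))" .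
  moreover have "(2 * M - 2) * (2 * M - 3) = 4 * y\<^sup>2 - 2 * y" by (simp add: y(2) power2_eq_square algebra_simps)
  moreover have "y \<le> y\<^sup>2" using y(1) by (simp add: power2_eq_square)
  moreover have "y * (1 / K) + 1 / K \<le> 1 / 200" using k by (simp only: y(2) distrib_right mult_1)
  moreover have "0 \<le> y * (1 / K)" using y K0 by simp
  ultimately show ?thesis using y(1) by linarith
qed

text \<open>\<open>R\<close> is the conformal factor, \<open>t\<close> the Kelvin coordinate, and
  \<tau> = t^2 / R is the squared cosine of the angle at the pole between x - c and
  \<open>e\<close>. As R^2 t^(2m-4) = \<tau>^(m-2) R^m, the f'' term has the order R^m;
  \<open>bracket_le\<close> absorbs the f' term, and the last term is nonpositive. The lower bound
  on \<tau> keeps \<tau>^(m-2) away from 0.\<close>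

lemma laplacian_upper_bound:
  fixes t R \<tau> g1 g2 K :: real and m :: nat
  assumes m: "2 \<le> m" and K: "200 * real m \<le> K" and R: "0 \<le> R" and tR: "t\<^sup>2 = \<tau> * R"
    and \<tau>: "1/100 \<le> \<tau>" "\<tau> \<le> 9/50"
    and g1: "\<bar>g1 + (2 * real m - 2) * t ^ (2 * m - 3)\<bar> \<le> \<bar>t\<bar> ^ (2 * m - 3) / K"
    and g2: "\<bar>g2 + (2 * real m - 2) * (2 * real m - 3) * t ^ (2 * m - 4)\<bar> \<le> \<bar>t\<bar> ^ (2 * m - 4) / K"
  shows "R\<^sup>2 * g2 - (4 * real m - 4) * (R * (t * g1)) - (4 * real m - 4) * R \<le> - (1/2 * (1/100) ^ m * R ^ m)"
proof -
  define A where "A = t ^ (2 * m - 4)"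
  have mm: "2 * m - 4 = 2 * (m - 2)" "2 * m - 3 = Suc (2 * m - 4)" using m by auto
  have Aeq: "A = \<tau> ^ (m - 2) * R ^ (m - 2)" unfolding A_def mm(1) power_mult tR power_mult_distrib ..
  have A0: "0 \<le> A" using Aeq \<tau> R by simp
  have absA: "\<bar>t\<bar> ^ (2 * m - 4) = A" using A0 unfolding A_def by (simp flip: power_abs)
  have t3: "t ^ (2 * m - 3) = t * A" "\<bar>t\<bar> ^ (2 * m - 3) = \<bar>t\<bar> * A"
    unfolding mm(2) power_Suc absA by (simp_all add: A_def)
  have b2: "R\<^sup>2 * g2 \<le> R\<^sup>2 * (A * (- ((2 * real m - 2) * (2 * real m - 3)) + 1 / K))"
    using g2 unfolding absA A_def[symmetric] by (intro mult_left_mono) (auto simp: algebra_simps abs_le_iff)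
  have "- (t * g1) = (2 * real m - 2) * (t\<^sup>2 * A) - t * (g1 + (2 * real m - 2) * (t * A))"
    by (simp add: algebra_simps power2_eq_square)
  also have "- (t * (g1 + (2 * real m - 2) * (t * A))) \<le> \<bar>t\<bar> * (\<bar>t\<bar> * A / K)"
  proof -
    have "- (t * (g1 + (2 * real m - 2) * (t * A))) \<le> \<bar>t\<bar> * \<bar>g1 + (2 * real m - 2) * (t * A)\<bar>"
      using abs_ge_minus_self[of "t * (g1 + (2 * real m - 2) * (t * A))"] by (simp only: abs_mult)
    also have "\<dots> \<le> \<bar>t\<bar> * (\<bar>t\<bar> * A / K)" using g1 unfolding t3 by (intro mult_left_mono) auto
    finally show ?thesis .
  qed
  then have "(2 * real m - 2) * (t\<^sup>2 * A) - t * (g1 + (2 * real m - 2) * (t * A))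
      \<le> (2 * real m - 2) * (t\<^sup>2 * A) + \<bar>t\<bar> * (\<bar>t\<bar> * A / K)" by linarith
  also have "\<dots> = A * t\<^sup>2 * (2 * real m - 2 + 1 / K)"
    by (simp add: algebra_simps power2_eq_square flip: abs_mult)
  finally have "- (t * g1) \<le> A * (\<tau> * R) * (2 * real m - 2 + 1 / K)" unfolding tR .
  then have b1: "(4 * real m - 4) * R * (- (t * g1)) \<le> (4 * real m - 4) * R * (A * (\<tau> * R) * (2 * real m - 2 + 1 / K))"
    using m R by (intro mult_left_mono) auto
  have "R\<^sup>2 * g2 - (4 * real m - 4) * (R * (t * g1)) - (4 * real m - 4) * R
      \<le> R\<^sup>2 * g2 + (4 * real m - 4) * R * (- (t * g1))"
    using m R by simp
  also have "\<dots> \<le> R\<^sup>2 * (A * (- ((2 * real m - 2) * (2 * real m - 3)) + 1 / K))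
      + (4 * real m - 4) * R * (A * (\<tau> * R) * (2 * real m - 2 + 1 / K))"
    by (rule add_mono[OF b2 b1])
  also have "\<dots> = (A * R\<^sup>2) * (- ((2 * real m - 2) * (2 * real m - 3)) + 1 / K
      + (4 * real m - 4) * \<tau> * (2 * real m - 2 + 1 / K))"
    by (simp add: algebra_simps power2_eq_square)
  also have "\<dots> \<le> (A * R\<^sup>2) * (- (1/2))"
    using bracket_le[of "real m" K \<tau>] m K \<tau> A0 by (intro mult_left_mono) auto
  also have "A * R\<^sup>2 = \<tau> ^ (m - 2) * R ^ m"
  proof -
    have "R ^ m = R ^ (m - 2) * R\<^sup>2" using m by (simp only: power_add[symmetric] le_add_diff_inverse2)
    then show ?thesis by (simp add: Aeq)
  qed
  also have "\<tau> ^ (m - 2) * R ^ m * - (1 / 2) \<le> - (1/2 * (1/100) ^ m * R ^ m)"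
  proof -
    have "(1/100 :: real) ^ m \<le> (1/100) ^ (m - 2)" by (rule power_decreasing) auto
    also have "\<dots> \<le> \<tau> ^ (m - 2)" using \<tau> by (intro power_mono) auto
    finally have "(1/100) ^ m * R ^ m \<le> \<tau> ^ (m - 2) * R ^ m" using R by (intro mult_right_mono) auto
    then show ?thesis by linarith
  qed
  finally show ?thesis .
qed

context kelvin_ode begin

text \<open>The direction \<open>e - 4 \<nu>\<close> points from the pole into the ball and has
  squared cosine 1/17 with \<open>e\<close>. Relative to the pole, everything scales with
  \<open>s\<close>: the \<open>e\<close>-component lies between s/2 and 3s/2, and the squared norm
  between 25/2 s^2 (from 1/4 + 49/4) and 25 s^2. Hence the bounds 1/100 and 9/50 for \<tau>. The
  second claim serves to separate different scales.\<close>

lemma laplacian_sol_le_scaled: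
  assumes d: "1 / K\<^sup>2 \<le> d" "d \<le> s" and s: "s \<le> 1 / 4" and K200: "200 * real m \<le> K"
    and x: "x \<in> ball (pole d + s *\<^sub>R (e - 4 *\<^sub>R \<nu>)) (s / 2)"
  shows "x \<in> ball 0 2" "(x - pole d) \<bullet> \<nu> \<in> {- (9/2) * s <..< - (7/2) * s}"
    "1/2 * (1/100) ^ m * (1/25) ^ m / s ^ (2 * m) \<le> - laplacian (sol d) x"
proof -
  have "0 < 1 / K\<^sup>2" using K by simp
  then have d0: "0 < d" and s0: "0 < s" using d by linarith+
  define q where "q = x - pole d"
  define w where "w = q - s *\<^sub>R (e - 4 *\<^sub>R \<nu>)"
  have xq: "x = pole d + q" by (simp add: q_def)
  have w: "norm w < s / 2" using x by (simp add: w_def q_def dist_norm norm_minus_commute algebra_simps)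
  have qe: "q \<bullet> e = s + w \<bullet> e" and q\<nu>: "q \<bullet> \<nu> = - (4 * s) + w \<bullet> \<nu>"
    by (simp_all add: w_def inner_diff_left ee algebra_simps)
  have we: "\<bar>w \<bullet> e\<bar> < s / 2" "\<bar>w \<bullet> \<nu>\<bar> < s / 2"
    using Cauchy_Schwarz_ineq2[of w e] Cauchy_Schwarz_ineq2[of w \<nu>] w by (simp_all add: ee)
  have e1: "s / 2 \<le> q \<bullet> e" "q \<bullet> e \<le> 3/2 * s" using we qe by linarith+
  have \<nu>1: "- (9/2) * s < q \<bullet> \<nu>" "q \<bullet> \<nu> < - (7/2) * s" using we q\<nu> by linarith+
  then show "(x - pole d) \<bullet> \<nu> \<in> {- (9/2) * s <..< - (7/2) * s}" by (simp add: q_def)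
  have "norm q \<le> norm w + norm (s *\<^sub>R (e - 4 *\<^sub>R \<nu>))"
    using norm_triangle_ineq[of w "s *\<^sub>R (e - 4 *\<^sub>R \<nu>)"] by (simp add: w_def)
  also have "norm (s *\<^sub>R (e - 4 *\<^sub>R \<nu>)) \<le> s * (9/2)"
  proof -
    have "(norm (e - 4 *\<^sub>R \<nu>))\<^sup>2 = 17"
      unfolding power2_norm_eq_inner by (simp add: inner_diff_left inner_diff_right ee)
    then have "(norm (e - 4 *\<^sub>R \<nu>))\<^sup>2 \<le> (9/2)\<^sup>2" by (simp add: power2_eq_square)
    then have "norm (e - 4 *\<^sub>R \<nu>) \<le> 9/2" by (rule power2_le_imp_le) simp
    then show ?thesis using s0 by simp
  qed
  finally have nq: "norm q \<le> 5 * s" using w by linarith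
  then have nq2: "(norm q)\<^sup>2 \<le> 25 * s\<^sup>2"
    using power_mono[OF nq, of 2] by (simp add: power_mult_distrib)
  \<comment> \<open>In the criterion for \<open>ball 0 2\<close> the positive terms add up to at
    most (25/4 + 4 + 1) s, less than the 14 s gained from the component along \<open>\<nu>\<close>;
    this uses s \<le> 1/4 and d \<le> s.\<close>
  have ss: "25 * s\<^sup>2 \<le> 25/4 * s" using s s0 by (simp add: power2_eq_square)
  have dd: "d\<^sup>2 \<le> s" using d s d0 mult_mono[of d 1 d s] by (simp add: power2_eq_square)
  have "2 * (2 + d) * (q \<bullet> \<nu>) \<le> 4 * (q \<bullet> \<nu>)" using \<nu>1(2) d0 s0 by (simp add: algebra_simps mult_nonneg_nonpos)
  then have "(norm q)\<^sup>2 + 2 * (2 + d) * (q \<bullet> \<nu>) + 4 * d + d\<^sup>2 < 0"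
    using nq2 ss dd \<nu>1(2) d(2) s0 by linarith
  then show xB: "x \<in> ball 0 2" using in_ball_iff[OF xq] by simp
  note p = pole_facts[OF d(1) xB]
  have nq1: "25/2 * s\<^sup>2 \<le> (norm q)\<^sup>2"
  proof -
    have "(q \<bullet> e)\<^sup>2 + (q \<bullet> \<nu>)\<^sup>2 = (\<Sum>b\<in>{e, \<nu>}. (q \<bullet> b)\<^sup>2)" using e\<nu> by simp
    also have "\<dots> \<le> (\<Sum>b\<in>Basis. (q \<bullet> b)\<^sup>2)" using e \<nu> by (intro sum_mono2) auto
    also have "\<dots> = (norm q)\<^sup>2" unfolding power2_norm_eq_inner by (subst euclidean_inner) (simp add: power2_eq_square)
    finally have "(q \<bullet> e)\<^sup>2 + (q \<bullet> \<nu>)\<^sup>2 \<le> (norm q)\<^sup>2" .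
    moreover have "(s / 2)\<^sup>2 \<le> (q \<bullet> e)\<^sup>2" using e1 s0 by (intro power_mono) auto
    moreover have "(7/2 * s)\<^sup>2 \<le> (- (q \<bullet> \<nu>))\<^sup>2" using \<nu>1 s0 by (intro power_mono) auto
    ultimately show ?thesis by (simp add: power_mult_distrib power_divide)
  qed
  have n0: "0 < (norm q)\<^sup>2" using p(3) by (simp add: q_def)
  define R where "R = inv_sq (pole d) x"
  define \<tau> where "\<tau> = (q \<bullet> e)\<^sup>2 * R"
  have R: "R = 1 / (norm q)\<^sup>2" by (simp add: R_def inv_sq_norm q_def)
  have R0: "0 \<le> R" by (simp add: R)
  have k: "kelvin (pole d) e x = (q \<bullet> e) * R" by (simp add: kelvin_def R_def q_def)
  have tR: "(kelvin (pole d) e x)\<^sup>2 = \<tau> * R" by (simp add: k \<tau>_def power2_eq_square)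
  have \<tau>1: "1/100 \<le> \<tau>"
  proof -
    have "(s / 2)\<^sup>2 \<le> (q \<bullet> e)\<^sup>2" using e1 s0 by (intro power_mono) auto
    then have "(norm q)\<^sup>2 * (1/100) \<le> (q \<bullet> e)\<^sup>2" using nq2 by (simp add: power_divide)
    then show ?thesis unfolding \<tau>_def R using n0 by (simp add: field_simps)
  qed
  have \<tau>2: "\<tau> \<le> 9/50"
  proof -
    have "(q \<bullet> e)\<^sup>2 \<le> (3/2 * s)\<^sup>2" using e1 s0 by (intro power_mono) auto
    also have "\<dots> = 9/50 * (25/2 * s\<^sup>2)" by (simp add: power2_eq_square)
    also have "\<dots> \<le> 9/50 * (norm q)\<^sup>2" using nq1 by (intro mult_left_mono) auto
    finally show ?thesis unfolding \<tau>_def R using n0 by (simp add: field_simps)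
  qed
  have "laplacian (sol d) x \<le> - (1/2 * (1/100) ^ m * R ^ m)"
    unfolding laplacian_sol[OF d(1) xB] R_def[symmetric]
    by (rule laplacian_upper_bound[OF m K200 R0 tR \<tau>1 \<tau>2 G1[OF p(4)] G2[OF p(4)]])
  moreover have "(1/25) ^ m / s ^ (2 * m) \<le> R ^ m"
  proof -
    have "1 / (25 * s\<^sup>2) \<le> R" unfolding R using nq2 n0 s0 by (intro divide_left_mono) auto
    then have "(1 / (25 * s\<^sup>2)) ^ m \<le> R ^ m" by (rule power_mono) simp
    then show ?thesis by (simp add: power_divide power_mult_distrib power_mult)
  qed
  then have "1/2 * (1/100) ^ m * ((1/25) ^ m / s ^ (2 * m)) \<le> 1/2 * (1/100) ^ m * R ^ m"
    by (rule mult_left_mono) simp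
  ultimately show "1/2 * (1/100) ^ m * (1/25) ^ m / s ^ (2 * m) \<le> - laplacian (sol d) x" by simp
qed

text \<open>The lower bound for the negative Laplacian times the volume of a ball of radius s/2; the
  powers of s cancel in dimension 2 m.\<close>

definition \<kappa> :: real where
  "\<kappa> = 1/2 * (1/100) ^ m * (1/25) ^ m * ((1/2) ^ (2 * m) * unit_ball_vol (real (2 * m)))"

text \<open>By scaling, each of the disjoint dyadic balls in the cone contributes the same amount
  \<open>\<kappa>\<close>.\<close>

lemma neg_laplacian_integral_ge:
  assumes d: "1 / K\<^sup>2 \<le> d" "d \<le> (1/2) ^ (N + 2)" and K200: "200 * real m \<le> K"
  shows "ennreal (real N * \<kappa>) \<le> (\<integral>\<^sup>+x\<in>ball 0 2. ennreal (max (- laplacian (sol d) x) 0) \<partial>lborel)"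
proof -
  define s :: "nat \<Rightarrow> real" where "s j = (1/2) ^ (j + 2)" for j
  define A where "A j = ball (pole d + s j *\<^sub>R (e - 4 *\<^sub>R \<nu>)) (s j / 2)" for j
  define v where "v j = 1/2 * (1/100) ^ m * (1/25) ^ m / s j ^ (2 * m)" for j
  have s0: "0 < s j" for j by (simp add: s_def)
  have s4: "s j \<le> 1/4" for j using power_decreasing[of 2 "j + 2" "1/2 :: real"] by (simp add: s_def power2_eq_square)
  have sd: "d \<le> s j" if "j < N" for j
  proof -
    have "(1/2 :: real) ^ (N + 2) \<le> (1/2) ^ (j + 2)" by (rule power_decreasing) (use that in auto)
    then show ?thesis using d(2) unfolding s_def by linarith
  qed
  have v0: "0 \<le> v j" for j using s0[of j] by (simp add: v_def)
  note F = laplacian_sol_le_scaled[OF d(1) sd s4 K200, folded A_def v_def]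
  \<comment> \<open>The balls lie in slabs orthogonal to \<open>\<nu>\<close>. Halving the scale
    separates them: - 9/2 s_j \<ge> - 9/4 s_i > - 7/2 s_i.\<close>
  have disj: "x \<notin> A j" if "x \<in> A i" "i < N" "j < N" "i < j" for x i j
  proof
    assume "x \<in> A j"
    then have "(x - pole d) \<bullet> \<nu> > - (9/2) * s j" using F(2)[OF that(3)] by simp
    moreover have "(x - pole d) \<bullet> \<nu> < - (7/2) * s i" using F(2)[OF that(2,1)] by simp
    moreover have "s j \<le> s i / 2"
      using power_decreasing[of "Suc (i + 2)" "j + 2" "1/2 :: real"] that(4) by (simp add: s_def)
    ultimately show False using s0[of i] by linarith
  qed
  have pw: "(\<Sum>j<N. ennreal (v j) * indicator (A j) x)
      \<le> ennreal (max (- laplacian (sol d) x) 0) * indicator (ball 0 2) x" for x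
  proof (cases "\<exists>i<N. x \<in> A i")
    case True
    then obtain i where i: "i < N" "x \<in> A i" by blast
    have "(\<Sum>j<N. ennreal (v j) * indicator (A j) x) = (\<Sum>j\<in>{i}. ennreal (v j) * indicator (A j) x)"
    proof (rule sum.mono_neutral_right)
      show "\<forall>j\<in>{..<N} - {i}. ennreal (v j) * indicator (A j) x = 0"
      proof
        fix j assume "j \<in> {..<N} - {i}"
        then have "x \<notin> A j" using i disj[of x i j] disj[of x j i] by (cases "i < j") auto
        then show "ennreal (v j) * indicator (A j) x = 0" by simp
      qed
    qed (use i in auto)
    also have "\<dots> = ennreal (v i)" using i by simp
    also have "\<dots> \<le> ennreal (max (- laplacian (sol d) x) 0)"
      using F(3)[OF i] by (intro ennreal_leI) simp
    finally show ?thesis using F(1)[OF i] by simp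
  next
    case False
    then have "(\<Sum>j<N. ennreal (v j) * indicator (A j) x) = 0" by (intro sum.neutral) auto
    then show ?thesis by simp
  qed
  have vol: "ennreal (v j) * emeasure lborel (A j) = ennreal \<kappa>" for j
  proof -
    have "emeasure lborel (A j) = ennreal (unit_ball_vol (real (2 * m)) * (s j / 2) ^ (2 * m))"
      unfolding A_def using s0[of j] by (subst emeasure_ball) (auto simp: dim)
    moreover have "v j * (unit_ball_vol (real (2 * m)) * (s j / 2) ^ (2 * m)) = \<kappa>"
      using s0[of j] by (simp add: v_def \<kappa>_def power_divide)
    ultimately show ?thesis using v0[of j] by (metis ennreal_mult')
  qed
  have "ennreal (real N * \<kappa>) = (\<Sum>j<N. ennreal (v j) * emeasure lborel (A j))"
    unfolding vol by (simp add: ennreal_mult' ennreal_of_nat_eq_real_of_nat)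
  also have "\<dots> = (\<integral>\<^sup>+x. (\<Sum>j<N. ennreal (v j) * indicator (A j) x) \<partial>lborel)"
  proof -
    have mA: "A j \<in> sets lborel" for j by (simp add: A_def)
    have "(\<lambda>x. ennreal (v j) * indicator (A j) x) \<in> borel_measurable lborel" for j
      using mA[of j] by measurable
    then show ?thesis
      unfolding nn_integral_cmult_indicator[OF mA, symmetric] by (rule nn_integral_sum[symmetric])
  qed
  also have "\<dots> \<le> (\<integral>\<^sup>+x\<in>ball 0 2. ennreal (max (- laplacian (sol d) x) 0) \<partial>lborel)"
    by (intro nn_integral_mono pw)
  finally show ?thesis .
qed

text \<open>On \<open>ball 0 1\<close> the pole is at distance more than 1, so \<open>inv_sq\<close>
  and |\<open>kelvin\<close>| are at most 1. This bounds all three terms of the Laplacian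
  independently of \<open>K\<close> and \<open>d\<close>.\<close>

lemma laplacian_integral_le:
  assumes d: "1 / K\<^sup>2 \<le> d"
  shows "(\<integral>\<^sup>+x\<in>ball 0 1. ennreal \<bar>laplacian (sol d) x\<bar> \<partial>lborel)
    \<le> ennreal ((20 * (real m)\<^sup>2 + 1) * measure lborel (ball 0 1 :: 'a set))"
proof -
  have b: "\<bar>laplacian (sol d) x\<bar> \<le> 20 * (real m)\<^sup>2 + 1" if x1: "x \<in> ball 0 1" for x
  proof -
    have x: "x \<in> ball 0 2" using x1 by simp
    note p = pole_facts[OF d x]
    have n: "1 < norm (x - pole d)" using norm_pole[of d x 1] x1 p(1) by simp
    then have "1 \<le> (norm (x - pole d))\<^sup>2" by (simp add: power2_eq_square less_imp_le mult_ge1_I)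
    then have R: "0 \<le> inv_sq (pole d) x" "inv_sq (pole d) x \<le> 1" by (simp_all add: inv_sq_norm divide_le_eq_1)
    define t where "t = kelvin (pole d) e x"
    have "1 / norm (x - pole d) \<le> 1" using n by (subst divide_le_eq_1_pos) linarith+
    then have t: "\<bar>t\<bar> \<le> 1" using kelvin_le[OF ee(1), of "pole d" x] unfolding t_def by linarith
    then have tp: "\<bar>t\<bar> ^ k \<le> 1" for k by (simp add: power_le_one)
    have tK: "\<bar>t\<bar> ^ k / K \<le> 1" for k using tp[of k] K by (simp add: divide_le_eq)
    have "\<bar>(2 * real m - 2) * t ^ (2 * m - 3)\<bar> \<le> (2 * real m - 2) * 1"
      unfolding abs_mult power_abs using m tp by (intro mult_mono) auto
    moreover have tri: "\<bar>g\<bar> \<le> \<bar>g + X\<bar> + \<bar>X\<bar>" for g X :: real by linarith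
    note tri[of "G 1 t" "(2 * real m - 2) * t ^ (2 * m - 3)"] G1[OF p(4), folded t_def] tK[of "2 * m - 3"]
    ultimately have g1: "\<bar>G 1 t\<bar> \<le> 2 * real m" by simp
    have "\<bar>(2 * real m - 2) * (2 * real m - 3) * t ^ (2 * m - 4)\<bar> \<le> (2 * real m - 2) * (2 * real m - 3) * 1"
      unfolding abs_mult[of "(2 * real m - 2) * (2 * real m - 3)"] power_abs using m tp by (intro mult_mono) auto
    also have "\<dots> \<le> 2 * real m * (2 * real m) * 1" using m by (intro mult_mono) auto
    finally have g2: "\<bar>G 2 t\<bar> \<le> 4 * (real m)\<^sup>2 + 1"
      using G2[OF p(4), folded t_def] tK[of "2 * m - 4"] tri[of "G 2 t" "(2 * real m - 2) * (2 * real m - 3) * t ^ (2 * m - 4)"]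
      by (simp add: power2_eq_square)
    let ?R = "inv_sq (pole d) x"
    have a1: "\<bar>?R\<^sup>2 * G 2 t\<bar> \<le> 1 * (4 * (real m)\<^sup>2 + 1)"
      unfolding abs_mult using R g2 by (intro mult_mono) (auto simp: power_le_one)
    have a2: "\<bar>(4 * real m - 4) * (?R * (t * G 1 t))\<bar> \<le> 4 * real m * (1 * (1 * (2 * real m)))"
      unfolding abs_mult using R g1 t m by (intro mult_mono) auto
    have a3: "\<bar>(4 * real m - 4) * ?R\<bar> \<le> 4 * real m * 1"
      unfolding abs_mult using R m by (intro mult_mono) auto
    have "real m \<le> (real m)\<^sup>2" using m by (simp add: power2_eq_square)
    have abs3: "\<bar>X - Y - Z\<bar> \<le> w" if "\<bar>X\<bar> \<le> x" "\<bar>Y\<bar> \<le> y" "\<bar>Z\<bar> \<le> z" "x + y + z \<le> w" for X Y Z x y z w :: real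
      using that by linarith
    show ?thesis
      unfolding laplacian_sol[OF d x] t_def[symmetric]
      by (rule abs3[OF a1 a2 a3]) (use \<open>real m \<le> (real m)\<^sup>2\<close> in \<open>simp add: power2_eq_square\<close>)
  qed
  have "(\<integral>\<^sup>+x\<in>ball 0 1. ennreal \<bar>laplacian (sol d) x\<bar> \<partial>lborel)
      \<le> (\<integral>\<^sup>+x\<in>(ball 0 1 :: 'a set). ennreal (20 * (real m)\<^sup>2 + 1) \<partial>lborel)"
  proof (rule nn_integral_mono)
    fix x :: 'a
    show "ennreal \<bar>laplacian (sol d) x\<bar> * indicator (ball 0 1) x \<le> ennreal (20 * (real m)\<^sup>2 + 1) * indicator (ball 0 1) x"
      using ennreal_leI[OF b[of x]] by (cases "x \<in> ball 0 1") simp_all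
  qed
  also have "\<dots> = ennreal (20 * (real m)\<^sup>2 + 1) * emeasure lborel (ball 0 1 :: 'a set)"
    by (rule nn_integral_cmult_indicator) simp
  also have "\<dots> = ennreal ((20 * (real m)\<^sup>2 + 1) * measure lborel (ball 0 1 :: 'a set))"
    using ball_finite[of "0 :: 'a" 1] by (subst emeasure_eq_ennreal_measure) (auto simp: ennreal_mult')
  finally show ?thesis .
qed

text \<open>Only a box near the pole is integrated over. There f \<ge> - a - 2 since |t| \<le> 1,
  which gives exp (- 4 m) / K^5, and \<open>inv_sq\<close> is at least 1 / ((10 + 2 m) d^2).\<close>

lemma mass_ge:
  assumes K200: "200 * real m \<le> K"
  shows "exp (- (4 * real m)) * (1 / (10 + 2 * real m)) ^ (2 * m) * K \<le> mass (1 / K\<^sup>2)"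
proof -
  define d where "d = 1 / K\<^sup>2"
  have m2: "2 \<le> real m" using m by simp
  have K0: "0 < K" using K by linarith
  have d0: "0 < d" using K0 by (simp add: d_def)
  have dK: "1 / K\<^sup>2 \<le> d" by (simp add: d_def)
  have Kd: "d * K\<^sup>2 = 1" using K0 by (simp add: d_def)
  have "K \<le> K\<^sup>2" using K by (simp add: power2_eq_square)
  then have "d * K \<le> 1" using Kd d0 by (metis mult_left_mono less_imp_le)
  then have "d * (200 * real m) \<le> 1" using mult_left_mono[OF K200, of d] d0 by linarith
  moreover have "d * (2 * real m + 5) \<le> d * (200 * real m)" using m2 d0 by (intro mult_left_mono) auto
  ultimately have "d * (2 * real m + 5) \<le> 1" by linarith
  then have dm: "(2 * real m + 5) * d \<le> 1" by (simp only: mult.commute)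
  have "1 * d \<le> (2 * real m + 5) * d" using d0 by (intro mult_right_mono) auto
  then have d1: "d \<le> 1" using dm by linarith
  have dd: "d\<^sup>2 \<le> d" using d0 d1 by (simp add: power2_eq_square mult_left_le_one_le)
  \<comment> \<open>Side lengths relative to the pole. Width of order d^2 along \<open>e\<close>
    gives |t| \<le> d^2 / (4 d^2); depth between 2 d and 3 d towards the ball outweighs the gap d,
    so the box lies in \<open>ball 0 2\<close>; width of order d elsewhere keeps the distance to the
    pole of order d.\<close>
  define lo where "lo b = (if b = \<nu> then - (3 * d) else if b = e then - d\<^sup>2 else - d)" for b
  define hi where "hi b = (if b = \<nu> then - (2 * d) else if b = e then d\<^sup>2 else d)" for b
  define B where "B = cbox (pole d + (\<Sum>b\<in>Basis. lo b *\<^sub>R b)) (pole d + (\<Sum>b\<in>Basis. hi b *\<^sub>R b))"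
  define W where "W = 1 / K ^ 5 * exp (- (4 * real m)) * (1 / ((10 + 2 * real m) * d\<^sup>2)) ^ (2 * m)"
  have W0: "0 \<le> W" using K0 by (simp add: W_def)
  have key: "x \<in> ball 0 2 \<and> W \<le> exp (2 * real m * sol d x)" if x: "x \<in> B" for x
  proof -
    define q where "q = x - pole d"
    have xq: "x = pole d + q" by (simp add: q_def)
    have bd: "lo b \<le> q \<bullet> b" "q \<bullet> b \<le> hi b" if "b \<in> Basis" for b
      using x that unfolding B_def mem_box q_def by (auto simp: inner_add_left inner_diff_left)
    have q\<nu>: "- (3 * d) \<le> q \<bullet> \<nu>" "q \<bullet> \<nu> \<le> - (2 * d)" using bd[OF \<nu>] by (simp_all add: lo_def hi_def)
    have qe: "\<bar>q \<bullet> e\<bar> \<le> d\<^sup>2" using bd[OF e] e\<nu> by (simp add: lo_def hi_def abs_le_iff)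
    have sqb: "(q \<bullet> b)\<^sup>2 \<le> d\<^sup>2 + (if b = \<nu> then 8 * d\<^sup>2 else 0)" if "b \<in> Basis" for b
    proof (cases "b = \<nu>")
      case True
      have "(- (q \<bullet> \<nu>))\<^sup>2 \<le> (3 * d)\<^sup>2" using q\<nu> d0 by (intro power_mono) auto
      then show ?thesis using True by (simp add: power_mult_distrib)
    next
      case False
      then have "\<bar>q \<bullet> b\<bar> \<le> d" using bd[OF that] dd by (auto simp: lo_def hi_def abs_le_iff split: if_splits)
      then show ?thesis using False d0 power_mono[of "\<bar>q \<bullet> b\<bar>" d 2] by simp
    qed
    have nq: "(norm q)\<^sup>2 = (\<Sum>b\<in>Basis. (q \<bullet> b)\<^sup>2)"
      unfolding power2_norm_eq_inner by (subst euclidean_inner) (simp add: power2_eq_square)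
    also have "\<dots> \<le> (\<Sum>b\<in>Basis. d\<^sup>2 + (if b = \<nu> then 8 * d\<^sup>2 else 0))" by (rule sum_mono) (rule sqb)
    also have "\<dots> = (2 * real m + 8) * d\<^sup>2"
      using \<nu> by (simp add: sum.distrib dim algebra_simps)
    finally have nq2: "(norm q)\<^sup>2 \<le> (2 * real m + 8) * d\<^sup>2" .
    have "(2 * d)\<^sup>2 \<le> (- (q \<bullet> \<nu>))\<^sup>2" using q\<nu> d0 by (intro power_mono) auto
    also have "(- (q \<bullet> \<nu>))\<^sup>2 \<le> (norm q)\<^sup>2" unfolding nq
      using member_le_sum[OF \<nu>, of "\<lambda>b. (q \<bullet> b)\<^sup>2"] by simp
    finally have nq1: "4 * d\<^sup>2 \<le> (norm q)\<^sup>2" by (simp add: power_mult_distrib)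
    have "2 * (2 + d) * (q \<bullet> \<nu>) \<le> 2 * (2 + d) * (- (2 * d))"
      using q\<nu>(2) d0 by (intro mult_left_mono) auto
    then have "(norm q)\<^sup>2 + 2 * (2 + d) * (q \<bullet> \<nu>) + 4 * d + d\<^sup>2
        \<le> (2 * real m + 8) * d\<^sup>2 + 2 * (2 + d) * (- (2 * d)) + 4 * d + d\<^sup>2"
      using nq2 by linarith
    also have "\<dots> = ((2 * real m + 5) * d - 4) * d" by (simp add: power2_eq_square algebra_simps)
    also have "\<dots> < 0" using dm d0 by (intro mult_neg_pos) auto
    finally have xB: "x \<in> ball 0 2" using in_ball_iff[OF xq] by simp
    note p = pole_facts[OF dK xB]
    have n0: "0 < (norm q)\<^sup>2" using p(3) by (simp add: q_def)
    define R where "R = inv_sq (pole d) x"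
    have R: "R = 1 / (norm q)\<^sup>2" by (simp add: R_def inv_sq_norm q_def)
    define t where "t = kelvin (pole d) e x"
    have "\<bar>t\<bar> = \<bar>q \<bullet> e\<bar> / (norm q)\<^sup>2" by (simp add: t_def kelvin_def R_def[symmetric] R q_def abs_mult)
    also have "\<dots> \<le> 1"
    proof -
      have "\<bar>q \<bullet> e\<bar> \<le> (norm q)\<^sup>2" using qe nq1 zero_le_power2[of d] by linarith
      then show ?thesis using n0 by simp
    qed
    finally have "\<bar>t\<bar> ^ (2 * m - 2) \<le> 1" by (simp add: power_le_one)
    moreover have "t ^ (2 * m - 2) \<le> \<bar>t\<bar> ^ (2 * m - 2)" by (simp flip: power_abs)
    ultimately have "- a - 2 \<le> G 0 t" using G0_ge[OF p(4), folded t_def] by linarith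
    then have "2 * real m * (- a - 2) \<le> 2 * real m * G 0 t" by (intro mult_left_mono) auto
    then have "exp (2 * real m * (- a) + - (4 * real m)) \<le> exp (2 * real m * G 0 t)"
      by (simp add: algebra_simps)
    then have E: "1 / K ^ 5 * exp (- (4 * real m)) \<le> exp (2 * real m * G 0 t)"
      unfolding exp_add exp_minus_a .
    have "(2 * real m + 8) * d\<^sup>2 \<le> (10 + 2 * real m) * d\<^sup>2" by (intro mult_right_mono) auto
    then have "(norm q)\<^sup>2 \<le> (10 + 2 * real m) * d\<^sup>2" using nq2 by linarith
    then have "1 / ((10 + 2 * real m) * d\<^sup>2) \<le> R"
      unfolding R using n0 d0 by (intro divide_left_mono mult_pos_pos) auto
    then have "(1 / ((10 + 2 * real m) * d\<^sup>2)) ^ (2 * m) \<le> R ^ (2 * m)" by (rule power_mono) simp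
    then have "W \<le> exp (2 * real m * G 0 t) * R ^ (2 * m)"
      unfolding W_def using E by (intro mult_mono) auto
    then show ?thesis unfolding exp_sol[OF dK xB] using xB by (simp add: t_def R_def)
  qed
  have mB: "d ^ (2 * m + 1) \<le> measure lborel B"
  proof -
    define g where "g b = (if b = e then d\<^sup>2 else d)" for b
    have bx: "(pole d + (\<Sum>b\<in>Basis. h b *\<^sub>R b)) \<bullet> b = pole d \<bullet> b + h b" if "b \<in> Basis" for b :: 'a and h
      using that by (simp add: inner_add_left)
    have le: "lo b \<le> hi b" for b using d0 by (auto simp: lo_def hi_def)
    have gl: "0 \<le> g b \<and> g b \<le> hi b - lo b" for b using d0 e\<nu> by (auto simp: g_def lo_def hi_def)
    have "d ^ (2 * m + 1) = d\<^sup>2 * d ^ (2 * m - 1)" using m by (simp flip: power_add)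
    also have "\<dots> = (\<Prod>b\<in>Basis. g b)"
    proof -
      have "(\<Prod>b\<in>Basis - {e}. g b) = (\<Prod>b\<in>Basis - {e}. d)" by (rule prod.cong) (auto simp: g_def)
      also have "\<dots> = d ^ (2 * m - 1)" using e by (simp add: card_Diff_singleton dim)
      finally show ?thesis using prod.remove[OF finite_Basis e, of g] by (simp add: g_def)
    qed
    also have "\<dots> \<le> (\<Prod>b\<in>Basis. hi b - lo b)" by (rule prod_mono) (rule gl)
    also have "\<dots> = measure lborel B"
    proof -
      have "measure lborel B = (\<Prod>b\<in>Basis. ((pole d + (\<Sum>b\<in>Basis. hi b *\<^sub>R b)) - (pole d + (\<Sum>b\<in>Basis. lo b *\<^sub>R b))) \<bullet> b)"
        unfolding B_def by (rule measure_lborel_cbox) (simp add: bx le)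
      also have "\<dots> = (\<Prod>b\<in>Basis. hi b - lo b)" by (rule prod.cong) (simp_all add: inner_diff_left)
      finally show ?thesis by simp
    qed
    finally show ?thesis .
  qed
  have Bfin: "emeasure lborel B < \<infinity>" unfolding B_def by (rule emeasure_bounded_finite[OF bounded_cbox])
  have "W * measure lborel B = (LINT x|lborel. W * indicator B x)" by (simp add: B_def)
  also have "\<dots> \<le> mass d"
    unfolding mass_def set_lebesgue_integral_def
  proof (rule integral_mono)
    show "integrable lborel (\<lambda>x. W * indicator B x)"
      using Bfin by (intro integrable_mult_right integrable_real_indicator) (simp_all add: B_def)
    show "integrable lborel (\<lambda>x. indicator (ball 0 2) x *\<^sub>R exp (2 * real m * sol d x))"
      using exp_sol_integrable[OF dK] by (simp add: set_integrable_def)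
    show "W * indicator B x \<le> indicator (ball 0 2) x *\<^sub>R exp (2 * real m * sol d x)" for x
      using key[of x] by (cases "x \<in> B") (simp_all add: indicator_def)
  qed
  finally have "W * measure lborel B \<le> mass d" .
  moreover have "W * d ^ (2 * m + 1) \<le> W * measure lborel B" by (rule mult_left_mono[OF mB W0])
  moreover have "exp (- (4 * real m)) * (1 / (10 + 2 * real m)) ^ (2 * m) * K \<le> W * d ^ (2 * m + 1)"
  proof -
    \<comment> \<open>Powers of \<open>K\<close>: - 5 from the density and 2 (2 m - 1) from
      d^(-(2m-1)). The total 4 m - 7 is 4 k + 1, hence at least 1.\<close>
    obtain k where k: "m = k + 2" using le_Suc_ex[OF m] by (metis add.commute)
    have "(1 / d\<^sup>2) ^ (2 * m) * d ^ (2 * m + 1) = K ^ (4 * m - 2)"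
    proof -
      have "(1 / d\<^sup>2) ^ (2 * m) = (1 / d) ^ (2 * m - 1) * (1 / d) ^ (2 * m + 1)"
      proof -
        have "(1 / d\<^sup>2) ^ (2 * m) = (1 / d) ^ (2 * (2 * m))" unfolding power_mult by (simp add: power_one_over)
        also have "2 * (2 * m) = (2 * m - 1) + (2 * m + 1)" using m by auto
        finally show ?thesis unfolding power_add .
      qed
      moreover have "(1 / d) ^ (2 * m + 1) * d ^ (2 * m + 1) = 1" using d0 by (simp flip: power_mult_distrib)
      moreover have "(1 / d) ^ (2 * m - 1) = K ^ (4 * m - 2)"
      proof -
        have "1 / d = K\<^sup>2" by (simp add: d_def)
        then have "(1 / d) ^ (2 * m - 1) = K ^ (2 * (2 * m - 1))" unfolding power_mult by simp
        also have "2 * (2 * m - 1) = 4 * m - 2" by simp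
        finally show ?thesis .
      qed
      ultimately show ?thesis by (simp only: mult.assoc mult_1_right)
    qed
    moreover have "1 / K ^ 5 * K ^ (4 * m - 2) = K ^ (4 * k + 1)"
    proof -
      have "4 * m - 2 = 5 + (4 * k + 1)" by (simp add: k)
      then have "K ^ (4 * m - 2) = K ^ 5 * K ^ (4 * k + 1)" by (simp only: power_add)
      then show ?thesis using K0 by simp
    qed
    moreover have "W * d ^ (2 * m + 1) = exp (- (4 * real m)) * (1 / (10 + 2 * real m)) ^ (2 * m)
        * (1 / K ^ 5 * ((1 / d\<^sup>2) ^ (2 * m) * d ^ (2 * m + 1)))"
    proof -
      have "(1 / ((10 + 2 * real m) * d\<^sup>2)) ^ (2 * m) = (1 / (10 + 2 * real m)) ^ (2 * m) * (1 / d\<^sup>2) ^ (2 * m)"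
        by (simp flip: power_mult_distrib)
      then show ?thesis unfolding W_def by (simp only: mult_ac)
    qed
    ultimately have "W * d ^ (2 * m + 1) = exp (- (4 * real m)) * (1 / (10 + 2 * real m)) ^ (2 * m) * K ^ (4 * k + 1)"
      by simp
    moreover have "K ^ 1 \<le> K ^ (4 * k + 1)" using K by (intro power_increasing) auto
    ultimately show ?thesis by (simp add: mult_left_mono)
  qed
  ultimately show ?thesis unfolding d_def by linarith
qed

text \<open>Intermediate value theorem between \<open>1 / K ^ 2\<close> and 1: \<open>K1\<close>
  feeds \<open>mass_ge\<close> at the left end, \<open>K2\<close> feeds \<open>mass_le\<close> at
  the right end. The final bound weakens \<open>K ^ 5\<close> to \<open>K\<close>; it still sends d
  to 0 as \<open>K\<close> grows.\<close>

lemma exists_sol_mass: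
  fixes \<Lambda> :: real
  assumes K200: "200 * real m \<le> K" and \<Lambda>: "0 < \<Lambda>"
    and K1: "\<Lambda> \<le> exp (- (4 * real m)) * (1 / (10 + 2 * real m)) ^ (2 * m) * K"
    and K2: "measure lborel (ball 0 2 :: 'a set) \<le> \<Lambda> * K ^ 5"
  obtains d where "1 / K\<^sup>2 \<le> d" "mass d = \<Lambda>"
    "d ^ (4 * m) \<le> measure lborel (ball 0 2 :: 'a set) / (\<Lambda> * K)"
proof -
  have K0: "0 < K" using K by linarith
  have K2': "1 / K\<^sup>2 \<le> 1" using K by simp
  have "mass 1 \<le> 1 / K ^ 5 * measure lborel (ball 0 2 :: 'a set)" using mass_le[OF K2'] by simp
  also have "\<dots> \<le> 1 / K ^ 5 * (\<Lambda> * K ^ 5)" using K2 K0 by (intro mult_left_mono) auto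
  also have "\<dots> = \<Lambda>" using K0 by simp
  finally have "mass 1 \<le> \<Lambda>" .
  moreover have "\<Lambda> \<le> mass (1 / K\<^sup>2)" using mass_ge[OF K200] K1 by linarith
  ultimately obtain d where d: "1 / K\<^sup>2 \<le> d" "d \<le> 1" "mass d = \<Lambda>"
    using IVT2'[of mass 1 \<Lambda> "1 / K\<^sup>2"] K2' continuous_mass by auto
  have "0 < 1 / K\<^sup>2" using K0 by simp
  then have d0: "0 < d" using d by linarith
  have "\<Lambda> \<le> 1 / K ^ 5 * (1 / d\<^sup>2) ^ (2 * m) * measure lborel (ball 0 2 :: 'a set)"
    using mass_le[OF d(1)] d(3) by simp
  also have "(1 / d\<^sup>2) ^ (2 * m) = 1 / d ^ (4 * m)" by (simp add: power_one_over flip: power_mult)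
  finally have "\<Lambda> * (K ^ 5 * d ^ (4 * m)) \<le> measure lborel (ball 0 2 :: 'a set)"
    using K0 d0 by (simp add: field_simps)
  moreover have "\<Lambda> * (K * d ^ (4 * m)) \<le> \<Lambda> * (K ^ 5 * d ^ (4 * m))"
    using \<Lambda> d0 power_increasing[of 1 5 K] K by (intro mult_left_mono mult_right_mono) auto
  ultimately have "\<Lambda> * (K * d ^ (4 * m)) \<le> measure lborel (ball 0 2 :: 'a set)" by (rule order_trans[rotated])
  then have "d ^ (4 * m) \<le> measure lborel (ball 0 2 :: 'a set) / (\<Lambda> * K)"
    using \<Lambda> K0 by (subst pos_le_divide_eq) (simp_all add: mult_ac)
  then show ?thesis using that d by blast
qed

end

text \<open>The bound on the unit ball does not depend on \<open>N\<close>, so it serves as the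
  common constant for a whole sequence of such functions.\<close>

lemma exists_solution:
  fixes m :: nat and \<Lambda> :: real
  assumes m: "m \<ge> 2" and dim: "DIM('a::euclidean_space) = 2 * m" and \<Lambda>: "0 < \<Lambda>"
  shows "\<exists>u :: 'a \<Rightarrow> real. Q_solution m (ball 0 2) u \<and>
    (\<integral>\<^sup>+x\<in>ball 0 2. ennreal (exp (2 * real m * u x)) \<partial>lborel) = ennreal \<Lambda> \<and>
    (\<integral>\<^sup>+x\<in>ball 0 1. ennreal \<bar>laplacian u x\<bar> \<partial>lborel)
      \<le> ennreal ((20 * (real m)\<^sup>2 + 1) * measure lborel (ball 0 1 :: 'a set)) \<and>
    ennreal (real N) \<le> (\<integral>\<^sup>+x\<in>ball 0 2. ennreal (max (- laplacian u x) 0) \<partial>lborel)"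
proof -
  have "\<not> card (Basis :: 'a set) \<le> 1" using m dim by simp
  then obtain e \<nu> :: 'a where e\<nu>: "e \<in> Basis" "\<nu> \<in> Basis" "e \<noteq> \<nu>"
    by (auto simp: card_le_Suc0_iff_eq)
  interpret two_directions e \<nu> m by unfold_locales (use e\<nu> dim m in auto)
  define V where "V = measure lborel (ball 0 2 :: 'a set)"
  define c where "c = exp (- (4 * real m)) * (1 / (10 + 2 * real m)) ^ (2 * m)"
  have c: "0 < c" by (simp add: c_def add_pos_nonneg)
  \<comment> \<open>The value of \<open>\<kappa>\<close>, written out beforehand:
    \<open>\<kappa>\<close> belongs to \<open>kelvin_ode\<close>, which can be interpreted only
    after \<open>K\<close> is fixed, and \<open>K\<close> depends on this number through
    \<delta>.\<close>
  define \<kappa>' where "\<kappa>' = 1/2 * (1/100) ^ m * (1/25) ^ m * ((1/2) ^ (2 * m) * unit_ball_vol (real (2 * m)))"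
  have \<kappa>': "0 < \<kappa>'" by (simp add: \<kappa>'_def)
  \<comment> \<open>The number of dyadic balls whose joint contribution reaches \<open>N\<close>; a
    pole distance at most \<delta> leaves room for all of them.\<close>
  obtain N' where N': "real N / \<kappa>' \<le> real N'" using real_arch_simple by blast
  define \<delta> :: real where "\<delta> = (1/2) ^ (N' + 2)"
  have \<delta>: "0 < \<delta>" by (simp add: \<delta>_def)
  \<comment> \<open>The summands in order secure: the ODE estimates, the cone estimate, enough mass
    at the nearest pole, little mass at distance 1, and d \<le> \<delta>.\<close>
  define K where "K = 1 + 200 * real m + \<Lambda> / c + V / \<Lambda> + V / (\<Lambda> * \<delta> ^ (4 * m))"
  have V0: "0 \<le> V" by (simp add: V_def)
  have t0: "0 \<le> \<Lambda> / c" "0 \<le> V / \<Lambda>" "0 \<le> V / (\<Lambda> * \<delta> ^ (4 * m))"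
    using \<Lambda> c V0 \<delta> by simp_all
  then have bnd: "1 \<le> K" "200 * real m \<le> K" "\<Lambda> / c \<le> K" "V / \<Lambda> \<le> K" "V / (\<Lambda> * \<delta> ^ (4 * m)) \<le> K"
    unfolding K_def by linarith+
  obtain G a where ode: "deriv_seq {- (K ^ 2) <..< K ^ 2} G" "exp (2 * real m * a) = K ^ 5"
    "\<And>t. t \<in> {- (K ^ 2) <..< K ^ 2} \<Longrightarrow> G 0 t \<le> - a"
    "\<And>t. t \<in> {- (K ^ 2) <..< K ^ 2} \<Longrightarrow> - a - 2 * t ^ (2 * m - 2) \<le> G 0 t"
    "\<And>t. t \<in> {- (K ^ 2) <..< K ^ 2} \<Longrightarrow> \<bar>G 1 t + (2 * real m - 2) * t ^ (2 * m - 3)\<bar> \<le> \<bar>t\<bar> ^ (2 * m - 3) / K"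
    "\<And>t. t \<in> {- (K ^ 2) <..< K ^ 2} \<Longrightarrow> \<bar>G 2 t + (2 * real m - 2) * (2 * real m - 3) * t ^ (2 * m - 4)\<bar> \<le> \<bar>t\<bar> ^ (2 * m - 4) / K"
    "\<And>t. t \<in> {- (K ^ 2) <..< K ^ 2} \<Longrightarrow> G (2 * m) t = (- 1) ^ m * exp (2 * real m * G 0 t)"
    using ode_solution[OF m bnd(1)] by blast
  interpret kelvin_ode e \<nu> m G K a "{- (K ^ 2) <..< K ^ 2}"
    by unfold_locales (use ode bnd(1) in blast)+
  have k1: "\<Lambda> \<le> c * K" using bnd(3) c by (simp add: pos_divide_le_eq mult.commute)
  have "V \<le> \<Lambda> * K" using bnd(4) \<Lambda> by (simp add: pos_divide_le_eq mult.commute)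
  also have "\<dots> \<le> \<Lambda> * K ^ 5" using \<Lambda> bnd(1) power_increasing[of 1 5 K] by (intro mult_left_mono) auto
  finally have k2: "V \<le> \<Lambda> * K ^ 5" .
  obtain d where d: "1 / K\<^sup>2 \<le> d" "mass d = \<Lambda>" "d ^ (4 * m) \<le> V / (\<Lambda> * K)"
    using exists_sol_mass[OF bnd(2) \<Lambda> k1[unfolded c_def] k2[unfolded V_def], folded V_def] by blast
  have "V / (\<Lambda> * K) \<le> \<delta> ^ (4 * m)" using bnd(5) bnd(1) \<Lambda> \<delta> by (simp add: field_simps)
  then have "d ^ (4 * m) \<le> \<delta> ^ (4 * m)" using d(3) by linarith
  then have d\<delta>: "d \<le> \<delta>" using \<delta> m by (intro power_le_imp_le_base[of d "4 * m - 1" \<delta>]) auto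
  have "real N \<le> real N' * \<kappa>'" using N' \<kappa>' by (simp add: pos_divide_le_eq)
  then have "ennreal (real N) \<le> ennreal (real N' * \<kappa>')" by (rule ennreal_leI)
  also have "\<kappa>' = \<kappa>" by (simp only: \<kappa>'_def \<kappa>_def)
  finally have "ennreal (real N) \<le> (\<integral>\<^sup>+x\<in>ball 0 2. ennreal (max (- laplacian (sol d) x) 0) \<partial>lborel)"
    using neg_laplacian_integral_ge[OF d(1) d\<delta>[unfolded \<delta>_def] bnd(2)] by (rule order_trans)
  then show ?thesis
    using Q_solution_sol[OF d(1)] nn_integral_sol[OF d(1), unfolded d(2)] laplacian_integral_le[OF d(1)] by blast
qed

text \<open>The index type \<open>'n option\<close> has 2 m + 1 elements, so the sphere is S^(2m).
  The integrals take values in \<open>ennreal\<close>, where divergence of the negative part is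
  convergence to the top element; the k-th function is picked with negative part of integral at
  least k.\<close>

theorem theorem5:
  fixes m :: nat and \<Lambda> :: real
  assumes "m \<ge> 2" and "CARD('n::finite) = 2 * m"
    and "0 < \<Lambda>" and "\<Lambda> < fact (2 * m - 1) * sphere_vol (sphere (0 :: real ^ ('n option)) 1)"
  shows "\<exists>u :: nat \<Rightarrow> real ^ 'n \<Rightarrow> real.
    (\<forall>k. Q_solution m (ball 0 2) (u k)) \<and>
    (\<forall>k. (\<integral>\<^sup>+x\<in>ball 0 2. ennreal (exp (2 * real m * u k x)) \<partial>lborel) = ennreal \<Lambda>) \<and>
    (\<exists>C::real. \<forall>k. (\<integral>\<^sup>+x\<in>ball 0 1. ennreal \<bar>laplacian (u k) x\<bar> \<partial>lborel) \<le> ennreal C) \<and>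
    (\<lambda>k. \<integral>\<^sup>+x\<in>ball 0 2. ennreal (max (- laplacian (u k) x) 0) \<partial>lborel) \<longlonglongrightarrow> \<infinity>"
proof -
  have dim: "DIM(real ^ 'n) = 2 * m" using assms(2) by simp
  define u where "u k = (SOME u :: real ^ 'n \<Rightarrow> real. Q_solution m (ball 0 2) u \<and>
    (\<integral>\<^sup>+x\<in>ball 0 2. ennreal (exp (2 * real m * u x)) \<partial>lborel) = ennreal \<Lambda> \<and>
    (\<integral>\<^sup>+x\<in>ball 0 1. ennreal \<bar>laplacian u x\<bar> \<partial>lborel)
      \<le> ennreal ((20 * (real m)\<^sup>2 + 1) * measure lborel (ball 0 1 :: (real ^ 'n) set)) \<and>
    ennreal (real k) \<le> (\<integral>\<^sup>+x\<in>ball 0 2. ennreal (max (- laplacian u x) 0) \<partial>lborel))" for k :: nat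
  note u = someI_ex[OF exists_solution[OF assms(1) dim assms(3)], folded u_def]
  have "(\<lambda>k. \<integral>\<^sup>+x\<in>ball 0 2. ennreal (max (- laplacian (u k) x) 0) \<partial>lborel) \<longlonglongrightarrow> \<infinity>"
  proof (rule tendsto_sandwich[of "\<lambda>k. ennreal (real k)" _ _ "\<lambda>k. \<infinity>"])
    show "(\<lambda>k. ennreal (real k)) \<longlonglongrightarrow> \<infinity>"
      using of_nat_tendsto_top_ennreal by (simp add: ennreal_of_nat_eq_real_of_nat)
  qed (use u in simp_all)
  then show ?thesis using u by blast
qed

end
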